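(* Let $(f_w)_{w\in2\mathbb{N},\,w\ge6}$ denote the sequence of normalized extremal quasimodular forms of depth $3$ ($f_w$ of weight $w$). Then $$f_6=\frac{5E_2^3-3E_2E_4-2E_6}{51840},$$ and for every $w\ge6$ with $w\equiv0\pmod6$, $$f_{w+6}=\frac{(w+6)^3}{2^2\,3^7(w+1)(w+2)^3(w+4)^3(w+5)}\,K_w^{\mathrm{up}}f_w,$$ where $$K_w^{\mathrm{up}}f=48(7w^2+42w+60)\,\partial_{w-3}^3f-(15w^4+96w^3+151w^2-30w-116)E_4\,\partial_{w-3}f-\tfrac16(w+1)(9w^4+45w^3+40w^2+24w+144)E_6f.$$ Furthermore, for every $w\ge 6$ with $w\equiv0\pmod6$, $$f_{w+2}=\frac4{w+1}\partial_{w-3}f_w,\qquad f_{w+4}=\frac{2(w+3)^2}{27(w+1)(w+2)^3}\left(\frac{(w+1)(3w+1)}{48}E_4f_w-\partial_{w-3}^2f_w\right).$$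
   Context: $\mathcal{M}_k$ is the space of holomorphic modular forms of weight $k$ for $\mathrm{PSL}(2,\mathbb{Z})$ ($\mathcal{M}_k=0$ for $k<0$); $q=e^{2\pi iz}$; $E_{2k}=1-\frac{4k}{B_{2k}}\sum_{n\ge1}\sigma_{2k-1}(n)q^n$ ($k\ge1$). $f'=\frac1{2\pi i}\frac{df}{dz}$; the Serre derivative is $\partial_kf=f'-\frac k{12}E_2f$, iterated as $\partial_k^0f=f$, $\partial_k^{j+1}f=\partial_{k+2j}(\partial_k^jf)$. $\mathcal{QM}_w^3=\bigoplus_{\ell=0}^3E_2^\ell\mathcal{M}_{w-2\ell}$. A normalized extremal quasimodular form of weight $w$ and depth $3$ (meaning depth $\le 3$) is an element of $\mathcal{QM}_w^3$ of vanishing order $\dim\mathcal{QM}_w^3-1=\lfloor w/3\rfloor$ at $i\infty$ (in $q$) with leading coefficient $1$. *)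

theory Defs
  imports "HOL-Complex_Analysis.Complex_Analysis" "HOL-Library.Function_Algebras"
begin

section \<open>Functions on the upper half-plane and their \<open>q\<close>-expansions\<close>

definition upper_half_plane :: "complex set" where
  "upper_half_plane = {z. Im z > 0}"

definition nome :: "complex \<Rightarrow> complex" where
  "nome z = exp (2 * of_real pi * \<i> * z)"

definition has_q_expansion :: "(complex \<Rightarrow> complex) \<Rightarrow> complex fps \<Rightarrow> bool" where
  "has_q_expansion f F \<longleftrightarrow> (\<forall>z\<in>upper_half_plane. (\<lambda>n. fps_nth F n * nome z ^ n) sums f z)"

section \<open>Modular forms\<close>

text \<open>
  A function on the upper half-plane is represented by its extension by zero to the whole plane.
  This makes the representation unique, so that dimensions of spaces of such functions
  are meaningful. Holomorphy at the cusp is the existence of a \<open>q\<close>-expansion without negative powers.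
  Both a matrix and its negative are included, so nonzero forms have even weight.
\<close>

definition modular_forms :: "int \<Rightarrow> (complex \<Rightarrow> complex) set" where
  "modular_forms k = {f.
     f holomorphic_on upper_half_plane \<and>
     (\<forall>z. z \<notin> upper_half_plane \<longrightarrow> f z = 0) \<and>
     (\<forall>a b c d :: int. a * d - b * c = 1 \<longrightarrow> (\<forall>z\<in>upper_half_plane.
        f ((of_int a * z + of_int b) / (of_int c * z + of_int d)) =
          (of_int c * z + of_int d) powi k * f z)) \<and>
     (\<exists>F. has_q_expansion f F)}"

section \<open>Eisenstein series\<close>

text \<open>Bernoulli numbers \<open>1, -1/2, 1/6, 0, -1/30, 0, 1/42, \<dots>\<close>\<close>

fun bernoulli :: "nat \<Rightarrow> real" where
  "bernoulli 0 = 1"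
| "bernoulli (Suc n) = - (\<Sum>k\<le>n. real ((n + 2) choose k) * bernoulli k) / real (n + 2)"

lemma bernoulli_2_4_6: "bernoulli 2 = 1/6" "bernoulli 4 = -1/30" "bernoulli 6 = 1/42"
  by (simp_all add: numeral_eq_Suc atMost_Suc binomial_eq_0)

definition divisor_sum :: "nat \<Rightarrow> nat \<Rightarrow> nat" where
  "divisor_sum m n = (\<Sum>d | d dvd n. d ^ m)"

text \<open>
  The index \<open>k\<close> is the weight (even and at least 2), whence the factor \<open>2 k / B\<^sub>k\<close>,
  which is \<open>4 j / B\<^sub>2\<^sub>j\<close> for \<open>k = 2 j\<close>.
\<close>

definition eisenstein :: "nat \<Rightarrow> complex \<Rightarrow> complex" where
  "eisenstein k z = 1 - of_real (2 * real k / bernoulli k) *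
     (\<Sum>n. of_nat (divisor_sum (k - 1) (Suc n)) * nome z ^ Suc n)"

section \<open>The Serre derivative\<close>

definition q_deriv :: "(complex \<Rightarrow> complex) \<Rightarrow> complex \<Rightarrow> complex" where
  "q_deriv f z = deriv f z / (2 * of_real pi * \<i>)"

definition serre_deriv :: "int \<Rightarrow> (complex \<Rightarrow> complex) \<Rightarrow> complex \<Rightarrow> complex" where
  "serre_deriv k f z = q_deriv f z - of_int k / 12 * eisenstein 2 z * f z"

fun serre_deriv_iter :: "nat \<Rightarrow> int \<Rightarrow> (complex \<Rightarrow> complex) \<Rightarrow> complex \<Rightarrow> complex" where
  "serre_deriv_iter 0 k f = f"
| "serre_deriv_iter (Suc j) k f = serre_deriv (k + 2 * int j) (serre_deriv_iter j k f)"

section \<open>Extremal quasimodular forms\<close>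

text \<open>
  The sum of the spaces \<open>E\<^sub>2\<^sup>l M\<^sub>w\<^sub>-\<^sub>2\<^sub>l\<close> is automatically direct, so the set of all sums is the direct sum.
\<close>

definition quasimodular_forms :: "nat \<Rightarrow> int \<Rightarrow> (complex \<Rightarrow> complex) set" where
  "quasimodular_forms r w = {f. \<exists>g.
     (\<forall>l\<le>r. g l \<in> modular_forms (w - 2 * int l)) \<and>
     f = (\<lambda>z. \<Sum>l\<le>r. eisenstein 2 z ^ l * g l z)}"

interpretation cfun: vector_space "\<lambda>(c :: complex) (f :: complex \<Rightarrow> complex) z. c * f z"
  by unfold_locales (auto simp: fun_eq_iff algebra_simps)

definition normalized_extremal :: "nat \<Rightarrow> int \<Rightarrow> (complex \<Rightarrow> complex) \<Rightarrow> bool" where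
  "normalized_extremal r w f \<longleftrightarrow>
     f \<in> quasimodular_forms r w \<and>
     (\<exists>F. has_q_expansion f F \<and>
          subdegree F = cfun.dim (quasimodular_forms r w) - 1 \<and>
          fps_nth F (subdegree F) = 1)"

definition K_up :: "nat \<Rightarrow> (complex \<Rightarrow> complex) \<Rightarrow> complex \<Rightarrow> complex" where
  "K_up w f z = (let W = of_nat w :: complex in
     48 * (7 * W^2 + 42 * W + 60) * serre_deriv_iter 3 (int w - 3) f z
     - (15 * W^4 + 96 * W^3 + 151 * W^2 - 30 * W - 116)
         * eisenstein 4 z * serre_deriv (int w - 3) f z
     - 1 / 6 * (W + 1) * (9 * W^4 + 45 * W^3 + 40 * W^2 + 24 * W + 144) * eisenstein 6 z * f z)"

end

theory Submission
  imports Defs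
begin

text \<open>
  For \<open>w = 6 m\<close> one shows that the form \<open>f\<^sub>w\<close> satisfies a modular differential equation
  \<open>L\<^sub>w f = 0\<close> of order 4 whose indicial polynomial at the cusp is \<open>x\<^sup>3 (x - w/3)\<close>. The operator identity
  \<open>L\<^sub>w\<^sub>+\<^sub>6 K\<^sub>w = M\<^sub>w L\<^sub>w\<close> carries the equation from \<open>f\<^sub>w\<close> to \<open>K\<^sub>w f\<^sub>w\<close>, starting from \<open>f\<^sub>0 = 1\<close>, and the
  equation determines the first three coefficients of \<open>f\<^sub>w\<close>, from which one reads off the vanishing
  orders and leading coefficients of \<open>K\<^sub>w f\<^sub>w\<close> and of the two intermediate forms.

  Uniqueness of extremal forms then comes for free: products of these explicit forms and their Serre
  derivatives with monomials in \<open>E\<^sub>4\<close> and \<open>E\<^sub>6\<close> realise every vanishing order from \<open>0\<close> to \<open>w div 3\<close>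
  in weight \<open>w\<close>, and this exhausts the dimension.

  The structure of the spaces of modular forms is obtained without the valence formula: cusp forms of
  weight at most 10 vanish by the maximum principle, Ramanujan's differential equations follow by comparing
  constant terms, and they show that the discriminant is the exponential of a primitive of \<open>E\<^sub>2\<close>,
  so that every cusp form is divisible by it.
\<close>

section \<open>Differential operators on power series\<close>

text \<open>The operators \<open>L_w\<close> are rigid: a monic modular operator of order 4 acting
  in weight \<open>w - 3\<close> has three free constants, in front of \<open>E4\<close>,
  \<open>E6\<close> and \<open>E4^2\<close>, and its exponents at the cusp always sum to
  \<open>w/3\<close>. Asking for the exponent \<open>w/3\<close>, the expected order of
  \<open>f_w\<close>, and three times the exponent 0 fixes all of them. The parameter is
  \<open>w - 3\<close>, weight minus depth, because with this value the Serre derivative preserves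
  depth at most 3.

  With \<open>n = w/3\<close>, the coefficient of \<open>q^(n+j)\<close> in a solution enters its
  recursion with the factor \<open>12^4 (n+j)^3 j\<close>, nonzero for \<open>j > 0\<close>, so
  statements about leading coefficients become polynomial identities in \<open>n\<close>. Algebra
  and analysis are therefore kept apart: the operator identities are proved for formal power series,
  and functions meet them through their expansions.

  The analytic obstacle is weight 2, where the lattice sum does not converge absolutely and the
  order of summation produces the extra term in the transformation law of \<open>E2\<close>.
  Modularity of \<open>E4\<close> and \<open>E6\<close> is then deduced from \<open>E2\<close> by
  differentiation and comparison with lattice sums.\<close>

definition eis_fps :: "nat \<Rightarrow> int \<Rightarrow> complex fps" where
  "eis_fps m c = Abs_fps (\<lambda>n. if n = 0 then 1 else of_int c * of_nat (divisor_sum m n))"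

abbreviation "E2_fps \<equiv> eis_fps 1 (-24)"
abbreviation "E4_fps \<equiv> eis_fps 3 240"
abbreviation "E6_fps \<equiv> eis_fps 5 (-504)"

definition D_fps :: "complex fps \<Rightarrow> complex fps" where
  "D_fps F = fps_X * fps_deriv F"

lemma D_fps_nth: "fps_nth (D_fps F) n = of_nat n * fps_nth F n"
  by (cases n) (simp_all add: D_fps_def)

lemma D_fps_mult: "D_fps (F * G) = D_fps F * G + F * D_fps G"
  by (simp add: D_fps_def algebra_simps)

text \<open>Multiplying the Serre derivative by 12 keeps all coefficients below integral.\<close>

definition serre_fps :: "int \<Rightarrow> complex fps \<Rightarrow> complex fps" where
  "serre_fps k F = 12 * D_fps F - of_int k * (E2_fps * F)"

fun serre_fps_iter :: "nat \<Rightarrow> int \<Rightarrow> complex fps \<Rightarrow> complex fps" where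
  "serre_fps_iter 0 k F = F"
| "serre_fps_iter (Suc j) k F = serre_fps (k + 2 * int j) (serre_fps_iter j k F)"

lemma serre_fps_0 [simp]: "serre_fps k 0 = 0"
  by (simp add: serre_fps_def D_fps_def)

lemma serre_fps_add: "serre_fps k (F + G) = serre_fps k F + serre_fps k G"
  by (simp add: serre_fps_def D_fps_def algebra_simps)

lemma serre_fps_diff: "serre_fps k (F - G) = serre_fps k F - serre_fps k G"
  by (simp add: serre_fps_def D_fps_def algebra_simps)

lemma serre_fps_of_int: "serre_fps k (of_int c * F) = of_int c * serre_fps k F"
  by (simp add: serre_fps_def D_fps_def fps_of_int[symmetric] algebra_simps)

lemma serre_fps_numeral: "serre_fps k (numeral c * F) = numeral c * serre_fps k F"
  using serre_fps_of_int[of k "numeral c"] by simp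

section \<open>Holomorphic functions with a \<open>q\<close>-expansion\<close>

lemma upper_half_plane_iff: "z \<in> upper_half_plane \<longleftrightarrow> Im z > 0"
  by (simp add: upper_half_plane_def)

lemma open_upper_half_plane: "open upper_half_plane"
  unfolding upper_half_plane_def by (rule open_halfspace_Im_gt)

lemma convex_upper_half_plane: "convex upper_half_plane"
  unfolding upper_half_plane_def by (rule convex_halfspace_Im_gt)

lemma norm_nome: "norm (nome z) = exp (- 2 * pi * Im z)"
  by (simp add: nome_def)

lemma norm_nome_less_1: "z \<in> upper_half_plane \<Longrightarrow> norm (nome z) < 1"
  by (simp add: norm_nome upper_half_plane_iff)

lemma nome_nonzero: "nome z \<noteq> 0"
  by (simp add: nome_def)

lemma nome_surj:
  assumes "q \<noteq> 0" "norm q < 1"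
  obtains z where "z \<in> upper_half_plane" "nome z = q"
proof -
  define z where "z = Ln q / (2 * of_real pi * \<i>)"
  have "nome z = q"
    using assms by (simp add: z_def nome_def exp_Ln)
  then have "exp (- 2 * pi * Im z) < exp 0"
    using assms norm_nome[of z] by simp
  then have "Im z > 0" by (subst (asm) exp_less_cancel_iff) (simp add: zero_less_mult_iff)
  then show ?thesis using that \<open>nome z = q\<close> by (simp add: upper_half_plane_iff)
qed

lemma nome_add_of_int: "nome (z + of_int n) = nome z"
proof -
  have "nome (z + of_int n) = nome z * exp (\<i> * (of_int (2 * n) * of_real pi))"
    by (simp add: nome_def exp_add[symmetric] algebra_simps)
  also have "exp (\<i> * (of_int (2 * n) * of_real pi)) = 1"
    unfolding exp_eq_1 by (auto intro!: exI[of _ n])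
  finally show ?thesis by simp
qed

lemma nome_deriv: "(nome has_field_derivative (2 * of_real pi * \<i> * nome z)) (at z within A)"
  unfolding nome_def by (auto intro!: derivative_eq_intros)

text \<open>Every radius \<open>0 < r < 1\<close> is attained by some \<open>nome z\<close>, so
  convergence on the half-plane already forces convergence radius at least 1. This opens the
  calculus of \<open>eval_fps\<close>.\<close>

lemma has_q_expansion_iff:
  "has_q_expansion f F \<longleftrightarrow> fps_conv_radius F \<ge> 1 \<and> (\<forall>z\<in>upper_half_plane. f z = eval_fps F (nome z))"
proof
  assume F: "has_q_expansion f F"
  have "conv_radius (fps_nth F) \<ge> 1"
  proof (rule conv_radius_geI_ex)
    fix r :: real assume r: "0 < r" "ereal r < 1"
    then obtain z where "z \<in> upper_half_plane" "nome z = of_real r"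
      using nome_surj[of "of_real r"] by auto
    with F have "summable (\<lambda>n. fps_nth F n * of_real r ^ n)"
      by (auto simp: has_q_expansion_def sums_iff)
    with r show "\<exists>z. norm z = r \<and> summable (\<lambda>n. fps_nth F n * z ^ n)"
      by (intro exI[of _ "of_real r"]) simp
  qed
  then show "fps_conv_radius F \<ge> 1 \<and> (\<forall>z\<in>upper_half_plane. f z = eval_fps F (nome z))"
    using F by (auto simp: has_q_expansion_def sums_iff eval_fps_def fps_conv_radius_def)
next
  assume F: "fps_conv_radius F \<ge> 1 \<and> (\<forall>z\<in>upper_half_plane. f z = eval_fps F (nome z))"
  show "has_q_expansion f F"
    unfolding has_q_expansion_def
  proof
    fix z assume z: "z \<in> upper_half_plane"
    then have "ereal (norm (nome z)) < 1"
      using norm_nome_less_1 by simp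
    then have "ereal (norm (nome z)) < fps_conv_radius F"
      using F by (meson less_le_trans)
    then show "(\<lambda>n. fps_nth F n * nome z ^ n) sums f z"
      using F z sums_eval_fps by auto
  qed
qed

lemma has_q_expansion_radius: "has_q_expansion f F \<Longrightarrow> norm q < 1 \<Longrightarrow> ereal (norm q) < fps_conv_radius F"
  unfolding has_q_expansion_iff by (metis less_le_trans less_ereal.simps(1) one_ereal_def)

lemma has_q_expansion_eval: "has_q_expansion f F \<Longrightarrow> z \<in> upper_half_plane \<Longrightarrow> f z = eval_fps F (nome z)"
  unfolding has_q_expansion_iff by blast

lemma has_q_expansion_cong:
  "(\<And>z. z \<in> upper_half_plane \<Longrightarrow> f z = g z) \<Longrightarrow> has_q_expansion f F \<longleftrightarrow> has_q_expansion g F"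
  by (simp add: has_q_expansion_def)

lemma has_q_expansion_add:
  assumes "has_q_expansion f F" "has_q_expansion g G"
  shows "has_q_expansion (\<lambda>z. f z + g z) (F + G)"
  using assms unfolding has_q_expansion_def by (auto simp: ring_distribs intro: sums_add)

lemma has_q_expansion_diff:
  assumes "has_q_expansion f F" "has_q_expansion g G"
  shows "has_q_expansion (\<lambda>z. f z - g z) (F - G)"
  using assms unfolding has_q_expansion_def by (auto simp: ring_distribs intro: sums_diff)

lemma has_q_expansion_const: "has_q_expansion (\<lambda>z. c) (fps_const c)"
  by (auto simp: has_q_expansion_iff)

lemma has_q_expansion_mult:
  assumes "has_q_expansion f F" "has_q_expansion g G"
  shows "has_q_expansion (\<lambda>z. f z * g z) (F * G)"
proof -
  have "fps_conv_radius (F * G) \<ge> 1"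
    using fps_conv_radius_mult[of F G] assms unfolding has_q_expansion_iff by (meson min.boundedI order.trans)
  moreover have "f z * g z = eval_fps (F * G) (nome z)" if z: "z \<in> upper_half_plane" for z
    using eval_fps_mult[OF has_q_expansion_radius[OF assms(1) norm_nome_less_1[OF z]]
        has_q_expansion_radius[OF assms(2) norm_nome_less_1[OF z]]]
    by (simp add: has_q_expansion_eval[OF assms(1) z] has_q_expansion_eval[OF assms(2) z])
  ultimately show ?thesis by (simp add: has_q_expansion_iff[of _ "F * G"])
qed

lemma has_q_expansion_cmult: "has_q_expansion f F \<Longrightarrow> has_q_expansion (\<lambda>z. c * f z) (fps_const c * F)"
  by (intro has_q_expansion_mult has_q_expansion_const)

lemma has_q_expansion_power: "has_q_expansion f F \<Longrightarrow> has_q_expansion (\<lambda>z. f z ^ n) (F ^ n)"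
proof (induction n)
  case 0
  show ?case using has_q_expansion_const[of 1] by simp
next
  case (Suc n)
  then show ?case using has_q_expansion_mult[of f F "\<lambda>z. f z ^ n" "F ^ n"] by simp
qed

lemma has_q_expansion_deriv:
  assumes "has_q_expansion f F" "z \<in> upper_half_plane"
  shows "(f has_field_derivative 2 * of_real pi * \<i> * eval_fps (D_fps F) (nome z)) (at z)"
proof -
  have r: "ereal (norm (nome z)) < fps_conv_radius F"
    using assms has_q_expansion_radius norm_nome_less_1 by blast
  have r': "ereal (norm (nome z)) < fps_conv_radius (fps_deriv F)"
    using r fps_conv_radius_deriv[of F] by (rule less_le_trans)
  have "((\<lambda>z. eval_fps F (nome z)) has_field_derivative
      eval_fps (fps_deriv F) (nome z) * (2 * of_real pi * \<i> * nome z)) (at z)"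
    using DERIV_chain[OF has_field_derivative_eval_fps[OF r] nome_deriv] by (simp add: o_def)
  also have "eval_fps (fps_deriv F) (nome z) * (2 * of_real pi * \<i> * nome z) = 2 * of_real pi * \<i> * eval_fps (D_fps F) (nome z)"
    using r' by (simp add: D_fps_def eval_fps_mult)
  finally show ?thesis
  proof (rule has_field_derivative_transform_within_open[OF _ open_upper_half_plane assms(2)])
    show "eval_fps F (nome w) = f w" if "w \<in> upper_half_plane" for w
      using has_q_expansion_eval[OF assms(1) that] by simp
  qed
qed

lemma fps_conv_radius_D_fps: "fps_conv_radius F \<le> fps_conv_radius (D_fps F)"
  using fps_conv_radius_deriv[of F] fps_conv_radius_mult[of fps_X "fps_deriv F"]
  unfolding D_fps_def by (simp add: order.trans)

lemma has_q_expansion_q_deriv: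
  assumes "has_q_expansion f F"
  shows "has_q_expansion (q_deriv f) (D_fps F)"
proof -
  have "1 \<le> fps_conv_radius F"
    using assms by (simp add: has_q_expansion_iff)
  also note fps_conv_radius_D_fps
  finally show ?thesis
    using DERIV_imp_deriv[OF has_q_expansion_deriv[OF assms]]
    by (simp add: has_q_expansion_iff[of _ "D_fps F"] q_deriv_def)
qed

lemma has_q_expansion_holomorphic:
  assumes "has_q_expansion f F"
  shows "f holomorphic_on upper_half_plane"
  using has_q_expansion_deriv[OF assms] open_upper_half_plane
  by (meson holomorphic_on_open)

text \<open>The nome omits the value 0, so the two series first agree only on the punctured disc;
  continuity adds the centre.\<close>

lemma has_q_expansion_unique:
  assumes "has_q_expansion f F" "has_q_expansion g G" "\<And>z. z \<in> upper_half_plane \<Longrightarrow> f z = g z"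
  shows "F = G"
proof (rule eval_fps_eqD)
  show r: "fps_conv_radius F > 0" "fps_conv_radius G > 0"
    using has_q_expansion_radius[OF assms(1), of 0] has_q_expansion_radius[OF assms(2), of 0] 
    by (simp_all add: zero_ereal_def)
  define d where "d = (\<lambda>q. eval_fps F q - eval_fps G q)"
  have ev: "eval_fps F q = eval_fps G q" if q: "q \<in> ball 0 1 - {0}" for q
  proof -
    obtain z where "z \<in> upper_half_plane" "nome z = q"
      using q nome_surj[of q] by auto
    then show ?thesis
      using assms has_q_expansion_eval by metis
  qed
  have isC: "isCont (eval_fps F) 0" "isCont (eval_fps G) 0"
    using continuous_eval_fps[of 0 F UNIV] continuous_eval_fps[of 0 G UNIV] r by (auto simp: zero_ereal_def)
  have "(eval_fps F \<longlongrightarrow> eval_fps F 0) (at 0)" "(eval_fps G \<longlongrightarrow> eval_fps G 0) (at 0)"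
    using isC by (simp_all add: isCont_def)
  moreover have "eventually (\<lambda>q. eval_fps G q = eval_fps F q) (at 0)"
    using eventually_at_ball[of 1 0 UNIV] by (auto simp: eventually_at ev intro!: exI[of _ 1])
  ultimately have "eval_fps F 0 = eval_fps G 0"
    by (auto intro: tendsto_unique[OF at_neq_bot] Lim_transform_eventually)
  then have "eval_fps F q = eval_fps G q" if "q \<in> ball 0 1" for q
    using ev that by (cases "q = 0") auto
  then show "eventually (\<lambda>q. eval_fps F q = eval_fps G q) (nhds 0)"
    by (auto simp: eventually_nhds intro!: exI[of _ "ball 0 1"])
qed

lemma has_q_expansion_serre_deriv:
  assumes "has_q_expansion f F" "has_q_expansion (eisenstein 2) E2_fps"
  shows "has_q_expansion (serre_deriv k f) (fps_const (1/12) * serre_fps k F)"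
proof -
  have "has_q_expansion (\<lambda>z. q_deriv f z - (of_int k / 12) * (eisenstein 2 z * f z))
     (D_fps F - fps_const (of_int k / 12) * (E2_fps * F))"
    using assms by (intro has_q_expansion_diff has_q_expansion_q_deriv has_q_expansion_cmult has_q_expansion_mult)
  also have "(\<lambda>z. q_deriv f z - (of_int k / 12) * (eisenstein 2 z * f z)) = serre_deriv k f"
    by (simp add: serre_deriv_def fun_eq_iff)
  also have "D_fps F - fps_const (of_int k / 12) * (E2_fps * F) = fps_const (1/12) * serre_fps k F"
    by (simp add: serre_fps_def fps_of_int[symmetric] numeral_fps_const right_diff_distrib mult.assoc[symmetric])
  finally show ?thesis .
qed

subsection \<open>Eisenstein series\<close>

lemma divisor_sum_le: "divisor_sum m n \<le> n ^ Suc m"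
proof (cases "n = 0")
  case False
  have le: "d \<le> n \<and> 0 < d" if "d dvd n" for d
    using that False by (auto dest: dvd_imp_le intro: Nat.gr0I)
  have "divisor_sum m n \<le> (\<Sum>d\<in>{1..n}. n ^ m)"
    unfolding divisor_sum_def using False
    by (intro order.trans[OF sum_mono[of _ _ "\<lambda>_. n ^ m"] sum_mono2]) (auto intro!: power_mono simp: Suc_le_eq dest: le)
  then show ?thesis by simp
qed (simp add: divisor_sum_def)

text \<open>\<open>D_fps\<close> multiplies the \<open>n\<close>-th coefficient by \<open>n\<close>
  and does not shrink the convergence radius, so induction on \<open>k\<close> reduces this to the
  geometric series.\<close>

lemma summable_power_mult_geometric:
  fixes r :: real
  assumes "0 < r" "r < 1"
  shows "summable (\<lambda>n. real n ^ k * r ^ n)"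
proof -
  have "fps_conv_radius (Abs_fps (\<lambda>n. of_nat n ^ k :: complex)) \<ge> 1"
  proof (induction k)
    case 0
    show ?case unfolding fps_conv_radius_def
    proof (rule conv_radius_geI_ex)
      fix s :: real assume "0 < s" "ereal s < 1"
      then show "\<exists>z. norm z = s \<and> summable (\<lambda>n. fps_nth (Abs_fps (\<lambda>n. of_nat n ^ 0 :: complex)) n * z ^ n)"
        by (intro exI[of _ "of_real s"]) (auto intro: summable_geometric)
    qed
  next
    case (Suc k)
    have "Abs_fps (\<lambda>n. of_nat n ^ Suc k :: complex) = D_fps (Abs_fps (\<lambda>n. of_nat n ^ k))"
      by (simp add: fps_eq_iff D_fps_nth)
    then show ?case using Suc fps_conv_radius_D_fps by (metis order.trans)
  qed
  moreover have "ereal (norm (complex_of_real r)) < 1" using assms by simp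
  ultimately have "ereal (norm (complex_of_real r)) < fps_conv_radius (Abs_fps (\<lambda>n. of_nat n ^ k :: complex))"
    by (rule less_le_trans[rotated])
  from norm_summable_fps[OF this] have "summable (\<lambda>n. norm (of_nat n ^ k * complex_of_real r ^ n))"
    by simp
  then show ?thesis using assms by (simp add: norm_mult norm_power)
qed

lemma eis_fps_radius: "fps_conv_radius (eis_fps m c) \<ge> 1"
  unfolding fps_conv_radius_def
proof (rule conv_radius_geI_ex)
  fix r :: real assume r: "0 < r" "ereal r < 1"
  have "summable (\<lambda>n. norm (fps_nth (eis_fps m c) n * of_real r ^ n))"
  proof (rule summable_comparison_test_ev)
    have "summable (\<lambda>n. real n ^ Suc m * r ^ n)"
      using r by (intro summable_power_mult_geometric) auto
    then show "summable (\<lambda>n. \<bar>real_of_int c\<bar> * (real n ^ Suc m * r ^ n))"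
      by (rule summable_mult)
    have "norm (norm (fps_nth (eis_fps m c) n * of_real r ^ n)) \<le> \<bar>real_of_int c\<bar> * (real n ^ Suc m * r ^ n)" if "n > 0" for n
    proof -
      have "real (divisor_sum m n) \<le> real n ^ Suc m"
        using divisor_sum_le[of m n] by (metis of_nat_le_iff of_nat_power)
      then show ?thesis
        using that r by (simp add: eis_fps_def norm_mult norm_power mult_left_mono mult_right_mono mult.assoc)
    qed
    then show "eventually (\<lambda>n. norm (norm (fps_nth (eis_fps m c) n * of_real r ^ n)) \<le> \<bar>real_of_int c\<bar> * (real n ^ Suc m * r ^ n)) sequentially"
      by (auto simp: eventually_sequentially intro!: exI[of _ 1])
  qed
  then have "summable (\<lambda>n. fps_nth (eis_fps m c) n * of_real r ^ n)"
    by (rule summable_norm_cancel)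
  with r show "\<exists>z. norm z = r \<and> summable (\<lambda>n. fps_nth (eis_fps m c) n * z ^ n)"
    by (intro exI[of _ "of_real r"]) simp
qed

lemma eisenstein_q_expansion:
  assumes "- 2 * real k / bernoulli k = of_int c"
  shows "has_q_expansion (eisenstein k) (eis_fps (k - 1) c)"
  unfolding has_q_expansion_iff
proof (intro conjI ballI eis_fps_radius)
  fix z assume "z \<in> upper_half_plane"
  then have r: "ereal (norm (nome z)) < fps_conv_radius (eis_fps (k - 1) c')" for c'
    using eis_fps_radius[of "k - 1" c'] norm_nome_less_1 by (metis less_le_trans less_ereal.simps(1) one_ereal_def)
  have c: "- complex_of_real (2 * real k / bernoulli k) = of_int c"
    using assms by (metis minus_divide_left of_real_minus of_real_of_int_eq mult_minus_left)
  have s: "summable (\<lambda>n. of_nat (divisor_sum (k - 1) (Suc n)) * nome z ^ Suc n)"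
    using summable_fps[OF r[of 1]] by (subst (asm) summable_Suc_iff[symmetric]) (simp add: eis_fps_def)
  have "eval_fps (eis_fps (k - 1) c) z' = 1 + (\<Sum>n. fps_nth (eis_fps (k - 1) c) (Suc n) * z' ^ Suc n)"
    if "z' = nome z" for z'
    unfolding eval_fps_def using suminf_split_head[OF summable_fps[OF r[of c]]] that
    by (simp add: eis_fps_def algebra_simps)
  also have "(\<Sum>n. fps_nth (eis_fps (k - 1) c) (Suc n) * nome z ^ Suc n) = of_int c * (\<Sum>n. of_nat (divisor_sum (k - 1) (Suc n)) * nome z ^ Suc n)"
    by (subst suminf_mult[OF s, symmetric]) (simp add: eis_fps_def mult.assoc)
  finally show "eisenstein k z = eval_fps (eis_fps (k - 1) c) (nome z)"
    unfolding eisenstein_def c[symmetric] by simp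
qed

lemma eisenstein_2_4_6_q_expansion:
  "has_q_expansion (eisenstein 2) E2_fps"
  "has_q_expansion (eisenstein 4) E4_fps"
  "has_q_expansion (eisenstein 6) E6_fps"
  using eisenstein_q_expansion[of 2 "-24"] eisenstein_q_expansion[of 4 240] eisenstein_q_expansion[of 6 "-504"]
  by (simp_all add: bernoulli_2_4_6)

section \<open>Modular forms and the generators of the modular group\<close>

text \<open>The expansion accounts for the translation \<open>T\<close>, the second conjunct for the
  inversion \<open>S\<close>. Unlike \<open>modular_forms\<close> this leaves values off the
  half-plane free, so that sums, products and derivatives need no truncation.\<close>

definition modform :: "int \<Rightarrow> (complex \<Rightarrow> complex) \<Rightarrow> complex fps \<Rightarrow> bool" where
  "modform k f F \<longleftrightarrow> has_q_expansion f F \<and> (\<forall>z\<in>upper_half_plane. f (- 1 / z) = z powi k * f z)"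

lemma modform_q_expansion: "modform k f F \<Longrightarrow> has_q_expansion f F"
  by (simp add: modform_def)

lemma modform_S: "modform k f F \<Longrightarrow> z \<in> upper_half_plane \<Longrightarrow> f (- 1 / z) = z powi k * f z"
  by (simp add: modform_def)

lemma Im_minus_inverse: "Im (- 1 / z) = Im z / norm z ^ 2"
  by (simp add: Im_divide cmod_power2)

lemma upper_half_plane_nonzero: "z \<in> upper_half_plane \<Longrightarrow> z \<noteq> 0"
  by (auto simp: upper_half_plane_iff)

lemma S_upper_half_plane: "z \<in> upper_half_plane \<Longrightarrow> - 1 / z \<in> upper_half_plane"
  using upper_half_plane_nonzero[of z] unfolding upper_half_plane_iff Im_minus_inverse by simp

lemma modform_cong:
  assumes "\<And>z. z \<in> upper_half_plane \<Longrightarrow> f z = g z"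
  shows "modform k f F \<longleftrightarrow> modform k g F"
  using assms S_upper_half_plane has_q_expansion_cong[of f g] unfolding modform_def by (metis (no_types))

lemma modform_add: "modform k f F \<Longrightarrow> modform k g G \<Longrightarrow> modform k (\<lambda>z. f z + g z) (F + G)"
  by (simp add: modform_def has_q_expansion_add ring_distribs)

lemma modform_diff: "modform k f F \<Longrightarrow> modform k g G \<Longrightarrow> modform k (\<lambda>z. f z - g z) (F - G)"
  by (simp add: modform_def has_q_expansion_diff ring_distribs)

lemma modform_cmult: "modform k f F \<Longrightarrow> modform k (\<lambda>z. c * f z) (fps_const c * F)"
  by (simp add: modform_def has_q_expansion_cmult)

lemma modform_mult: "modform k f F \<Longrightarrow> modform l g G \<Longrightarrow> modform (k + l) (\<lambda>z. f z * g z) (F * G)"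
  using upper_half_plane_nonzero by (auto simp: modform_def has_q_expansion_mult power_int_add)

lemma modform_const: "modform 0 (\<lambda>z. c) (fps_const c)"
  by (simp add: modform_def has_q_expansion_const)

lemma modform_zero: "modform k (\<lambda>z. 0) 0"
  using has_q_expansion_const[of 0] by (simp add: modform_def)

lemma modform_power: "modform k f F \<Longrightarrow> modform (int n * k) (\<lambda>z. f z ^ n) (F ^ n)"
proof (induction n)
  case 0
  show ?case using modform_const[of 1] by simp
next
  case (Suc n)
  then show ?case using modform_mult[of k f F "int n * k" "\<lambda>z. f z ^ n" "F ^ n"] by (simp add: algebra_simps)
qed

lemma has_q_expansion_periodic:
  assumes "has_q_expansion f F" "z \<in> upper_half_plane"
  shows "f (z + of_int n) = f z"
  using assms has_q_expansion_eval[OF assms(1)] by (simp add: nome_add_of_int upper_half_plane_iff)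

text \<open>The generators \<open>S\<close> and \<open>T\<close> suffice: Euclid's algorithm on the bottom row.\<close>

lemma modform_SL2:
  fixes a b c d :: int
  assumes f: "modform k f F" and "a * d - b * c = 1" "z \<in> upper_half_plane"
  shows "f ((of_int a * z + of_int b) / (of_int c * z + of_int d)) = (of_int c * z + of_int d) powi k * f z"
  using assms(2,3)
proof (induction "nat \<bar>c\<bar>" arbitrary: a b c d z rule: less_induct)
  case less
  note T = has_q_expansion_periodic[OF modform_q_expansion[OF f]]
  note S = modform_S[OF f]
  \<comment> \<open>\<open>S\<close> applied twice fixes every point but contributes the factor
    \<open>(-1) powi k\<close>. For odd \<open>k\<close> this says that \<open>f\<close>
    vanishes.\<close>
  have neg: "(-1) powi k * f z = f z" if z: "z \<in> upper_half_plane" for z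
  proof -
    have "f z = f (- 1 / (- 1 / z))" by simp
    also have "\<dots> = (- 1 / z) powi k * (z powi k * f z)"
      using S[OF S_upper_half_plane[OF z]] S[OF z] by simp
    also have "\<dots> = (- 1 / z * z) powi k * f z"
      by (simp only: power_int_mult_distrib mult.assoc)
    finally show ?thesis using upper_half_plane_nonzero[OF z] by simp
  qed
  show ?case
  proof (cases "c = 0")
    case True
    then have "a = 1 \<and> d = 1 \<or> a = -1 \<and> d = -1"
      using less.prems by (simp add: zmult_eq_1_iff)
    then show ?thesis
    proof
      assume "a = 1 \<and> d = 1"
      then show ?thesis using True T[OF less.prems(2), of b] by simp
    next
      assume "a = -1 \<and> d = -1"
      moreover have "(- z + of_int b) / (- 1) = z + of_int (- b)" by simp
      ultimately show ?thesis
        using True T[OF less.prems(2), of "- b"] neg[OF less.prems(2)]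
        by (simp only: of_int_minus of_int_1 of_int_0 mult_zero_left add_0_left mult_minus_left mult_1_left)
    qed
  next
    case False
    define n where "n = d div c"
    define r where "r = d mod c"
    \<comment> \<open>Up to sign the matrix factors as the one with rows \<open>(b', -a)\<close> and
      \<open>(r, -c)\<close>, times \<open>S\<close>, times the \<open>n\<close>-th power of
      \<open>T\<close>.\<close>
    define b' where "b' = b - n * a"
    have d: "d = n * c + r" by (simp add: n_def r_def)
    define z' where "z' = z + of_int n"
    define u where "u = - 1 / z'"
    have z': "z' \<in> upper_half_plane" using less.prems(2) by (simp add: z'_def upper_half_plane_iff)
    then have u: "u \<in> upper_half_plane" unfolding u_def by (rule S_upper_half_plane)
    have nz: "z' \<noteq> 0" using z' by (rule upper_half_plane_nonzero)
    have "nat \<bar>r\<bar> < nat \<bar>c\<bar>" using False by (simp add: r_def abs_mod_less)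
    moreover have "b' * (- c) - (- a) * r = 1"
      using less.prems(1) unfolding b'_def d by (simp add: algebra_simps)
    ultimately have IH: "f ((of_int b' * u + of_int (- a)) / (of_int r * u + of_int (- c))) = (of_int r * u + of_int (- c)) powi k * f u"
      using less.hyps u by blast
    have uz: "- (x * u + of_int y) * z' = x - of_int y * z - of_int (n * y)" for x :: complex and y
    proof -
      have "- (x * u + of_int y) * z' = - x * (u * z') - of_int y * z'" by (simp add: algebra_simps)
      also have "u * z' = -1" using nz by (simp add: u_def)
      finally show ?thesis by (simp add: z'_def algebra_simps)
    qed
    have num: "of_int a * z + of_int b = - (of_int b' * u + of_int (- a)) * z'"
      unfolding uz by (simp add: b'_def)
    have den: "of_int c * z + of_int d = - (of_int r * u + of_int (- c)) * z'"
      unfolding uz by (simp add: d)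
    have "f ((of_int a * z + of_int b) / (of_int c * z + of_int d)) = (of_int r * u + of_int (- c)) powi k * f u"
      unfolding IH[symmetric] num den by (simp only: mult_divide_mult_cancel_right[OF nz] minus_divide_divide)
    also have "f u = z' powi k * ((-1) powi k * f z)"
      using S[OF z'] T[OF less.prems(2), of n] neg[OF less.prems(2)] by (simp add: u_def z'_def)
    also have "(of_int r * u + of_int (- c)) powi k * (z' powi k * ((-1) powi k * f z))
       = ((-1) * (of_int r * u + of_int (- c)) * z') powi k * f z"
      by (simp only: power_int_mult_distrib mult_ac)
    also have "(-1) * (of_int r * u + of_int (- c)) * z' = of_int c * z + of_int d"
      unfolding den by simp
    finally show ?thesis .
  qed
qed

text \<open>Passes from functions controlled only on the half-plane to the extension by zero that
  \<open>modular_forms\<close> demands.\<close>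

definition cut :: "(complex \<Rightarrow> complex) \<Rightarrow> complex \<Rightarrow> complex" where
  "cut f z = (if z \<in> upper_half_plane then f z else 0)"

lemma cut_eq [simp]: "z \<in> upper_half_plane \<Longrightarrow> cut f z = f z"
  by (simp add: cut_def)

lemma modular_forms_iff:
  "f \<in> modular_forms k \<longleftrightarrow> cut f = f \<and> (\<exists>F. modform k f F)"
proof
  assume f: "f \<in> modular_forms k"
  then obtain F where F: "has_q_expansion f F" by (auto simp: modular_forms_def)
  have "f (- 1 / z) = z powi k * f z" if "z \<in> upper_half_plane" for z
  proof -
    have "\<forall>a b c d :: int. a * d - b * c = 1 \<longrightarrow> (\<forall>z\<in>upper_half_plane.
        f ((of_int a * z + of_int b) / (of_int c * z + of_int d)) = (of_int c * z + of_int d) powi k * f z)"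
      using f by (simp add: modular_forms_def)
    from this[rule_format, of 0 0 "-1" 1 z] that show ?thesis by simp
  qed
  then show "cut f = f \<and> (\<exists>F. modform k f F)"
    using f F by (auto simp: cut_def modular_forms_def modform_def fun_eq_iff)
next
  assume f: "cut f = f \<and> (\<exists>F. modform k f F)"
  then obtain F where F: "modform k f F" by blast
  have "f z = 0" if "z \<notin> upper_half_plane" for z
  proof -
    have "f z = cut f z" using f by simp
    then show ?thesis using that by (simp add: cut_def)
  qed
  moreover have "f holomorphic_on upper_half_plane"
    using F has_q_expansion_holomorphic modform_q_expansion by blast
  ultimately show "f \<in> modular_forms k"
    using modform_SL2[OF F] modform_q_expansion[OF F] unfolding modular_forms_def by (intro CollectI conjI allI impI ballI exI[of _ F]) simp_all
qed

lemma cut_modular_form: "modform k f F \<Longrightarrow> cut f \<in> modular_forms k"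
  unfolding modular_forms_iff using modform_cong[of "cut f" f] by (auto simp: cut_def)

section \<open>Vanishing of cusp forms of weight at most 10\<close>

text \<open>\<open>y ^ k * exp (- 4 * pi * y)\<close> decreases from \<open>y = k / (4 pi)\<close>
  on, which is below 0.85 for \<open>k \<le> 10\<close>. Quantitatively,
  \<open>10 / 0.85 < 12 < 4 pi\<close>.\<close>

lemma exp_power_gt:
  fixes y :: real
  assumes "y \<ge> 87/100" "k \<le> 10"
  shows "y ^ k * exp (- 4 * pi * y) < (85/100) ^ k * exp (- 4 * pi * (85/100))"
proof -
  define s where "s = (y - 85/100) / (85/100)"
  have s: "s > 0" "y = 85/100 * (1 + s)" using assms by (simp_all add: s_def field_simps)
  have "(1 + s) ^ k \<le> (1 + s) ^ 10" using s assms(2) by (intro power_increasing) auto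
  also have "\<dots> \<le> exp s ^ 10" using s exp_ge_add_one_self[of s] by (intro power_mono) auto
  also have "\<dots> = exp (10 * s)" by (simp add: exp_of_nat_mult[symmetric])
  also have "\<dots> < exp (4 * pi * (y - 85/100))"
  proof -
    have "10 * s < 12 * (y - 85/100)" using assms by (simp add: s_def field_simps)
    also have "\<dots> \<le> 4 * pi * (y - 85/100)" using pi_gt3 assms by (intro mult_right_mono) auto
    finally show ?thesis by simp
  qed
  finally have "(1 + s) ^ k < exp (4 * pi * (y - 85/100))" .
  then have "(85/100) ^ k * (1 + s) ^ k * exp (- 4 * pi * y) < (85/100) ^ k * exp (4 * pi * (y - 85/100)) * exp (- 4 * pi * y)"
    by simp
  also have "\<dots> = (85/100) ^ k * exp (- 4 * pi * (85/100))"
    by (simp add: exp_add[symmetric] algebra_simps)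
  also have "(85/100) ^ k * (1 + s) ^ k = y ^ k" by (simp only: s(2) power_mult_distrib)
  finally show ?thesis .
qed

lemma translate_to_strip:
  fixes z :: complex
  obtains n :: int where "\<bar>Re (z + of_int n)\<bar> \<le> 1/2" "Im (z + of_int n) = Im z"
proof
  show "\<bar>Re (z + of_int (- round (Re z)))\<bar> \<le> 1/2"
    using of_int_round_abs_le[of "Re z"] by (simp add: abs_minus_commute)
qed simp

text \<open>
  \<open>|f(z)|\<^sup>2 (Im z)\<^sup>k\<close> is invariant and attains its maximum over \<open>Im z \<ge> 0.87\<close>; by invariance this
  also bounds it on the line \<open>Im z = 0.85\<close>, as \<open>S\<close> and \<open>T\<close> move this line above \<open>0.87\<close>. The maximum
  principle for \<open>f/q\<close> as a function of \<open>q\<close> then gives \<open>k \<ge> 4 pi 0.85 > 10\<close>.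
\<close>

lemma cusp_form_small_weight:
  assumes f: "modform (int k) f F" and F0: "fps_nth F 0 = 0" and k: "k \<le> 10" and w: "w \<in> upper_half_plane"
  shows "f w = 0"
proof (rule ccontr)
  assume "f w \<noteq> 0"
  note qf = modform_q_expansion[OF f]
  define \<Psi> where "\<Psi> = eval_fps (fps_shift 1 F)"
  define \<phi> where "\<phi> = (\<lambda>z. norm (f z) ^ 2 * Im z ^ k)"
  have r: "ereal (norm q) < fps_conv_radius (fps_shift 1 F)" if "norm q < 1" for q
    using has_q_expansion_radius[OF qf that] by simp
  have f\<Psi>: "f z = nome z * \<Psi> (nome z)" if z: "z \<in> upper_half_plane" for z
  proof (cases "F = 0")
    case False
    then have "1 \<le> subdegree F" using F0 by (intro subdegree_geI) auto
    then show ?thesis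
      using eval_fps_shift[of 1 F "nome z"] has_q_expansion_radius[OF qf norm_nome_less_1[OF z]]
        has_q_expansion_eval[OF qf z] nome_nonzero[of z] by (simp add: \<Psi>_def)
  qed (use has_q_expansion_eval[OF qf z] in \<open>simp add: \<Psi>_def\<close>)
  have hol: "\<Psi> holomorphic_on ball 0 1"
    unfolding \<Psi>_def by (rule holomorphic_on_eval_fps) (use r in auto)
  have \<phi>_T: "\<phi> (z + of_int n) = \<phi> z" if "z \<in> upper_half_plane" for z n
    using has_q_expansion_periodic[OF qf that] by (simp add: \<phi>_def)
  have \<phi>_S: "\<phi> (- 1 / z) = \<phi> z" if z: "z \<in> upper_half_plane" for z
  proof -
    have "\<phi> (- 1 / z) = norm (z ^ k * f z) ^ 2 * (Im z / norm z ^ 2) ^ k"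
      unfolding \<phi>_def Im_minus_inverse using modform_S[OF f z] by simp
    also have "\<dots> = \<phi> z"
      using upper_half_plane_nonzero[OF z]
      by (simp add: \<phi>_def norm_mult norm_power power_mult_distrib power_divide power_mult[symmetric] mult.commute)
    finally show ?thesis .
  qed
  \<comment> \<open>By analytic continuation \<open>f\<close> cannot vanish on the whole region
    above 0.87, so the maximum taken below is positive.\<close>
  obtain z1 where z1: "Im z1 \<ge> 87/100" "f z1 \<noteq> 0"
  proof -
    have "\<exists>z1. Im z1 > 87/100 \<and> f z1 \<noteq> 0"
    proof (rule ccontr)
      assume neg: "\<not> (\<exists>z1. Im z1 > 87/100 \<and> f z1 \<noteq> 0)"
      have "f w = 0"
      proof (rule analytic_continuation_open[of "{z. Im z > 87/100}" upper_half_plane f "\<lambda>_. 0"])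
        show "open {z. Im z > 87/100}" by (rule open_halfspace_Im_gt)
        show "{z. Im z > 87/100} \<noteq> {}" by (auto intro!: exI[of _ "\<i>"])
      qed (use neg w has_q_expansion_holomorphic[OF qf] open_upper_half_plane
              convex_connected[OF convex_upper_half_plane] in \<open>auto simp: upper_half_plane_iff\<close>)
      with \<open>f w \<noteq> 0\<close> show False by simp
    qed
    then show ?thesis using that by (auto intro: less_imp_le)
  qed
  define R where "R = exp (- 2 * pi * (87/100))"
  have "R < exp 0" unfolding R_def by (subst exp_less_cancel_iff) simp
  then have R: "0 < R" "R < 1" by (simp_all add: R_def)
  obtain C where C: "\<And>q. norm q \<le> R \<Longrightarrow> norm (\<Psi> q) \<le> C"
  proof -
    have "continuous_on (cball 0 R) \<Psi>"
      using hol R by (intro holomorphic_on_imp_continuous_on holomorphic_on_subset[OF hol]) auto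
    then have "bounded (\<Psi> ` cball 0 R)"
      by (intro compact_imp_bounded compact_continuous_image) auto
    then obtain C where "\<forall>x\<in>cball 0 R. norm (\<Psi> x) \<le> C" unfolding bounded_iff by blast
    then show ?thesis using that[of C] by simp
  qed
  have bound: "\<phi> z \<le> C ^ 2 * (Im z ^ k / exp (Im z))" if z: "Im z \<ge> 87/100" for z
  proof -
    have "z \<in> upper_half_plane" using z by (simp add: upper_half_plane_iff)
    have "norm (nome z) \<le> R" using z by (simp add: norm_nome R_def)
    then have "norm (f z) \<le> norm (nome z) * C"
      using f\<Psi>[OF \<open>z \<in> upper_half_plane\<close>] C by (simp add: norm_mult mult_left_mono)
    then have "norm (f z) ^ 2 \<le> (norm (nome z) * C) ^ 2" by (intro power_mono) auto
    also have "\<dots> = C ^ 2 * exp (- 4 * pi * Im z)"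
      by (simp add: norm_nome power_mult_distrib exp_of_nat_mult[symmetric])
    \<comment> \<open>The decay is weakened to \<open>exp (- Im z)\<close>, which suffices and
      matches the limit \<open>tendsto_power_div_exp_0\<close>.\<close>
    also have "\<dots> \<le> C ^ 2 * exp (- Im z)"
    proof -
      have "1 * Im z \<le> 4 * pi * Im z" using pi_gt3 z by (intro mult_right_mono) auto
      then show ?thesis by (intro mult_left_mono) auto
    qed
    finally show ?thesis using z by (simp add: \<phi>_def exp_minus field_simps mult_right_mono)
  qed
  have \<phi>z1: "\<phi> z1 > 0" using z1 by (simp add: \<phi>_def)
  have "((\<lambda>y. C ^ 2 * (y ^ k / exp y)) \<longlongrightarrow> C ^ 2 * 0) at_top"
    by (intro tendsto_intros tendsto_power_div_exp_0)
  then have "eventually (\<lambda>y. C ^ 2 * (y ^ k / exp y) < \<phi> z1) at_top"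
    using \<phi>z1 by (intro order_tendstoD) auto
  then obtain Y where Y: "\<And>y. y \<ge> Y \<Longrightarrow> C ^ 2 * (y ^ k / exp y) < \<phi> z1"
    by (auto simp: eventually_at_top_linorder)
  define A where "A = cbox (Complex (-1/2) (87/100)) (Complex (1/2) Y)"
  have A_iff: "z \<in> A \<longleftrightarrow> \<bar>Re z\<bar> \<le> 1/2 \<and> 87/100 \<le> Im z \<and> Im z \<le> Y" for z
    by (auto simp: A_def in_cbox_complex_iff)
  have "A \<subseteq> upper_half_plane" by (auto simp: A_iff upper_half_plane_iff)
  then have cont: "continuous_on A \<phi>" unfolding \<phi>_def
    by (intro continuous_intros continuous_on_subset[OF holomorphic_on_imp_continuous_on[OF has_q_expansion_holomorphic[OF qf]]])
  have small: "\<phi> z < \<phi> z1" if "Im z \<ge> 87/100" "Im z > Y" for z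
    using bound[OF that(1)] Y[of "Im z"] that by simp
  have "Im z1 \<le> Y" using small[of z1] z1 by force
  obtain n1 where n1: "\<bar>Re (z1 + of_int n1)\<bar> \<le> 1/2" "Im (z1 + of_int n1) = Im z1" by (rule translate_to_strip)
  then have z1A: "z1 + of_int n1 \<in> A" unfolding A_iff using z1 \<open>Im z1 \<le> Y\<close> by simp
  obtain z0 where z0: "z0 \<in> A" "\<And>z. z \<in> A \<Longrightarrow> \<phi> z \<le> \<phi> z0"
  proof -
    have "compact A" by (simp add: A_def)
    then show ?thesis using continuous_attains_sup[OF _ _ cont] z1A that by blast
  qed
  have z1z0: "\<phi> z1 \<le> \<phi> z0"
    using z0(2)[OF z1A] \<phi>_T[of z1 n1] z1 by (simp add: upper_half_plane_iff)
  have max: "\<phi> z \<le> \<phi> z0" if z: "Im z \<ge> 87/100" for z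
  proof (cases "Im z \<le> Y")
    case True
    obtain n where n: "\<bar>Re (z + of_int n)\<bar> \<le> 1/2" "Im (z + of_int n) = Im z" by (rule translate_to_strip)
    then have "z + of_int n \<in> A" unfolding A_iff using z True by simp
    then show ?thesis using z0(2) \<phi>_T[of z n] z by (fastforce simp: upper_half_plane_iff)
  next
    case False
    then show ?thesis using small[OF z] z1z0 by simp
  qed
  \<comment> \<open>After translation \<open>|z'|^2 \<le> 0.25 + 0.7225 = 0.9725\<close>, and
    \<open>0.85 / 0.9725 > 0.87\<close>. This is what ties the two heights together.\<close>
  have line: "\<phi> z \<le> \<phi> z0" if z: "Im z = 85/100" for z
  proof -
    obtain n where n: "\<bar>Re (z + of_int n)\<bar> \<le> 1/2" "Im (z + of_int n) = Im z" by (rule translate_to_strip)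
    define z' where "z' = z + of_int n"
    have zH: "z \<in> upper_half_plane" "z' \<in> upper_half_plane" using z n by (simp_all add: upper_half_plane_iff z'_def)
    have "\<bar>Re z'\<bar> ^ 2 \<le> (1/2) ^ 2" using n(1) unfolding z'_def by (intro power_mono) auto
    moreover have "norm z' ^ 2 = \<bar>Re z'\<bar> ^ 2 + (85/100) ^ 2"
      using n(2) z unfolding cmod_power2 by (simp add: z'_def)
    ultimately have "norm z' ^ 2 \<le> 9725/10000" by (simp add: power2_eq_square)
    moreover have "norm z' ^ 2 > 0" using upper_half_plane_nonzero[OF zH(2)] by simp
    ultimately have "Im (- 1 / z') \<ge> 87/100"
      unfolding Im_minus_inverse using n z by (simp add: z'_def field_simps)
    from max[OF this] show ?thesis
      using \<phi>_S[OF zH(2)] \<phi>_T[OF zH(1), of n] by (simp add: z'_def)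
  qed
  define S where "S = exp (- 2 * pi * (85/100))"
  have "S < exp 0" unfolding S_def by (subst exp_less_cancel_iff) simp
  then have S: "0 < S" "S < 1" by (simp_all add: S_def)
  \<comment> \<open>The bound on \<open>|\<Psi>|\<close> that \<open>line\<close> yields on the
    circle \<open>|q| = S\<close>, the image of the line \<open>Im z = 0.85\<close>.\<close>
  define B where "B = sqrt (\<phi> z0 / (S ^ 2 * (85/100) ^ k))"
  have z0H: "Im z0 \<ge> 87/100" "z0 \<in> upper_half_plane" using z0(1) by (auto simp: A_iff upper_half_plane_iff)
  have \<phi>z0: "\<phi> z0 > 0" using z1z0 \<phi>z1 by simp
  have "norm (\<Psi> (nome z0)) \<le> B"
  proof (rule maximum_modulus_frontier[of \<Psi> "cball 0 S"])
    show "\<Psi> holomorphic_on interior (cball 0 S)"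
      by (rule holomorphic_on_subset[OF hol]) (use S in auto)
    show "continuous_on (closure (cball 0 S)) \<Psi>"
      by (rule holomorphic_on_imp_continuous_on[OF holomorphic_on_subset[OF hol]]) (use S in auto)
    show "nome z0 \<in> cball 0 S"
      using z0H by (simp add: norm_nome S_def)
    fix q :: complex assume "q \<in> frontier (cball 0 S)"
    then have q: "norm q = S" using S by simp
    then obtain z where z: "z \<in> upper_half_plane" "nome z = q"
      using S nome_surj[of q] by (metis norm_zero less_irrefl)
    then have Imz: "Im z = 85/100" using q norm_nome[of z] by (simp add: S_def)
    have "norm (\<Psi> q) ^ 2 * (S ^ 2 * (85/100) ^ k) \<le> \<phi> z0"
      using line[OF Imz] f\<Psi>[OF z(1)] z(2) q Imz by (simp add: \<phi>_def norm_mult power_mult_distrib mult_ac)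
    then have "norm (\<Psi> q) ^ 2 \<le> \<phi> z0 / (S ^ 2 * (85/100) ^ k)"
      using S by (simp add: pos_le_divide_eq)
    then show "norm (\<Psi> q) \<le> B" unfolding B_def by (rule real_le_rsqrt)
  qed auto
  then have "norm (\<Psi> (nome z0)) ^ 2 \<le> B ^ 2" by (intro power_mono) auto
  also have "\<dots> = \<phi> z0 / (S ^ 2 * (85/100) ^ k)"
    unfolding B_def using \<phi>z0 S by (intro real_sqrt_pow2) auto
  finally have "norm (\<Psi> (nome z0)) ^ 2 * (S ^ 2 * (85/100) ^ k) \<le> \<phi> z0"
    using S by (simp add: pos_le_divide_eq)
  also have "\<phi> z0 = norm (\<Psi> (nome z0)) ^ 2 * (norm (nome z0) ^ 2 * Im z0 ^ k)"
    using f\<Psi>[OF z0H(2)] by (simp add: \<phi>_def norm_mult power_mult_distrib mult_ac)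
  finally have le: "norm (\<Psi> (nome z0)) ^ 2 * (S ^ 2 * (85/100) ^ k) \<le> norm (\<Psi> (nome z0)) ^ 2 * (norm (nome z0) ^ 2 * Im z0 ^ k)" .
  \<comment> \<open>Cancelling this factor leaves \<open>y ^ k * exp (- 4 * pi * y)\<close> at
    height 0.85 bounded by its value at the greater height \<open>Im z0\<close>, against
    \<open>exp_power_gt\<close>.\<close>
  have "\<Psi> (nome z0) \<noteq> 0" using \<phi>z0 f\<Psi>[OF z0H(2)] by (auto simp: \<phi>_def)
  with le have "S ^ 2 * (85/100) ^ k \<le> norm (nome z0) ^ 2 * Im z0 ^ k" by simp
  moreover have "S ^ 2 = exp (- 4 * pi * (85/100))" "norm (nome z0) ^ 2 = exp (- 4 * pi * Im z0)"
    by (simp_all add: S_def norm_nome exp_of_nat_mult[symmetric])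
  ultimately show False
    using exp_power_gt[OF z0H(1) k] by (simp add: mult.commute)
qed

section \<open>The Lipschitz formula and lattice sums\<close>

text \<open>The logarithmic derivative of
  \<open>Gamma z * Gamma (1 - z) = pi / sin (pi z)\<close>.\<close>

lemma Digamma_reflection:
  fixes z :: complex
  assumes z: "z \<notin> \<int>"
  shows "Digamma z - Digamma (1 - z) = - (of_real pi * cot (of_real pi * z))"
proof -
  have "1 - z \<notin> \<int>"
    using z Ints_diff[OF Ints_1, of "1 - z"] by auto
  then have nz: "z \<notin> \<int>\<^sub>\<le>\<^sub>0" "1 - z \<notin> \<int>\<^sub>\<le>\<^sub>0" using z nonpos_Ints_Int by blast+
  have sin: "sin (of_real pi * z) \<noteq> 0"
    using z sin_eq_0[of "of_real pi * z"] by (auto simp: mult.commute)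
  have "((\<lambda>z. Gamma z * Gamma (1 - z)) has_field_derivative
      Gamma z * Gamma (1 - z) * (Digamma z - Digamma (1 - z))) (at z)"
    using nz by (auto intro!: derivative_eq_intros simp: algebra_simps)
  moreover have "((\<lambda>z :: complex. of_real pi / sin (of_real pi * z)) has_field_derivative
      of_real pi / sin (of_real pi * z) * (- (of_real pi * cot (of_real pi * z)))) (at z)"
    using sin by (auto intro!: derivative_eq_intros simp: cot_def field_simps power2_eq_square)
  ultimately have "of_real pi / sin (of_real pi * z) * (Digamma z - Digamma (1 - z)) = 
     of_real pi / sin (of_real pi * z) * (- (of_real pi * cot (of_real pi * z)))"
    unfolding Gamma_reflection_complex by (rule DERIV_unique)
  moreover have "of_real pi / sin (of_real pi * z) \<noteq> 0" using sin by simp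
  ultimately show ?thesis using mult_left_cancel by blast
qed

lemma cot_exp:
  assumes "exp (2 * \<i> * z) \<noteq> 1"
  shows "cot z = - \<i> * (1 + 2 * exp (2 * \<i> * z) / (1 - exp (2 * \<i> * z)))"
proof -
  define e where "e = exp (\<i> * z)"
  have e: "e \<noteq> 0" "e ^ 2 \<noteq> 1" "exp (2 * \<i> * z) = e ^ 2" "exp (- (\<i> * z)) = 1 / e"
    using assms by (simp_all add: e_def exp_minus field_simps exp_of_nat_mult[symmetric] mult.assoc)
  have quot: "(a / 2) / (b / (2 * \<i>)) = \<i> * (a / b)" for a b :: complex by (simp add: divide_simps)
  have "cot z = \<i> * ((e + 1 / e) / (e - 1 / e))"
    unfolding cot_def cos_exp_eq sin_exp_eq e e_def[symmetric] by (simp only: quot)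
  also have "(e + 1 / e) / (e - 1 / e) = (e * (e + 1 / e)) / (e * (e - 1 / e))"
    using e by simp
  also have "\<dots> = (e^2 + 1) / (e^2 - 1)"
    using e(1) by (simp add: ring_distribs power2_eq_square)
  also have "\<dots> = - ((e^2 + 1) / (1 - e^2))"
    by (metis minus_diff_eq minus_divide_right)
  finally have "cot z = - \<i> * ((e^2 + 1) / (1 - e^2))" by simp
  also have "(e^2 + 1) / (1 - e^2) = 1 + 2 * e^2 / (1 - e^2)"
    using e by (simp add: field_simps)
  finally show ?thesis by (simp add: e)
qed

text \<open>The polylogarithm of order \<open>-j\<close>. The constant term 1/2 at
  \<open>j = 0\<close> comes from the cotangent and disappears under \<open>D_fps\<close>.\<close>

definition polylog_fps :: "nat \<Rightarrow> complex fps" where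
  "polylog_fps j = Abs_fps (\<lambda>d. if d = 0 then (if j = 0 then 1/2 else 0) else of_nat d ^ j)"

lemma D_polylog_fps: "D_fps (polylog_fps j) = polylog_fps (Suc j)"
  by (simp add: fps_eq_iff D_fps_nth polylog_fps_def)

lemma upper_half_plane_not_Ints:
  assumes "z \<in> upper_half_plane"
  shows "z \<notin> \<int>" "z \<notin> \<int>\<^sub>\<le>\<^sub>0" "1 - z \<notin> \<int>\<^sub>\<le>\<^sub>0"
  using assms by (auto simp: upper_half_plane_iff complex_is_Int_iff elim!: nonpos_Ints_cases)
    (auto simp: complex_eq_iff)

text \<open>For \<open>j = 0\<close> this is the expansion of \<open>pi cot (pi z)\<close> obtained
  from the reflection formula. Each differentiation raises the index, and the alternating sign comes
  from the inner function \<open>1 - z\<close>.\<close>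

lemma Polygamma_q_expansion:
  "has_q_expansion (\<lambda>z. Polygamma j z + (-1) ^ Suc j * Polygamma j (1 - z))
     (fps_const ((2 * of_real pi * \<i>) ^ Suc j) * polylog_fps j)"
proof (induction j)
  case 0
  define c where "c = 2 * complex_of_real pi * \<i>"
  show ?case unfolding has_q_expansion_def
  proof
    fix z assume z: "z \<in> upper_half_plane"
    define q where "q = nome z"
    have q: "norm q < 1" "q \<noteq> 1" using norm_nome_less_1[OF z] by (auto simp: q_def)
    have "(\<lambda>n. q ^ n) sums (1 / (1 - q))" using q by (intro geometric_sums)
    then have "(\<lambda>n. q ^ n - (if n = 0 then 1/2 else 0)) sums (1 / (1 - q) - 1/2)"
      by (intro sums_diff sums_single[of 0 "\<lambda>_. 1/2 :: complex"])
    then have "(\<lambda>n. c * (q ^ n - (if n = 0 then 1/2 else 0))) sums (c * (1 / (1 - q) - 1/2))"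
      by (rule sums_mult)
    moreover have "(\<lambda>n. c * (q ^ n - (if n = 0 then 1/2 else 0))) = (\<lambda>n. fps_nth (fps_const ((2 * of_real pi * \<i>) ^ Suc 0) * polylog_fps 0) n * nome z ^ n)"
      by (auto simp: fun_eq_iff polylog_fps_def c_def q_def)
    moreover have "c * (1 / (1 - q) - 1/2) = Digamma z - Digamma (1 - z)"
    proof -
      have e: "exp (2 * \<i> * (of_real pi * z)) = q"
        by (simp add: q_def nome_def mult_ac)
      have cot: "cot (of_real pi * z) = - \<i> * (1 + 2 * q / (1 - q))"
        using cot_exp[of "of_real pi * z"] q unfolding e by blast
      show ?thesis
        unfolding Digamma_reflection[OF upper_half_plane_not_Ints(1)[OF z]] cot using q
        by (simp add: c_def divide_simps) (simp add: algebra_simps)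
    qed
    ultimately show "(\<lambda>n. fps_nth (fps_const ((2 * of_real pi * \<i>) ^ Suc 0) * polylog_fps 0) n * nome z ^ n) sums
        (Digamma z + (-1) ^ Suc 0 * Digamma (1 - z))" by simp
  qed
next
  case (Suc j)
  let ?f = "\<lambda>z. Polygamma j z + (-1) ^ Suc j * Polygamma j (1 - z)"
  have "q_deriv ?f z = (Polygamma (Suc j) z + (-1) ^ Suc (Suc j) * Polygamma (Suc j) (1 - z)) / (2 * of_real pi * \<i>)"
    if "z \<in> upper_half_plane" for z
  proof -
    have "(?f has_field_derivative (Polygamma (Suc j) z + (-1) ^ Suc (Suc j) * Polygamma (Suc j) (1 - z))) (at z)"
      using upper_half_plane_not_Ints[OF that] by (auto intro!: derivative_eq_intros)
    then show ?thesis unfolding q_deriv_def by (simp add: DERIV_imp_deriv)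
  qed
  then have "has_q_expansion (\<lambda>z. (Polygamma (Suc j) z + (-1) ^ Suc (Suc j) * Polygamma (Suc j) (1 - z)) / (2 * of_real pi * \<i>))
     (D_fps (fps_const ((2 * of_real pi * \<i>) ^ Suc j) * polylog_fps j))"
    using has_q_expansion_q_deriv[OF Suc.IH] has_q_expansion_cong by (smt (verit) )
  from has_q_expansion_cmult[OF this, of "2 * of_real pi * \<i>"] show ?case
    by (simp add: D_fps_mult D_polylog_fps) (simp add: D_fps_def mult.assoc[symmetric])
qed

lemma has_sum_int:
  fixes f :: "int \<Rightarrow> 'a :: banach"
  assumes "summable (\<lambda>k. norm (f (int k)))" "summable (\<lambda>k. norm (f (- 1 - int k)))"
  shows "(f has_sum ((\<Sum>k. f (int k)) + (\<Sum>k. f (- 1 - int k)))) UNIV"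
proof -
  have "((\<lambda>k. f (int k)) has_sum (\<Sum>k. f (int k))) UNIV" "((\<lambda>k. f (- 1 - int k)) has_sum (\<Sum>k. f (- 1 - int k))) UNIV"
    using assms by (auto intro!: norm_summable_imp_has_sum summable_sums summable_norm_cancel)
  moreover have "bij_betw int UNIV {0..}" by (rule bij_betwI[of _ _ _ nat]) auto
  moreover have "bij_betw (\<lambda>k. - 1 - int k) UNIV {..<0}" by (rule bij_betwI[of _ _ _ "\<lambda>n. nat (- 1 - n)"]) auto
  ultimately have "(f has_sum (\<Sum>k. f (int k))) {0..}" "(f has_sum (\<Sum>k. f (- 1 - int k))) {..<0}"
    using has_sum_reindex_bij_betw by metis+
  moreover have "{0..} \<union> {..<0} = (UNIV :: int set)" "{0..} \<inter> {..<0 :: int} = {}" by auto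
  ultimately show ?thesis using has_sum_Un_disjoint by metis
qed

lemma summable_on_int_quadratic: "(\<lambda>n :: int. 1 / (1 + real_of_int n ^ 2)) summable_on UNIV"
proof -
  have sq: "summable (\<lambda>k. 1 / real k ^ 2)"
    using inverse_power_summable[of 2] by (simp add: field_simps)
  have "norm (1 / (1 + real k ^ 2)) \<le> 1 / real k ^ 2" if "k \<ge> 1" for k
    using that by (simp add: divide_simps add_pos_nonneg)
  then have s: "summable (\<lambda>k. 1 / (1 + real k ^ 2))"
    by (intro summable_comparison_test_ev[OF _ sq]) (auto simp: eventually_sequentially)
  have eq: "norm (1 / (1 + x ^ 2)) = 1 / (1 + x ^ 2)" for x :: real
    unfolding real_norm_def by (intro abs_of_nonneg divide_nonneg_nonneg add_nonneg_nonneg) auto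
  have "summable (\<lambda>k. norm (1 / (1 + real_of_int (int k) ^ 2)))"
    unfolding eq using s by simp
  moreover have "summable (\<lambda>k. 1 / (1 + real (Suc k) ^ 2))"
    using s by (subst summable_Suc_iff)
  then have "summable (\<lambda>k. norm (1 / (1 + real_of_int (- 1 - int k) ^ 2)))"
    unfolding eq by (simp add: power2_eq_square algebra_simps)
  ultimately show ?thesis
    by (rule has_sum_imp_summable[OF has_sum_int])
qed

text \<open>The form is positive definite: the imaginary part controls \<open>x\<close>, and then
  the triangle inequality controls \<open>y\<close>.\<close>

lemma quadratic_form_lower_bound:
  assumes z: "z \<in> upper_half_plane"
  obtains c where "c > 0" "\<And>x y :: real. c * (x^2 + y^2) \<le> norm (of_real x * z + of_real y) ^ 2"
proof -
  define b where "b = Im z"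
  have b: "b > 0" using z by (simp add: b_def upper_half_plane_iff)
  define C where "C = (1 / b) ^ 2 + (1 + norm z / b) ^ 2"
  have C: "C > 0" unfolding C_def using b by (intro add_pos_nonneg) auto
  have "x^2 + y^2 \<le> C * norm (of_real x * z + of_real y) ^ 2" for x y :: real
  proof -
    define N where "N = norm (of_real x * z + of_real y)"
    have "\<bar>Im (of_real x * z + of_real y)\<bar> \<le> N" unfolding N_def by (rule abs_Im_le_cmod)
    then have x: "\<bar>x\<bar> \<le> 1 / b * N" using b by (simp add: b_def abs_mult field_simps)
    have "\<bar>y\<bar> = norm ((of_real x * z + of_real y) - of_real x * z)" by simp
    also have "\<dots> \<le> N + \<bar>x\<bar> * norm z"
      unfolding N_def by (rule order.trans[OF norm_triangle_ineq4]) (simp add: norm_mult)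
    also have "\<dots> \<le> N + 1 / b * N * norm z" using x by (intro add_mono mult_right_mono) auto
    also have "\<dots> = (1 + norm z / b) * N" by (simp add: algebra_simps)
    finally have y: "\<bar>y\<bar> \<le> (1 + norm z / b) * N" .
    have "\<bar>x\<bar>^2 + \<bar>y\<bar>^2 \<le> (1 / b * N)^2 + ((1 + norm z / b) * N)^2"
      using x y by (intro add_mono power_mono) auto
    then show ?thesis by (simp only: C_def N_def[symmetric] distrib_right[of _ _ "N^2"] power_mult_distrib power2_abs)
  qed
  then have "1 / C * (x^2 + y^2) \<le> norm (of_real x * z + of_real y) ^ 2" for x y :: real
    using C by (simp add: pos_divide_le_eq mult.commute[of _ C])
  then show ?thesis using C by (intro that[of "1 / C"]) auto
qed

lemma summable_on_int_imp_summable: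
  fixes g :: "int \<Rightarrow> real"
  assumes "g summable_on UNIV"
  shows "summable (\<lambda>k. g (int k))" "summable (\<lambda>k. g (- 1 - int k))"
proof -
  have "inj int" "inj (\<lambda>k. - 1 - int k)" by (auto simp: inj_def)
  moreover have "g summable_on range int" "g summable_on range (\<lambda>k. - 1 - int k)"
    using assms by (auto intro: summable_on_subset_banach)
  ultimately show "summable (\<lambda>k. g (int k))" "summable (\<lambda>k. g (- 1 - int k))"
    by (auto simp: summable_on_reindex o_def intro: summable_on_imp_summable)
qed

lemma summable_on_times:
  fixes u :: "'a \<Rightarrow> real" and v :: "'b \<Rightarrow> real"
  assumes "u summable_on A" "v summable_on B" "\<And>x. x \<in> A \<Longrightarrow> u x \<ge> 0" "\<And>y. y \<in> B \<Longrightarrow> v y \<ge> 0"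
  shows "(\<lambda>(x, y). u x * v y) summable_on A \<times> B"
proof (rule summable_on_SigmaI[where g = "\<lambda>x. u x * infsum v B"])
  show "((\<lambda>y. case (x, y) of (x, y) \<Rightarrow> u x * v y) has_sum u x * infsum v B) B" for x
    using assms(2) by (simp add: has_sum_cmult_right)
  show "(\<lambda>x. u x * infsum v B) summable_on A"
    using assms(1) by (rule summable_on_cmult_left)
qed (use assms in auto)

lemma quadratic_form_power_bound:
  assumes z: "z \<in> upper_half_plane"
  obtains C where "C > 0"
    "\<And>x y :: real. norm (1 / (of_real x * z + of_real y) ^ (2 * e)) \<le> C / (x^2 + y^2) ^ e"
proof -
  obtain c where c: "c > 0" "\<And>x y :: real. c * (x^2 + y^2) \<le> norm (of_real x * z + of_real y) ^ 2"
    using quadratic_form_lower_bound[OF z] by blast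
  have "norm (1 / (of_real x * z + of_real y) ^ (2 * e)) \<le> 1 / c ^ e / (x^2 + y^2) ^ e" for x y :: real
  proof (cases "x^2 + y^2 = 0")
    case True
    then have "x = 0" "y = 0" by (simp_all add: sum_power2_eq_zero_iff)
    then show ?thesis by (cases e) auto
  next
    case False
    then have pos: "c * (x^2 + y^2) > 0" using c(1) by (simp add: sum_power2_gt_zero_iff)
    have "(c * (x^2 + y^2)) ^ e \<le> norm (of_real x * z + of_real y) ^ (2 * e)"
      unfolding power_mult using c(2) pos by (intro power_mono) auto
    then have "1 / norm (of_real x * z + of_real y) ^ (2 * e) \<le> 1 / (c * (x^2 + y^2)) ^ e"
      using pos by (intro divide_left_mono mult_pos_pos less_le_trans[OF zero_less_power[OF pos]]) auto
    then show ?thesis by (simp add: norm_divide norm_power power_mult_distrib)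
  qed
  then show ?thesis using c(1) by (intro that[of "1 / c ^ e"]) auto
qed

lemma one_plus_square_le_power:
  assumes "e \<ge> 1" "m \<noteq> 0"
  shows "1 / ((real_of_int m)^2 + x^2) ^ e \<le> 1 / (1 + x^2)"
proof -
  have "1 \<le> m^2" using assms(2) by (simp add: int_one_le_iff_zero_less)
  then have m: "1 \<le> (real_of_int m)^2" by (metis of_int_1_le_iff of_int_power)
  then have "1 + x^2 \<le> (real_of_int m)^2 + x^2" by simp
  also have "\<dots> = ((real_of_int m)^2 + x^2) ^ 1" by simp
  also have "\<dots> \<le> ((real_of_int m)^2 + x^2) ^ e" using m assms(1) by (intro power_increasing) (auto intro: add_increasing2)
  finally show ?thesis by (intro divide_left_mono) (auto intro!: mult_pos_pos add_pos_nonneg zero_less_power less_le_trans[OF _ \<open>1 + x^2 \<le> _\<close>])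
qed

lemma row_abs_summable:
  assumes z: "z \<in> upper_half_plane" and e: "e \<ge> 1" and m: "m \<noteq> 0"
  shows "(\<lambda>n :: int. norm (1 / (of_int m * z + of_int n) ^ (2 * e))) summable_on UNIV"
proof -
  obtain C where C: "C > 0" "\<And>x y :: real. norm (1 / (of_real x * z + of_real y) ^ (2 * e)) \<le> C / (x^2 + y^2) ^ e"
    using quadratic_form_power_bound[OF z] by blast
  show ?thesis
  proof (rule Infinite_Sum.abs_summable_on_comparison_test'[OF summable_on_cmult_right[OF summable_on_int_quadratic, of C]])
    fix n :: int
    have "norm (1 / (of_int m * z + of_int n) ^ (2 * e)) \<le> C * (1 / ((real_of_int m)^2 + (real_of_int n)^2) ^ e)"
      using C(2)[of "real_of_int m" "real_of_int n"] by simp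
    also have "\<dots> \<le> C * (1 / (1 + (real_of_int n)^2))"
      using C(1) one_plus_square_le_power[OF e m] by (intro mult_left_mono) auto
    finally show "norm (1 / (of_int m * z + of_int n) ^ (2 * e)) \<le> C * (1 / (1 + (real_of_int n)^2))" .
  qed
qed

definition lipschitz_const :: "nat \<Rightarrow> complex" where
  "lipschitz_const e = (2 * of_real pi * \<i>) ^ (2 * e) / fact (2 * e - 1)"

text \<open>The terms with \<open>n \<ge> 0\<close> give the Polygamma function at \<open>x\<close>,
  those with \<open>n < 0\<close> give it at \<open>1 - x\<close>; evenness of the exponent absorbs
  the sign.\<close>

lemma lipschitz_formula:
  assumes x: "x \<in> upper_half_plane" and e: "e \<ge> 1"
  shows "((\<lambda>n :: int. 1 / (x + of_int n) ^ (2 * e)) has_sum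
      lipschitz_const e * eval_fps (polylog_fps (2 * e - 1)) (nome x)) UNIV"
proof -
  define j where "j = 2 * e - 1"
  have j: "Suc j = 2 * e" "j \<noteq> 0" using e by (simp_all add: j_def)
  define f where "f = (\<lambda>n :: int. 1 / (x + of_int n) ^ (2 * e))"
  have "(\<lambda>n. norm (f n)) summable_on UNIV"
    using row_abs_summable[OF x e, of 1] by (simp add: f_def)
  from has_sum_int[OF summable_on_int_imp_summable[OF this]]
  have hs: "(f has_sum ((\<Sum>k. f (int k)) + (\<Sum>k. f (- 1 - int k)))) UNIV" .
  have m1: "(-1 :: complex) ^ Suc j = 1" unfolding j by simp
  have "Polygamma j x = fact j * (\<Sum>k. f (int k))"
    unfolding Polygamma_def using j m1 by (simp add: f_def inverse_eq_divide)
  moreover have "f (- 1 - int k) = inverse ((1 - x + of_nat k) ^ Suc j)" for k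
  proof -
    have "x + of_int (- 1 - int k) = - (1 - x + of_nat k)" by simp
    then show ?thesis unfolding f_def j by (simp only: power_minus_even even_mult_iff even_numeral simp_thms inverse_eq_divide)
  qed
  then have "Polygamma j (1 - x) = fact j * (\<Sum>k. f (- 1 - int k))"
    unfolding Polygamma_def using j m1 by simp
  ultimately have "fact j * ((\<Sum>k. f (int k)) + (\<Sum>k. f (- 1 - int k))) = Polygamma j x + (-1) ^ Suc j * Polygamma j (1 - x)"
    using m1 by (simp add: algebra_simps)
  also have "\<dots> = (2 * of_real pi * \<i>) ^ Suc j * eval_fps (polylog_fps j) (nome x)"
  proof -
    note q = Polygamma_q_expansion[of j]
    have "fps_conv_radius (polylog_fps j) \<ge> 1"
      using q by (simp add: has_q_expansion_iff fps_conv_radius_cmult_left)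
    then have "ereal (norm (nome x)) < fps_conv_radius (polylog_fps j)"
      using norm_nome_less_1[OF x] by (metis less_le_trans less_ereal.simps(1) one_ereal_def)
    then show ?thesis
      using has_q_expansion_eval[OF q x] by (simp add: eval_fps_mult)
  qed
  finally have "(\<Sum>k. f (int k)) + (\<Sum>k. f (- 1 - int k)) = lipschitz_const e * eval_fps (polylog_fps j) (nome x)"
    unfolding lipschitz_const_def j_def[symmetric] j[symmetric] by (simp add: field_simps)
  then show ?thesis using hs by (simp add: f_def j_def)
qed

lemma lipschitz_formula_row:
  assumes z: "z \<in> upper_half_plane" and e: "e \<ge> 1" and m: "m \<noteq> 0"
  shows "((\<lambda>n :: int. 1 / (of_int m * z + of_int n) ^ (2 * e)) has_sum
      lipschitz_const e * eval_fps (polylog_fps (2 * e - 1)) (nome z ^ nat \<bar>m\<bar>)) UNIV"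
proof -
  have pos: "((\<lambda>n :: int. 1 / (of_nat k * z + of_int n) ^ (2 * e)) has_sum
      lipschitz_const e * eval_fps (polylog_fps (2 * e - 1)) (nome z ^ k)) UNIV" if "k > 0" for k
  proof -
    have "of_nat k * z \<in> upper_half_plane" using z that by (simp add: upper_half_plane_iff)
    moreover have "nome (of_nat k * z) = nome z ^ k"
      by (simp add: nome_def exp_of_nat_mult[symmetric] mult_ac)
    ultimately show ?thesis using lipschitz_formula[OF _ e, of "of_nat k * z"] by simp
  qed
  show ?thesis
  proof (cases "m > 0")
    case True
    then show ?thesis using pos[of "nat m"] by simp
  next
    case False
    have eq: "1 / (of_nat (nat \<bar>m\<bar>) * z + of_int (- n)) ^ (2 * e) = 1 / (of_int m * z + of_int n) ^ (2 * e)" for n :: int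
    proof -
      have "of_nat (nat \<bar>m\<bar>) * z + of_int (- n) = - (of_int m * z + of_int n)"
        using False m by simp
      then show ?thesis by (simp only: power_minus_even even_mult_iff even_numeral simp_thms)
    qed
    have "bij_betw uminus (UNIV :: int set) UNIV" by (rule bij_betwI[of _ _ _ uminus]) auto
    from has_sum_reindex_bij_betw[OF this, of "\<lambda>n. 1 / (of_nat (nat \<bar>m\<bar>) * z + of_int n) ^ (2 * e)"]
    show ?thesis using pos[of "nat \<bar>m\<bar>"] m unfolding eq by simp
  qed
qed

section \<open>Lambert series and the summation of lattice rows\<close>

definition sigma_fps :: "nat \<Rightarrow> complex fps" where
  "sigma_fps j = Abs_fps (\<lambda>n. of_nat (divisor_sum j n))"

lemma divisor_sum_0: "divisor_sum j 0 = 0"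
  by (simp add: divisor_sum_def)

lemma eis_fps_conv_sigma: "eis_fps j c = 1 + fps_const (of_int c) * sigma_fps j"
  by (simp add: fps_eq_iff eis_fps_def sigma_fps_def divisor_sum_0)

lemma sigma_fps_radius: "fps_conv_radius (sigma_fps j) \<ge> 1"
proof -
  have "sigma_fps j = eis_fps j 1 - 1" by (simp add: eis_fps_conv_sigma)
  then show ?thesis using fps_conv_radius_diff[of "eis_fps j 1" 1] eis_fps_radius[of j 1] by (simp add: min_def split: if_splits)
qed

text \<open>The double series over \<open>d ^ j * q ^ (m * d)\<close> converges absolutely. It is
  summed once over \<open>d\<close> for fixed \<open>m\<close>, and once over the divisors
  \<open>d\<close> of \<open>n = m * d\<close>.\<close>

lemma lambert_series:
  assumes q: "norm q < 1" and j: "j \<ge> 1"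
  shows "((\<lambda>m. eval_fps (polylog_fps j) (q ^ m)) has_sum eval_fps (sigma_fps j) q) {1..}"
proof -
  \<comment> \<open>The maximum with 1/2 keeps \<open>r\<close> positive, so that dividing by
    \<open>r\<close> is harmless even for \<open>q = 0\<close>.\<close>
  define r where "r = max (norm q) (1 / 2)"
  have r: "0 < r" "r < 1" "norm q \<le> r" using q by (auto simp: r_def)
  define F :: "nat \<times> nat \<Rightarrow> complex" where "F = (\<lambda>(m, d). of_nat d ^ j * q ^ (m * d))"
  have "summable (\<lambda>m. r ^ m / r)" using r by (intro summable_divide summable_geometric) auto
  then have u: "(\<lambda>m. r ^ m / r) summable_on {1..}"
    using r by (intro summable_on_subset_banach[OF summable_nonneg_imp_summable_on]) auto
  have v: "(\<lambda>d. real d ^ j * r ^ d) summable_on {1..}"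
    using r summable_power_mult_geometric[of r j] by (intro summable_on_subset_banach[OF summable_nonneg_imp_summable_on]) auto
  have "(\<lambda>x. norm (F x)) summable_on {1..} \<times> {1..}"
  proof (rule Infinite_Sum.abs_summable_on_comparison_test'[OF summable_on_times[OF u v]])
    fix x :: "nat \<times> nat" assume "x \<in> {1..} \<times> {1..}"
    then obtain m d where x: "x = (m, d)" "m \<ge> 1" "d \<ge> 1" by auto
    have "norm q ^ (m * d) \<le> r ^ (m * d)" using r by (intro power_mono) auto
    \<comment> \<open>Replacing the product in the exponent by a sum separates the variables, so the
      majorant is a product of two convergent series.\<close>
    also have "m + d - 1 \<le> m * d"
    proof -
      have "0 \<le> (int m - 1) * (int d - 1)" using x by simp
      then have "int m + int d - 1 \<le> int (m * d)" by (simp add: algebra_simps)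
      then show ?thesis using x by linarith
    qed
    then have "r ^ (m * d) \<le> r ^ (m + d - 1)" using r by (intro power_decreasing) auto
    also have "\<dots> = r ^ m / r * r ^ d" using r x by (simp add: power_diff power_add)
    finally have "norm q ^ (m * d) \<le> r ^ m / r * r ^ d" .
    then have "real d ^ j * norm q ^ (m * d) \<le> real d ^ j * (r ^ m / r * r ^ d)"
      by (intro mult_left_mono) auto
    then show "norm (F x) \<le> (case x of (m, d) \<Rightarrow> r ^ m / r * (real d ^ j * r ^ d))"
      by (simp add: x F_def norm_mult norm_power mult_ac)
  qed (use r in auto)
  then have sF: "F summable_on {1..} \<times> {1..}" by (rule abs_summable_summable)
  then obtain S where S: "(F has_sum S) ({1..} \<times> {1..})" by (auto simp: summable_on_def)
  have "((\<lambda>m. eval_fps (polylog_fps j) (q ^ m)) has_sum S) {1..}"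
  proof (rule has_sum_SigmaD[OF S])
    fix m :: nat assume m: "m \<in> {1..}"
    have "norm (q ^ m) \<le> norm q ^ 1" unfolding norm_power using m q by (intro power_decreasing) auto
    then have "norm (q ^ m) < 1" using q by simp
    moreover have "fps_conv_radius (polylog_fps j) \<ge> 1"
      using Polygamma_q_expansion[of j] by (simp add: has_q_expansion_iff fps_conv_radius_cmult_left)
    ultimately have rad: "ereal (norm (q ^ m)) < fps_conv_radius (polylog_fps j)"
      by (metis less_le_trans less_ereal.simps(1) one_ereal_def)
    have "((\<lambda>d. fps_nth (polylog_fps j) d * (q ^ m) ^ d) has_sum eval_fps (polylog_fps j) (q ^ m)) UNIV"
      by (intro norm_summable_imp_has_sum norm_summable_fps sums_eval_fps rad)
    then show "((\<lambda>d. F (m, d)) has_sum eval_fps (polylog_fps j) (q ^ m)) {1..}"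
      using j by (subst has_sum_cong_neutral[where T = UNIV and g = "\<lambda>d. fps_nth (polylog_fps j) d * (q ^ m) ^ d"])
        (auto simp: F_def polylog_fps_def power_mult)
  qed
  moreover have "S = eval_fps (sigma_fps j) q"
  proof -
    have bij: "bij_betw (\<lambda>(m, d). (m * d, d)) ({1..} \<times> {1..}) (SIGMA n:{1..}. {d :: nat. d dvd n})"
      by (rule bij_betwI[of _ _ _ "\<lambda>(n, d). (n div d, d)"])
         (auto simp: Suc_le_eq dvd_div_eq_0_iff intro!: Nat.gr0I dest: dvd_imp_le)
    have "((\<lambda>(n, d). of_nat d ^ j * q ^ n) has_sum S) (SIGMA n:{1..}. {d. d dvd n})"
      using S by (subst has_sum_reindex_bij_betw[OF bij, symmetric]) (simp add: F_def case_prod_unfold)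
    then have "((\<lambda>n. of_nat (divisor_sum j n) * q ^ n) has_sum S) {1..}"
    proof (rule has_sum_SigmaD)
      fix n :: nat assume "n \<in> {1..}"
      then have "finite {d. d dvd n}" by simp
      then have "((\<lambda>d. of_nat d ^ j * q ^ n) has_sum (\<Sum>d | d dvd n. of_nat d ^ j * q ^ n)) {d. d dvd n}"
        by (rule has_sum_finite)
      then show "((\<lambda>y. case (n, y) of (n, d) \<Rightarrow> of_nat d ^ j * q ^ n) has_sum of_nat (divisor_sum j n) * q ^ n) {d. d dvd n}"
        by (simp add: divisor_sum_def sum_distrib_right)
    qed
    then have "((\<lambda>n. of_nat (divisor_sum j n) * q ^ n) has_sum S) UNIV"
      by (subst has_sum_cong_neutral[where T = "{1..}" and g = "\<lambda>n. of_nat (divisor_sum j n) * q ^ n"])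
         (auto simp: divisor_sum_0 not_le)
    then have "(\<lambda>n. of_nat (divisor_sum j n) * q ^ n) sums S" by (rule has_sum_imp_sums)
    then show ?thesis by (simp add: eval_fps_def sigma_fps_def sums_iff)
  qed
  ultimately show ?thesis by simp
qed

text \<open>For \<open>e \<ge> 1\<close> the term at \<open>n = 0\<close> is
  \<open>1 / 0 = 0\<close>, so this is twice the zeta value at \<open>2 e\<close>.\<close>

definition lattice_const :: "nat \<Rightarrow> complex" where
  "lattice_const e = (\<Sum>\<^sub>\<infinity>n :: int. 1 / of_int n ^ (2 * e))"

definition lattice_fps :: "nat \<Rightarrow> complex fps" where
  "lattice_fps e = fps_const (lattice_const e) + fps_const (2 * lipschitz_const e) * sigma_fps (2 * e - 1)"

text \<open>Defined by its expansion and not as a double series, so that \<open>e = 1\<close> is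
  covered, where the double series does not converge absolutely.\<close>

definition lattice_sum :: "nat \<Rightarrow> complex \<Rightarrow> complex" where
  "lattice_sum e z = eval_fps (lattice_fps e) (nome z)"

lemma lattice_sum_q_expansion: "has_q_expansion (lattice_sum e) (lattice_fps e)"
proof -
  have "fps_conv_radius (fps_const (2 * lipschitz_const e) * sigma_fps (2 * e - 1)) \<ge> 1"
    using fps_conv_radius_mult[of "fps_const (2 * lipschitz_const e)" "sigma_fps (2 * e - 1)"] sigma_fps_radius[of "2 * e - 1"]
    by (simp add: min_def split: if_splits)
  then have "fps_conv_radius (lattice_fps e) \<ge> 1"
    unfolding lattice_fps_def using fps_conv_radius_add[of "fps_const (lattice_const e)" "fps_const (2 * lipschitz_const e) * sigma_fps (2 * e - 1)"]
    by (simp add: min_def split: if_splits)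
  then show ?thesis by (simp add: has_q_expansion_iff lattice_sum_def)
qed

definition lattice_row :: "nat \<Rightarrow> complex \<Rightarrow> int \<Rightarrow> complex" where
  "lattice_row e z m = (\<Sum>\<^sub>\<infinity>n :: int. 1 / (of_int m * z + of_int n) ^ (2 * e))"

lemma inverse_even_powers_summable:
  assumes "e \<ge> 1"
  shows "(\<lambda>n :: int. norm (1 / (of_int n :: complex) ^ (2 * e))) summable_on UNIV"
proof (rule Infinite_Sum.abs_summable_on_comparison_test'[OF summable_on_cmult_right[OF summable_on_int_quadratic, of 2]])
  fix n :: int
  show "norm (1 / (of_int n :: complex) ^ (2 * e)) \<le> 2 * (1 / (1 + (real_of_int n)^2))"
  proof (cases "n = 0")
    case False
    have "1 / (real_of_int n ^ 2 + 0^2) ^ e \<le> 1 / (real_of_int n ^ 2 + 0^2) ^ 1"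
    proof -
      have "1 \<le> n^2" using False by (simp add: int_one_le_iff_zero_less)
      then have n: "1 \<le> (real_of_int n)^2" by (metis of_int_1_le_iff of_int_power)
      then show ?thesis using assms less_le_trans[OF zero_less_one n] by (intro divide_left_mono power_increasing mult_pos_pos zero_less_power) auto
    qed
    also have "\<dots> \<le> 2 * (1 / (1 + (real_of_int n)^2))"
    proof -
      have "1 \<le> n^2" using False by (simp add: int_one_le_iff_zero_less)
      then have "1 \<le> (real_of_int n)^2" by (metis of_int_1_le_iff of_int_power)
      then show ?thesis by (simp add: divide_simps)
    qed
    finally show ?thesis by (simp add: norm_divide norm_power power_mult)
  qed (use assms in \<open>simp add: power_0_left\<close>)
qed

lemma row_has_sum:
  assumes z: "z \<in> upper_half_plane" and e: "e \<ge> 1"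
  shows "((\<lambda>n :: int. 1 / (of_int m * z + of_int n) ^ (2 * e)) has_sum lattice_row e z m) UNIV"
proof (cases "m = 0")
  case True
  then show ?thesis
    using abs_summable_summable[OF inverse_even_powers_summable[OF e]] by (simp add: lattice_row_def)
next
  case False
  then show ?thesis
    using lipschitz_formula_row[OF z e False] infsumI by (fastforce simp: lattice_row_def)
qed

text \<open>Each row with \<open>m \<noteq> 0\<close> is evaluated by the Lipschitz formula, and the
  rows add up to a Lambert series, once for each sign of \<open>m\<close>. Summing in this order
  works for \<open>e = 1\<close> as well.\<close>

lemma lattice_row_has_sum:
  assumes z: "z \<in> upper_half_plane" and e: "e \<ge> 1"
  shows "(lattice_row e z has_sum lattice_sum e z) UNIV"
proof -
  let ?g = "\<lambda>m. eval_fps (polylog_fps (2 * e - 1)) (nome z ^ m)"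
  let ?S = "lipschitz_const e * eval_fps (sigma_fps (2 * e - 1)) (nome z)"
  have row: "lattice_row e z m = lipschitz_const e * ?g (nat \<bar>m\<bar>)" if "m \<noteq> 0" for m
    using lipschitz_formula_row[OF z e that] infsumI unfolding lattice_row_def by blast
  have "((\<lambda>m. lipschitz_const e * ?g m) has_sum ?S) {1..}"
    using e by (intro has_sum_cmult_right lambert_series norm_nome_less_1[OF z]) simp
  then have S: "((\<lambda>m. lattice_row e z (int m)) has_sum ?S) {1..}" "((\<lambda>m. lattice_row e z (- int m)) has_sum ?S) {1..}"
    by (subst has_sum_cong[where g = "\<lambda>m. lipschitz_const e * ?g m"]; simp add: row)+
  have bij: "bij_betw int {1..} {1..}" "bij_betw (\<lambda>m. - int m) {1..} {..-1}"
    by (rule bij_betwI[of _ _ _ nat]; force) (rule bij_betwI[of _ _ _ "\<lambda>m. nat (- m)"]; force)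
  have "(lattice_row e z has_sum ?S) {1..}" "(lattice_row e z has_sum ?S) {..-1}"
    using S has_sum_reindex_bij_betw[OF bij(1), of "lattice_row e z"] has_sum_reindex_bij_betw[OF bij(2), of "lattice_row e z"] by blast+
  then have "(lattice_row e z has_sum (?S + ?S)) ({1..} \<union> {..-1})"
    by (rule has_sum_Un_disjoint) auto
  moreover have "(lattice_row e z has_sum lattice_row e z 0) {0}"
    using has_sum_finite[of "{0}" "lattice_row e z"] by simp
  ultimately have "(lattice_row e z has_sum (lattice_row e z 0 + (?S + ?S))) ({0} \<union> ({1..} \<union> {..-1}))"
    by (intro has_sum_Un_disjoint[where A = "{0}"]) simp_all
  moreover have "{0} \<union> ({1..} \<union> {..-1}) = (UNIV :: int set)" by auto
  moreover have "lattice_row e z 0 + (?S + ?S) = lattice_sum e z"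
  proof -
    have "ereal (norm (nome z)) < fps_conv_radius (sigma_fps (2 * e - 1))"
      using sigma_fps_radius[of "2 * e - 1"] norm_nome_less_1[OF z] by (metis less_le_trans less_ereal.simps(1) one_ereal_def)
    moreover from this have "ereal (norm (nome z)) < fps_conv_radius (fps_const (2 * lipschitz_const e) * sigma_fps (2 * e - 1))"
      by (cases "lipschitz_const e = 0") (simp_all add: fps_conv_radius_cmult_left)
    ultimately show ?thesis
      unfolding lattice_sum_def lattice_fps_def lattice_row_def
      by (subst eval_fps_add) (simp_all add: eval_fps_mult lattice_const_def)
  qed
  ultimately show ?thesis by simp
qed

text \<open>Each of the three pieces \<open>1\<close>, \<open>a + b\<close> and \<open>a * b\<close>
  of \<open>(1 + a) * (1 + b)\<close> is at most \<open>(a + b)^2\<close>. The estimate separates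
  the variables of \<open>1 / (m^2 + n^2)^2\<close>.\<close>

lemma lattice_product_bound:
  fixes a b :: real
  assumes "a \<ge> 0" "b \<ge> 0" "a + b \<ge> 1"
  shows "1 / (a + b)^2 \<le> 3 * (1 / (1 + a) * (1 / (1 + b)))"
proof -
  have "1 * 1 \<le> (a + b) * (a + b)" using assms by (intro mult_mono) auto
  moreover have "1 * (a + b) \<le> (a + b) * (a + b)" using assms by (intro mult_right_mono) auto
  moreover have "a * b \<le> (a + b) * (a + b)" using assms by (intro mult_mono) auto
  ultimately have "(1 + a) * (1 + b) \<le> 3 * (a + b)^2" by (simp add: algebra_simps power2_eq_square)
  then have "1 / (3 * (a + b)^2) \<le> 1 / ((1 + a) * (1 + b))"
    using assms by (intro divide_left_mono mult_pos_pos) auto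
  then show ?thesis by simp
qed

lemma summable_on_int_quadratic_times:
  "(\<lambda>(m :: int, n :: int). 1 / (1 + (real_of_int m)^2) * (1 / (1 + (real_of_int n)^2))) summable_on UNIV \<times> UNIV"
  by (rule summable_on_times[OF summable_on_int_quadratic summable_on_int_quadratic]) (auto intro!: divide_nonneg_nonneg add_nonneg_nonneg)

lemma lattice_summable:
  fixes f :: "int \<times> int \<Rightarrow> complex"
  assumes "C \<ge> 0" and f: "\<And>m n. (m, n) \<noteq> (0, 0) \<Longrightarrow> norm (f (m, n)) \<le> C / ((real_of_int m)^2 + (real_of_int n)^2)^2"
  shows "f summable_on UNIV"
proof -
  \<comment> \<open>The second argument of the maximum takes care of the unrestricted value at the
    origin.\<close>
  define C' where "C' = max (3 * C) (norm (f (0, 0)))"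
  have "(\<lambda>x. norm (f x)) summable_on UNIV \<times> UNIV"
  proof (rule Infinite_Sum.abs_summable_on_comparison_test'[OF summable_on_cmult_right[OF summable_on_int_quadratic_times, of C']])
    fix x :: "int \<times> int"
    obtain m n where x: "x = (m, n)" by (cases x)
    define p where "p = 1 / (1 + (real_of_int m)^2) * (1 / (1 + (real_of_int n)^2))"
    have p: "p \<ge> 0" unfolding p_def by (intro mult_nonneg_nonneg divide_nonneg_nonneg add_nonneg_nonneg) auto
    have "norm (f x) \<le> C' * p"
    proof (cases "x = (0, 0)")
      case True
      then show ?thesis by (auto simp: p_def x C'_def)
    next
      case False
      then have "m^2 + n^2 \<ge> 1" by (simp add: x int_one_le_iff_zero_less sum_power2_gt_zero_iff)
      then have "(real_of_int m)^2 + (real_of_int n)^2 \<ge> 1"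
        by (metis of_int_1_le_iff of_int_power of_int_add)
      then have "C * (1 / ((real_of_int m)^2 + (real_of_int n)^2)^2) \<le> C * (3 * p)"
        unfolding p_def using assms(1) by (intro mult_left_mono lattice_product_bound) auto
      also have "\<dots> \<le> C' * p" using p by (simp add: C'_def mult.assoc[symmetric] mult_right_mono mult.commute[of C])
      finally show ?thesis using f[of m n] False by (simp add: x)
    qed
    then show "norm (f x) \<le> C' * (case x of (m, n) \<Rightarrow> 1 / (1 + (real_of_int m)^2) * (1 / (1 + (real_of_int n)^2)))"
      by (simp add: x p_def)
  qed
  then show ?thesis using abs_summable_summable by fastforce
qed

lemma lattice_term_S:
  assumes "z \<in> upper_half_plane"
  shows "1 / (of_int m * (- 1 / z) + of_int n) ^ (2 * e) = z ^ (2 * e) * (1 / (of_int n * z + of_int (- m)) ^ (2 * e))"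
proof -
  have "of_int m * (- 1 / z) + of_int n = (of_int n * z + of_int (- m)) / z"
    using upper_half_plane_nonzero[OF assms] by (simp add: field_simps)
  then show ?thesis by (simp add: power_divide)
qed

text \<open>For \<open>e \<ge> 2\<close> the double series converges absolutely, and
  \<open>S\<close> merely permutes its terms by \<open>(m, n)\<close> to \<open>(n, -m)\<close>, up
  to the automorphy factor.\<close>

lemma lattice_sum_modform:
  assumes e: "e \<ge> 2"
  shows "modform (2 * int e) (lattice_sum e) (lattice_fps e)"
  unfolding modform_def
proof (intro conjI ballI lattice_sum_q_expansion)
  fix z assume z: "z \<in> upper_half_plane"
  define a where "a = (\<lambda>z (m :: int, n :: int). 1 / (of_int m * z + of_int n :: complex) ^ (2 * e))"
  have total: "(a z has_sum lattice_sum e z) (UNIV \<times> UNIV)" if z: "z \<in> upper_half_plane" for z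
  proof (rule has_sum_SigmaI)
    show "(lattice_row e z has_sum lattice_sum e z) UNIV"
      using e by (intro lattice_row_has_sum z) simp
    show "((\<lambda>n. a z (m, n)) has_sum lattice_row e z m) UNIV" for m
      using row_has_sum[OF z, of e m] e by (simp add: a_def)
    obtain C where C: "C > 0" "\<And>x y :: real. norm (1 / (of_real x * z + of_real y) ^ (2 * e)) \<le> C / (x^2 + y^2) ^ e"
      using quadratic_form_power_bound[OF z] by blast
    have "norm (a z (m, n)) \<le> C / ((real_of_int m)^2 + (real_of_int n)^2)^2" if "(m, n) \<noteq> (0, 0)" for m n
    proof -
      have "m^2 + n^2 \<ge> 1" using that by (simp add: int_one_le_iff_zero_less sum_power2_gt_zero_iff)
      then have ge: "(real_of_int m)^2 + (real_of_int n)^2 \<ge> 1"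
        by (metis of_int_1_le_iff of_int_power of_int_add)
      have "norm (a z (m, n)) \<le> C / ((real_of_int m)^2 + (real_of_int n)^2) ^ e"
        using C(2)[of m n] by (simp add: a_def)
      also have "\<dots> \<le> C / ((real_of_int m)^2 + (real_of_int n)^2)^2"
        using ge C(1) e by (intro divide_left_mono power_increasing mult_pos_pos) auto
      finally show ?thesis .
    qed
    from lattice_summable[OF _ this] show "a z summable_on UNIV \<times> UNIV" using C(1) by simp
  qed
  have bij: "bij_betw (\<lambda>(m :: int, n). (n, - m)) (UNIV \<times> UNIV) (UNIV \<times> UNIV)"
    by (rule bij_betwI[of _ _ _ "\<lambda>(m, n). (- n, m)"]) auto
  have "((\<lambda>x. z ^ (2 * e) * a z x) has_sum z ^ (2 * e) * lattice_sum e z) (UNIV \<times> UNIV)"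
    by (intro has_sum_cmult_right total z)
  then have "((\<lambda>x. z ^ (2 * e) * a z (case x of (m, n) \<Rightarrow> (n, - m))) has_sum z ^ (2 * e) * lattice_sum e z) (UNIV \<times> UNIV)"
    using has_sum_reindex_bij_betw[OF bij, of "\<lambda>x. z ^ (2 * e) * a z x"] by simp
  moreover have "(\<lambda>x. z ^ (2 * e) * a z (case x of (m, n) \<Rightarrow> (n, - m))) = a (- 1 / z)"
    using lattice_term_S[OF z, symmetric] by (auto simp: a_def fun_eq_iff)
  ultimately have "lattice_sum e (- 1 / z) = z ^ (2 * e) * lattice_sum e z"
    using total[OF S_upper_half_plane[OF z]] has_sum_unique by metis
  then show "lattice_sum e (- 1 / z) = z powi (2 * int e) * lattice_sum e z"
    by (metis of_nat_mult of_nat_numeral power_int_of_nat)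
qed

section \<open>The conditionally convergent lattice sum of weight 2\<close>

lemma has_sum_diff:
  fixes f g :: "'a \<Rightarrow> 'b :: topological_ab_group_add"
  assumes "(f has_sum S) A" "(g has_sum T) A"
  shows "((\<lambda>x. f x - g x) has_sum (S - T)) A"
  using has_sum_add[OF assms(1), of "\<lambda>x. - g x" "- T"] assms(2) by (simp add: has_sum_uminus)

lemma has_sum_sum:
  fixes f :: "'i \<Rightarrow> 'a \<Rightarrow> 'b :: topological_comm_monoid_add"
  assumes "\<And>i. i \<in> I \<Longrightarrow> (f i has_sum S i) A"
  shows "((\<lambda>x. \<Sum>i\<in>I. f i x) has_sum (\<Sum>i\<in>I. S i)) A"
  using assms by (induction I rule: infinite_finite_induct) (auto intro: has_sum_add)

text \<open>The offset distinguishes two windows: \<open>b = 0\<close> pairs \<open>k\<close> with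
  \<open>- 1 - k\<close>, while \<open>b = 1\<close> is symmetric about 0 and is the one used for
  the columns.\<close>

lemma has_sum_int_LIMSEQ:
  fixes f :: "int \<Rightarrow> 'a :: topological_comm_monoid_add"
  assumes "(f has_sum S) UNIV"
  shows "(\<lambda>N. sum f {- int N..<int N + int b}) \<longlonglongrightarrow> S"
proof (rule filterlim_compose[OF assms[unfolded has_sum_def]])
  show "filterlim (\<lambda>N. {- int N..<int N + int b}) (finite_subsets_at_top UNIV) sequentially"
    unfolding filterlim_finite_subsets_at_top
  proof safe
    fix X :: "int set" assume X: "finite X"
    have "X \<subseteq> {- int N..<int N + int b}" if "N \<ge> nat (Max (abs ` X)) + 1" for N
    proof
      fix x assume "x \<in> X"
      then have "\<bar>x\<bar> \<le> Max (abs ` X)" using X by (intro Max_ge) auto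
      then show "x \<in> {- int N..<int N + int b}" using that by auto
    qed
    then show "\<forall>\<^sub>F N in sequentially. finite {- int N..<int N + int b} \<and> X \<subseteq> {- int N..<int N + int b} \<and> {- int N..<int N + int b} \<subseteq> UNIV"
      unfolding eventually_sequentially by (metis finite_atLeastLessThan_int subset_UNIV)
  qed
qed

text \<open>Pairing \<open>m = k\<close> with \<open>m = - 1 - k\<close> turns the sum into
  differences of Digamma series at \<open>\<tau>\<close> and \<open>- \<tau>\<close>, to which the
  reflection formula applies.\<close>

lemma cot_has_sum_value:
  fixes \<tau> :: complex
  assumes \<tau>: "\<tau> \<notin> \<int>" and S: "((\<lambda>m :: int. 1 / (of_int m - \<tau>) - 1 / (of_int m + \<tau>)) has_sum S) UNIV"
  shows "S = - 2 * of_real pi * cot (of_real pi * \<tau>)"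
proof -
  define f where "f = (\<lambda>m :: int. 1 / (of_int m - \<tau>) - 1 / (of_int m + \<tau>))"
  have "sum f {- int N..<int N} = (\<Sum>k<N. f (int k) + f (- 1 - int k))" for N
  proof (induction N)
    case (Suc N)
    have "{- int (Suc N)..<int (Suc N)} = insert (- 1 - int N) (insert (int N) {- int N..<int N})" by auto
    then show ?case using Suc by (simp add: algebra_simps)
  qed simp
  then have "(\<lambda>k. f (int k) + f (- 1 - int k)) sums S"
    using has_sum_int_LIMSEQ[OF S, of 0] by (simp add: sums_def f_def)
  moreover have "(\<lambda>k. f (int k) + f (- 1 - int k)) sums (Digamma \<tau> - Digamma (1 - \<tau>) - (Digamma (- \<tau>) - Digamma (1 - (- \<tau>))))"
  proof -
    have d: "(\<lambda>k. inverse (of_nat (Suc k)) - inverse (w + of_nat k)) sums (Digamma w + euler_mascheroni)" if "w \<noteq> 0" for w :: complex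
      using summable_sums[OF summable_Digamma[OF that]] by (simp add: Digamma_def)
    have nz: "\<tau> \<noteq> 0" "1 - \<tau> \<noteq> 0" "- \<tau> \<noteq> 0" "1 - (- \<tau>) \<noteq> 0"
    proof -
      have "\<tau> \<noteq> of_int n" for n using \<tau> by auto
      from this[of 0] this[of 1] this[of "-1"] show "\<tau> \<noteq> 0" "1 - \<tau> \<noteq> 0" "- \<tau> \<noteq> 0" "1 - (- \<tau>) \<noteq> 0"
        by (auto simp: add_eq_0_iff)
    qed
    define d' where "d' = (\<lambda>w k. inverse (of_nat (Suc k)) - inverse (w + of_nat k) :: complex)"
    have "(\<lambda>k. d' \<tau> k - d' (1 - \<tau>) k - (d' (- \<tau>) k - d' (1 - (- \<tau>)) k)) sums (Digamma \<tau> - Digamma (1 - \<tau>) - (Digamma (- \<tau>) - Digamma (1 - (- \<tau>))))"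
      using sums_diff[OF sums_diff[OF d[OF nz(1)] d[OF nz(2)]] sums_diff[OF d[OF nz(3)] d[OF nz(4)]]] by (simp add: d'_def)
    moreover have "d' \<tau> k - d' (1 - \<tau>) k - (d' (- \<tau>) k - d' (1 - (- \<tau>)) k) = f (int k) + f (- 1 - int k)" for k
    proof -
      have e: "of_int (- 1 - int k) - \<tau> = - (1 - (- \<tau>) + of_nat k)" "of_int (- 1 - int k) + \<tau> = - (1 - \<tau> + of_nat k)"
        "of_int (int k) - \<tau> = - \<tau> + of_nat k" "of_int (int k) + \<tau> = \<tau> + of_nat k" by simp_all
      have "(n - B) - (n - C) - ((n - A) - (n - D)) = A - B + (- D - - C)" for A B C D n :: complex by simp
      then show ?thesis unfolding f_def d'_def e by (simp only: inverse_eq_divide divide_minus_right)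
    qed
    ultimately show ?thesis by simp
  qed
  ultimately have "S = Digamma \<tau> - Digamma (1 - \<tau>) - (Digamma (- \<tau>) - Digamma (1 - (- \<tau>)))"
    by (rule sums_unique2)
  also have "\<dots> = - (of_real pi * cot (of_real pi * \<tau>)) - (- (of_real pi * cot (of_real pi * (- \<tau>))))"
    using \<tau> by (subst (1 2) Digamma_reflection) auto
  also have "cot (of_real pi * (- \<tau>)) = - cot (of_real pi * \<tau>)"
    by (simp add: cot_def)
  finally show ?thesis by simp
qed

text \<open>The first difference is \<open>(3 n - 1) (n - 1) / 4\<close>, which is nonnegative
  because no integer lies strictly between 1/3 and 1; the second is its mirror image.\<close>

lemma half_shift_bound:
  fixes n :: int
  shows "(real_of_int n)^2 / 4 \<le> (real_of_int n - 1/2)^2" "(real_of_int n)^2 / 4 \<le> (real_of_int n + 1/2)^2"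
proof -
  have "0 \<le> (3 * n - 1) * (n - 1)" "0 \<le> (3 * n + 1) * (n + 1)"
    by (cases "n \<ge> 1"; cases "n \<le> 0"; auto simp: mult_nonneg_nonneg mult_nonpos_nonpos)
       (cases "n \<ge> 0"; cases "n \<le> -1"; auto simp: mult_nonneg_nonneg mult_nonpos_nonpos)
  then have "0 \<le> real_of_int ((3 * n - 1) * (n - 1))" "0 \<le> real_of_int ((3 * n + 1) * (n + 1))"
    by (simp_all only: of_int_0_le_iff)
  then show "(real_of_int n)^2 / 4 \<le> (real_of_int n - 1/2)^2" "(real_of_int n)^2 / 4 \<le> (real_of_int n + 1/2)^2"
    by (simp_all add: power2_eq_square algebra_simps)
qed

text \<open>
  \<open>u\<close> has the same size as \<open>1 / (m z + n)\<^sup>2\<close> up to an absolutely summable error, its sum over \<open>n\<close>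
  telescopes to 0, and its iterated sum in the other order is computed by the cotangent series.
\<close>

context
  fixes z :: complex
  assumes z: "z \<in> upper_half_plane"
begin

private definition u :: "int \<times> int \<Rightarrow> complex" where
  "u = (\<lambda>(m, n). 1 / (of_int m * z + of_int n - 1/2) - 1 / (of_int m * z + of_int n + 1/2))"

private definition a :: "int \<times> int \<Rightarrow> complex" where
  "a = (\<lambda>(m, n). 1 / (of_int m * z + of_int n) ^ 2)"

private lemma bounds:
  obtains c where "c > 0"
    "\<And>m n :: int. c * ((real_of_int m)^2 + (real_of_int n)^2) \<le> norm (of_int m * z + of_int n) ^ 2"
    "\<And>m n :: int. c * ((real_of_int m)^2 + (real_of_int n)^2) \<le> norm ((of_int m * z + of_int n - 1/2) * (of_int m * z + of_int n + 1/2))"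
proof -
  obtain c where c: "c > 0" "\<And>x y :: real. c * (x^2 + y^2) \<le> norm (of_real x * z + of_real y) ^ 2"
    using quadratic_form_lower_bound[OF z] by blast
  have "c / 4 * ((real_of_int m)^2 + (real_of_int n)^2) \<le> norm (of_int m * z + of_int n) ^ 2" for m n :: int
  proof -
    have "c / 4 * ((real_of_int m)^2 + (real_of_int n)^2) \<le> c * ((real_of_int m)^2 + (real_of_int n)^2)"
      using c(1) by (intro mult_right_mono) auto
    also have "\<dots> \<le> norm (of_int m * z + of_int n) ^ 2" using c(2)[of m n] by simp
    finally show ?thesis .
  qed
  moreover have "c / 4 * ((real_of_int m)^2 + (real_of_int n)^2) \<le> norm ((of_int m * z + of_int n - 1/2) * (of_int m * z + of_int n + 1/2))" for m n :: int
  proof -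
    define s where "s = c / 4 * ((real_of_int m)^2 + (real_of_int n)^2)"
    have s: "s \<ge> 0" using c(1) by (simp add: s_def)
    have s': "s = c * ((real_of_int m)^2 / 4 + (real_of_int n)^2 / 4)" by (simp add: s_def algebra_simps)
    have m: "(real_of_int m)^2 / 4 \<le> (real_of_int m)^2" by simp
    have "s \<le> c * ((real_of_int m)^2 + (real_of_int n - 1/2)^2)"
      unfolding s' using c(1) half_shift_bound(1)[of n] by (intro mult_left_mono add_mono m) auto
    also have "\<dots> \<le> norm (of_int m * z + of_int n - 1/2) ^ 2"
      using c(2)[of m "real_of_int n - 1/2"] by (simp add: algebra_simps)
    finally have 1: "s \<le> norm (of_int m * z + of_int n - 1/2) ^ 2" .
    have "s \<le> c * ((real_of_int m)^2 + (real_of_int n + 1/2)^2)"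
      unfolding s' using c(1) half_shift_bound(2)[of n] by (intro mult_left_mono add_mono m) auto
    also have "\<dots> \<le> norm (of_int m * z + of_int n + 1/2) ^ 2"
      using c(2)[of m "real_of_int n + 1/2"] by (simp add: algebra_simps)
    finally have 2: "s \<le> norm (of_int m * z + of_int n + 1/2) ^ 2" .
    have "s ^ 2 \<le> norm (of_int m * z + of_int n - 1/2) ^ 2 * norm (of_int m * z + of_int n + 1/2) ^ 2"
      unfolding power2_eq_square[of s] using 1 2 s by (intro mult_mono) auto
    also have "\<dots> = norm ((of_int m * z + of_int n - 1/2) * (of_int m * z + of_int n + 1/2)) ^ 2"
      by (simp add: norm_mult power_mult_distrib)
    finally show ?thesis unfolding s_def[symmetric] by (rule power2_le_imp_le) simp
  qed
  ultimately show ?thesis using c(1) by (intro that[of "c / 4"]) auto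
qed

text \<open>With \<open>X = m z + n\<close> the term of \<open>u\<close> is
  \<open>1 / (X^2 - 1/4)\<close>, so the difference has size \<open>|X|^(-4)\<close>.\<close>

private lemma summable_diff: "(\<lambda>x. a x - u x) summable_on UNIV"
proof -
  obtain c where c: "c > 0"
    "\<And>m n :: int. c * ((real_of_int m)^2 + (real_of_int n)^2) \<le> norm (of_int m * z + of_int n) ^ 2"
    "\<And>m n :: int. c * ((real_of_int m)^2 + (real_of_int n)^2) \<le> norm ((of_int m * z + of_int n - 1/2) * (of_int m * z + of_int n + 1/2))"
    using bounds by blast
  show ?thesis
  proof (rule lattice_summable[of "1 / (4 * c^2)"])
    fix m n :: int assume "(m, n) \<noteq> (0, 0)"
    define s where "s = (real_of_int m)^2 + (real_of_int n)^2"
    have s: "s > 0" using \<open>(m, n) \<noteq> (0, 0)\<close> by (auto simp: s_def sum_power2_gt_zero_iff)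
    define X where "X = of_int m * z + of_int n"
    define Y where "Y = (X - 1/2) * (X + 1/2)"
    have X: "c * s \<le> norm X ^ 2" and Y: "c * s \<le> norm Y"
      using c(2)[of m n] c(3)[of m n] by (simp_all add: X_def Y_def s_def)
    have cs: "c * s > 0" using c(1) s by simp
    then have nz: "X \<noteq> 0" "Y \<noteq> 0" using X Y by auto
    have "X - 1/2 \<noteq> 0 \<and> X + 1/2 \<noteq> 0" using nz(2) unfolding Y_def by (simp only: mult_eq_0_iff de_Morgan_disj simp_thms)
    then have nz': "X - 1/2 \<noteq> 0" "X + 1/2 \<noteq> 0" by blast+
    have "1 / (X - 1/2) - 1 / (X + 1/2) = 1 / Y"
      unfolding Y_def using diff_frac_eq[OF nz', of 1 1] by simp
    then have "a (m, n) - u (m, n) = 1 / X^2 - 1 / Y"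
      by (simp add: a_def u_def X_def)
    also have "\<dots> = (Y - X^2) / (X^2 * Y)"
      using diff_frac_eq[of "X^2" Y 1 1] nz by simp
    also have "Y - X^2 = - 1 / 4" by (simp add: Y_def power2_eq_square algebra_simps)
    finally have "norm (a (m, n) - u (m, n)) = 1 / 4 / (norm X ^ 2 * norm Y)"
      by (simp add: norm_divide norm_mult norm_power)
    also have "\<dots> \<le> 1 / 4 / ((c * s) * (c * s))"
      using X Y cs c(1) s by (intro divide_left_mono mult_mono mult_pos_pos less_le_trans[OF cs]) auto
    also have "\<dots> = 1 / (4 * c^2) / s^2" by (simp add: power2_eq_square)
    finally show "norm (a (m, n) - u (m, n)) \<le> 1 / (4 * c^2) / ((real_of_int m)^2 + (real_of_int n)^2)^2"
      by (simp add: s_def)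
  qed (use c in auto)
qed

private lemma u_bound:
  obtains C where "C > 0" "\<And>m n. (m, n) \<noteq> (0, 0) \<Longrightarrow> norm (u (m, n)) \<le> C / ((real_of_int m)^2 + (real_of_int n)^2)"
proof -
  obtain c where c: "c > 0"
    "\<And>m n :: int. c * ((real_of_int m)^2 + (real_of_int n)^2) \<le> norm ((of_int m * z + of_int n - 1/2) * (of_int m * z + of_int n + 1/2))"
    using bounds by metis
  have "norm (u (m, n)) \<le> 1 / c / ((real_of_int m)^2 + (real_of_int n)^2)" if "(m, n) \<noteq> (0, 0)" for m n
  proof -
    define s where "s = (real_of_int m)^2 + (real_of_int n)^2"
    have s: "s > 0" using that by (auto simp: s_def sum_power2_gt_zero_iff)
    define X where "X = of_int m * z + of_int n"
    have Y: "c * s \<le> norm ((X - 1/2) * (X + 1/2))" using c(2)[of m n] by (simp add: X_def s_def)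
    have cs: "c * s > 0" using c(1) s by simp
    then have "norm ((X - 1/2) * (X + 1/2)) > 0" using Y by linarith
    then have "X - 1/2 \<noteq> 0 \<and> X + 1/2 \<noteq> 0" by (simp only: zero_less_norm_iff mult_eq_0_iff de_Morgan_disj simp_thms)
    then have "X - 1/2 \<noteq> 0" "X + 1/2 \<noteq> 0" by blast+
    then have "u (m, n) = 1 / ((X - 1/2) * (X + 1/2))"
      using diff_frac_eq[of "X - 1/2" "X + 1/2" 1 1] by (simp add: u_def X_def)
    then have "norm (u (m, n)) = 1 / norm ((X - 1/2) * (X + 1/2))" by (simp only: norm_divide norm_one)
    also have "\<dots> \<le> 1 / (c * s)" using Y cs by (intro divide_left_mono mult_pos_pos less_le_trans[OF cs]) auto
    finally show ?thesis by (simp add: s_def)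
  qed
  then show ?thesis using c(1) by (intro that[of "1 / c"]) auto
qed

private lemma u_summable:
  "(\<lambda>n. u (m, n)) summable_on UNIV" "(\<lambda>m. u (m, n)) summable_on UNIV"
proof -
  obtain C where C: "C > 0" "\<And>m n. (m, n) \<noteq> (0, 0) \<Longrightarrow> norm (u (m, n)) \<le> C / ((real_of_int m)^2 + (real_of_int n)^2)"
    using u_bound by blast
  have *: "f summable_on UNIV"
    if f: "\<And>k. k \<noteq> 0 \<Longrightarrow> norm (f k) \<le> C / (real_of_int k)^2" for f :: "int \<Rightarrow> complex"
  proof -
    define C' where "C' = max (2 * C) (norm (f 0))"
    have "(\<lambda>k. norm (f k)) summable_on UNIV"
    proof (rule Infinite_Sum.abs_summable_on_comparison_test'[OF summable_on_cmult_right[OF summable_on_int_quadratic, of C']])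
      fix k :: int
      show "norm (f k) \<le> C' * (1 / (1 + (real_of_int k)^2))"
      proof (cases "k = 0")
        case False
        then have "1 \<le> k^2" by (simp add: int_one_le_iff_zero_less)
        then have k: "1 \<le> (real_of_int k)^2" by (metis of_int_1_le_iff of_int_power)
        have "C / (real_of_int k)^2 \<le> 2 * C * (1 / (1 + (real_of_int k)^2))"
          using k C(1) by (simp add: divide_simps)
        also have "\<dots> \<le> C' * (1 / (1 + (real_of_int k)^2))"
          unfolding C'_def by (intro mult_right_mono divide_nonneg_nonneg add_nonneg_nonneg) auto
        finally show ?thesis using f[OF False] by simp
      qed (simp add: C'_def)
    qed
    then show ?thesis by (rule abs_summable_summable)
  qed
  have le: "C / ((real_of_int m)^2 + (real_of_int n)^2) \<le> C / (real_of_int k)^2" if "k \<noteq> 0" "k = m \<or> k = n" for m n k :: int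
    using that C(1) by (intro divide_left_mono mult_pos_pos) (auto simp: sum_power2_gt_zero_iff)
  show "(\<lambda>n. u (m, n)) summable_on UNIV"
    by (rule *) (rule order.trans[OF C(2) le], auto)
  show "(\<lambda>m. u (m, n)) summable_on UNIV"
    by (rule *) (rule order.trans[OF C(2) le], auto)
qed

private lemma u_row: "((\<lambda>n. u (m, n)) has_sum 0) UNIV"
proof -
  define g where "g = (\<lambda>n :: int. 1 / (of_int m * z + of_int n - 1/2))"
  obtain S where S: "((\<lambda>n. u (m, n)) has_sum S) UNIV" using u_summable(1) unfolding summable_on_def by blast
  have "(\<Sum>n = - int N..<int N. u (m, n)) = g (- int N) - g (int N)" for N
  proof (induction N)
    case (Suc N)
    have "{- int (Suc N)..<int (Suc N)} = insert (- 1 - int N) (insert (int N) {- int N..<int N})" by auto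
    moreover have u: "u (m, n) = g n - g (n + 1)" for n by (simp add: u_def g_def add_diff_eq)
    have "u (m, - 1 - int N) = g (- int (Suc N)) - g (- int N)" "u (m, int N) = g (int N) - g (int (Suc N))"
      unfolding u by (simp_all add: add.commute)
    ultimately show ?case using Suc by simp
  qed simp
  moreover have "(\<lambda>N. g (- int N) - g (int N)) \<longlonglongrightarrow> 0 - 0"
  proof (intro tendsto_diff)
    have lim: "filterlim (\<lambda>N. of_nat N :: complex) at_infinity sequentially" by (rule tendsto_of_nat)
    have "(\<lambda>N. inverse ((of_int m * z - 1/2) + of_nat N)) \<longlonglongrightarrow> 0"
      by (intro filterlim_compose[OF tendsto_inverse_0] tendsto_add_filterlim_at_infinity[OF tendsto_const] lim)
    then show "(\<lambda>N. g (int N)) \<longlonglongrightarrow> 0" by (simp add: g_def inverse_eq_divide algebra_simps)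
    have "(\<lambda>N. - inverse ((1/2 - of_int m * z) + of_nat N)) \<longlonglongrightarrow> - 0"
      by (intro tendsto_minus filterlim_compose[OF tendsto_inverse_0] tendsto_add_filterlim_at_infinity[OF tendsto_const] lim)
    moreover have "- inverse ((1/2 - of_int m * z) + of_nat N) = g (- int N)" for N
    proof -
      have "of_int m * z + of_int (- int N) - 1/2 = - ((1/2 - of_int m * z) + of_nat N)" by simp
      then show ?thesis unfolding g_def by (simp only: inverse_eq_divide minus_divide_right)
    qed
    ultimately show "(\<lambda>N. g (- int N)) \<longlonglongrightarrow> 0" by simp
  qed
  ultimately have "(\<lambda>N. \<Sum>n = - int N..<int N. u (m, n)) \<longlonglongrightarrow> 0" by simp
  then have "S = 0" using has_sum_int_LIMSEQ[OF S, of 0] LIMSEQ_unique by auto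
  then show ?thesis using S by simp
qed

text \<open>Over the columns \<open>- N\<close> to \<open>N\<close> the terms telescope in
  \<open>n\<close>, leaving the cotangent series at \<open>\<tau> = (N + 1/2) / z\<close>. As
  \<open>Im \<tau>\<close> tends to minus infinity, \<open>cot (pi \<tau>)\<close> tends to
  \<open>\<i>\<close>; this nonzero limit is the anomaly of weight 2.\<close>

private lemma u_columns_limit:
  "(\<lambda>N. \<Sum>n = - int N..<int N + int 1. \<Sum>\<^sub>\<infinity>m. u (m, n)) \<longlonglongrightarrow> - 2 * of_real pi * \<i> / z"
proof -
  define w where "w = - 1 / z"
  have w: "w \<in> upper_half_plane" unfolding w_def by (rule S_upper_half_plane[OF z])
  note nz = upper_half_plane_nonzero[OF z]
  define M where "M = (\<lambda>N :: nat. real N + 1/2)"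
  define E where "E = (\<lambda>N. nome (of_real (M N) * w))"
  have Mw: "of_real (M N) * w \<in> upper_half_plane" for N
    using w by (simp add: upper_half_plane_iff M_def add_pos_pos)
  have val: "(\<Sum>n = - int N..<int N + int 1. \<Sum>\<^sub>\<infinity>m. u (m, n)) = - 2 * of_real pi / z * (\<i> * (1 + 2 * E N / (1 - E N)))" for N
  proof -
    define \<tau> where "\<tau> = - (of_real (M N) * w)"
    have \<tau>: "\<tau> \<notin> \<int>" using upper_half_plane_not_Ints(1)[OF Mw[of N]] by (simp add: \<tau>_def)
    have "((\<lambda>m. \<Sum>n = - int N..<int N + int 1. u (m, n)) has_sum (\<Sum>n = - int N..<int N + int 1. \<Sum>\<^sub>\<infinity>m. u (m, n))) UNIV"
      by (intro has_sum_sum has_sum_infsum u_summable(2)) 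
    then have "((\<lambda>m. z * (\<Sum>n = - int N..<int N + int 1. u (m, n))) has_sum z * (\<Sum>n = - int N..<int N + int 1. \<Sum>\<^sub>\<infinity>m. u (m, n))) UNIV"
      by (rule has_sum_cmult_right)
    moreover have "z * (\<Sum>n = - int N..<int N + int 1. u (m, n)) = 1 / (of_int m - \<tau>) - 1 / (of_int m + \<tau>)" for m
    proof -
      define g where "g = (\<lambda>n :: int. 1 / (of_int m * z + of_int n - 1/2))"
      have u: "u (m, n) = g n - g (n + 1)" for n by (simp add: u_def g_def add_diff_eq)
      have "(\<Sum>n = - int N..<int N + int 1. u (m, n)) = g (- int N) - g (int N + 1)"
      proof (induction N)
        case 0
        have "{- int 0..<int 0 + int 1} = {0}" by auto
        then show ?case by (simp add: u)
      next
        case (Suc N)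
        have "{- int (Suc N)..<int (Suc N) + int 1} = insert (- 1 - int N) (insert (int N + 1) {- int N..<int N + int 1})" by auto
        moreover have "u (m, - 1 - int N) = g (- int (Suc N)) - g (- int N)" "u (m, int N + 1) = g (int N + 1) - g (int (Suc N) + 1)"
          unfolding u by (simp_all add: add.commute)
        ultimately show ?case using Suc by simp
      qed
      moreover have "z * g (- int N) = 1 / (of_int m - \<tau>)" "z * g (int N + 1) = 1 / (of_int m + \<tau>)"
      proof -
        have "of_int m * z + of_int (- int N) - 1/2 = z * (of_int m - \<tau>)"
          using nz by (simp add: \<tau>_def w_def M_def algebra_simps)
        then show "z * g (- int N) = 1 / (of_int m - \<tau>)" using nz by (simp only: g_def) simp
        have "of_int m * z + of_int (int N + 1) - 1/2 = z * (of_int m + \<tau>)"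
          using nz by (simp add: \<tau>_def w_def M_def algebra_simps)
        then show "z * g (int N + 1) = 1 / (of_int m + \<tau>)" using nz by (simp only: g_def) simp
      qed
      ultimately show ?thesis by (simp add: right_diff_distrib)
    qed
    ultimately have "z * (\<Sum>n = - int N..<int N + int 1. \<Sum>\<^sub>\<infinity>m. u (m, n)) = - 2 * of_real pi * cot (of_real pi * \<tau>)"
      using cot_has_sum_value[OF \<tau>] by simp
    also have "cot (of_real pi * \<tau>) = - cot (of_real pi * (of_real (M N) * w))"
      by (simp add: \<tau>_def cot_def)
    also have "cot (of_real pi * (of_real (M N) * w)) = - \<i> * (1 + 2 * E N / (1 - E N))"
    proof -
      have e: "exp (2 * \<i> * (of_real pi * (of_real (M N) * w))) = E N" by (simp add: E_def nome_def mult_ac)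
      have "E N \<noteq> 1" using norm_nome_less_1[OF Mw[of N]] by (auto simp: E_def)
      then show ?thesis using cot_exp[of "of_real pi * (of_real (M N) * w)"] unfolding e by blast
    qed
    finally show ?thesis using nz by (simp add: field_simps)
  qed
  have "E \<longlonglongrightarrow> 0"
  proof (rule tendsto_norm_zero_cancel)
    define r where "r = exp (- 2 * pi * Im w)"
    have r: "0 < r" "r < 1" using w by (simp_all add: r_def upper_half_plane_iff)
    have "norm (E N) = r powr (1/2) * r ^ N" for N
      using r(1) by (simp add: E_def norm_nome M_def r_def powr_def exp_add[symmetric] exp_of_nat_mult[symmetric] algebra_simps)
    moreover have "(\<lambda>N. r powr (1/2) * r ^ N) \<longlonglongrightarrow> r powr (1/2) * 0"
      using r by (intro tendsto_intros LIMSEQ_power_zero) auto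
    ultimately show "(\<lambda>N. norm (E N)) \<longlonglongrightarrow> 0" by simp
  qed
  then have "(\<lambda>N. - 2 * of_real pi / z * (\<i> * (1 + 2 * E N / (1 - E N)))) \<longlonglongrightarrow> - 2 * of_real pi / z * (\<i> * (1 + 2 * 0 / (1 - 0)))"
    by (intro tendsto_intros) auto
  then show ?thesis unfolding val by simp
qed

text \<open>The absolutely convergent sum of \<open>a - u\<close> is evaluated in both orders. Rows
  give the lattice sum at \<open>z\<close>, since \<open>u\<close> contributes 0; columns give
  \<open>1 / z^2\<close> times the lattice sum at \<open>- 1 / z\<close>, plus
  \<open>2 pi \<i> / z\<close>.\<close>

lemma lattice_sum_1_S: "lattice_sum 1 (- 1 / z) = z^2 * lattice_sum 1 z - 2 * of_real pi * \<i> * z"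
proof -
  define w where "w = - 1 / z"
  have w: "w \<in> upper_half_plane" unfolding w_def by (rule S_upper_half_plane[OF z])
  note nz = upper_half_plane_nonzero[OF z]
  obtain T where T: "((\<lambda>x. a x - u x) has_sum T) (UNIV \<times> UNIV)"
    using summable_diff unfolding summable_on_def by auto
  have "((\<lambda>n. a (m, n) - u (m, n)) has_sum (lattice_row 1 z m - 0)) UNIV" for m
    using row_has_sum[OF z, of 1 m] by (intro has_sum_diff u_row) (simp add: a_def)
  then have "(lattice_row 1 z has_sum T) UNIV"
    using has_sum_SigmaD[OF T, of "lattice_row 1 z"] by simp
  then have T1: "T = lattice_sum 1 z" using lattice_row_has_sum[OF z, of 1] has_sum_unique by auto
  define b where "b = (\<lambda>n. 1 / z^2 * lattice_row 1 w (- n))"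
  have "((\<lambda>m. a (m, n)) has_sum b n) UNIV" for n
  proof -
    have "((\<lambda>k. 1 / z^2 * (1 / (of_int (- n) * w + of_int k) ^ (2 * 1))) has_sum b n) UNIV"
      unfolding b_def using row_has_sum[OF w, of 1 "- n"] by (intro has_sum_cmult_right) simp
    moreover have "1 / z^2 * (1 / (of_int (- n) * w + of_int k) ^ (2 * 1)) = a (k, n)" for k
      unfolding w_def lattice_term_S[OF z] using nz by (simp add: a_def)
    ultimately show ?thesis by simp
  qed
  then have col: "((\<lambda>m. a (m, n) - u (m, n)) has_sum (b n - (\<Sum>\<^sub>\<infinity>m. u (m, n)))) UNIV" for n
    by (intro has_sum_diff has_sum_infsum u_summable(2))
  have "((\<lambda>(n, m). a (m, n) - u (m, n)) has_sum T) (UNIV \<times> UNIV)"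
    using T by (subst (asm) has_sum_swap) simp
  then have "((\<lambda>n. b n - (\<Sum>\<^sub>\<infinity>m. u (m, n))) has_sum T) UNIV"
    by (rule has_sum_SigmaD) (use col in simp)
  from has_sum_int_LIMSEQ[OF this, of 1]
  have "(\<lambda>N. (\<Sum>n = - int N..<int N + int 1. b n) - (\<Sum>n = - int N..<int N + int 1. \<Sum>\<^sub>\<infinity>m. u (m, n))) \<longlonglongrightarrow> T"
    by (simp only: sum_subtractf)
  moreover have "(b has_sum 1 / z^2 * lattice_sum 1 w) UNIV"
  proof -
    have "bij_betw uminus (UNIV :: int set) UNIV" by (rule bij_betwI[of _ _ _ uminus]) auto
    from has_sum_reindex_bij_betw[OF this, of "lattice_row 1 w"]
    have "((\<lambda>n. lattice_row 1 w (- n)) has_sum lattice_sum 1 w) UNIV"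
      using lattice_row_has_sum[OF w, of 1] by simp
    then show ?thesis unfolding b_def by (rule has_sum_cmult_right)
  qed
  from has_sum_int_LIMSEQ[OF this, of 1]
  have "(\<lambda>N. (\<Sum>n = - int N..<int N + int 1. b n) - (\<Sum>n = - int N..<int N + int 1. \<Sum>\<^sub>\<infinity>m. u (m, n))) \<longlonglongrightarrow> 1 / z^2 * lattice_sum 1 w - (- 2 * of_real pi * \<i> / z)"
    by (intro tendsto_diff u_columns_limit)
  ultimately have "T = 1 / z^2 * lattice_sum 1 w - (- 2 * of_real pi * \<i> / z)"
    by (rule LIMSEQ_unique)
  then show ?thesis unfolding T1 w_def[symmetric] using nz by (simp add: field_simps power2_eq_square)
qed

end

section \<open>Modularity of the Eisenstein series and Ramanujan's equations\<close>

lemma lattice_const_1: "lattice_const 1 = of_real (pi^2) / 3"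
proof -
  define f where "f = (\<lambda>n :: int. 1 / (of_int n :: complex) ^ (2 * 1))"
  have s: "(\<lambda>n. norm (f n)) summable_on UNIV"
    using inverse_even_powers_summable[of 1] by (simp add: f_def)
  have "(f has_sum ((\<Sum>k. f (int k)) + (\<Sum>k. f (- 1 - int k)))) UNIV"
    by (rule has_sum_int[OF summable_on_int_imp_summable[OF s]])
  moreover have basel: "(\<lambda>k. f (int (Suc k))) sums of_real (pi^2 / 6)"
  proof -
    have "(\<lambda>k. of_real (1 / (real k + 1)^2) :: complex) sums of_real (pi^2 / 6)"
      using inverse_squares_sums by (subst sums_of_real_iff) (simp add: add.commute)
    then show ?thesis by (simp add: f_def add.commute power2_eq_square)
  qed
  have "(\<lambda>k. f (int k)) sums of_real (pi^2 / 6)"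
    using basel by (subst (asm) sums_Suc_iff) (simp add: f_def)
  moreover have "f (- 1 - int k) = f (int (Suc k))" for k
  proof -
    have "(of_int (- 1 - int k) :: complex) = - of_int (int (Suc k))" by simp
    then show ?thesis unfolding f_def by (simp only: power_minus_even even_mult_iff even_numeral simp_thms)
  qed
  ultimately have "(f has_sum (of_real (pi^2 / 6) + of_real (pi^2 / 6))) UNIV"
    using sums_unique[OF basel] by (simp only: sums_unique[symmetric])
  then have "(\<Sum>\<^sub>\<infinity>n. f n) = of_real (pi^2 / 6) + of_real (pi^2 / 6)" by (rule infsumI)
  then show ?thesis by (simp add: lattice_const_def f_def)
qed

lemma lattice_fps_1: "lattice_fps 1 = fps_const (of_real (pi^2) / 3) * E2_fps"
proof -
  have "2 * lipschitz_const 1 = of_real (pi^2) / 3 * of_int (- 24)"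
    by (simp add: lipschitz_const_def power2_eq_square)
  then show ?thesis
    unfolding lattice_fps_def lattice_const_1 eis_fps_conv_sigma by (simp add: algebra_simps del: of_int_minus of_int_numeral)
qed

lemma eisenstein_2_S:
  assumes z: "z \<in> upper_half_plane"
  shows "eisenstein 2 (- 1 / z) = z^2 * eisenstein 2 z + 6 * z / (of_real pi * \<i>)"
proof -
  have L: "lattice_sum 1 w = of_real (pi^2) / 3 * eisenstein 2 w" if "w \<in> upper_half_plane" for w
    using has_q_expansion_eval[OF lattice_sum_q_expansion[of 1] that] 
      has_q_expansion_eval[OF has_q_expansion_cmult[OF eisenstein_2_4_6_q_expansion(1)] that, of "of_real (pi^2) / 3"]
    unfolding lattice_fps_1 by simp
  have "of_real (pi^2) / 3 * eisenstein 2 (- 1 / z) = z^2 * (of_real (pi^2) / 3 * eisenstein 2 z) - 2 * of_real pi * \<i> * z"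
    using lattice_sum_1_S[OF z] unfolding L[OF z] L[OF S_upper_half_plane[OF z]] .
  then have "eisenstein 2 (- 1 / z) = (z^2 * (of_real (pi^2) / 3 * eisenstein 2 z) - 2 * of_real pi * \<i> * z) / (of_real (pi^2) / 3)"
  proof -
    have "X = Y / P" if "P * X = Y" "P \<noteq> 0" for P X Y :: complex using that by auto
    from this[OF \<open>of_real (pi^2) / 3 * eisenstein 2 (- 1 / z) = _\<close>] show ?thesis by simp
  qed
  also have "\<dots> = z^2 * eisenstein 2 z + 6 * z / (of_real pi * \<i>)"
    by (simp add: field_simps power2_eq_square)
  finally show ?thesis .
qed

text \<open>Differentiating the transformation law of \<open>E2\<close> shows that the extra terms
  of \<open>E2^2\<close> and of \<open>12 E2'\<close> are the same.\<close>

lemma modform_E2_riccati: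
  "modform 4 (\<lambda>z. eisenstein 2 z ^ 2 - 12 * q_deriv (eisenstein 2) z) (E2_fps ^ 2 - fps_const 12 * D_fps E2_fps)"
  unfolding modform_def
proof (intro conjI ballI)
  show "has_q_expansion (\<lambda>z. eisenstein 2 z ^ 2 - 12 * q_deriv (eisenstein 2) z) (E2_fps ^ 2 - fps_const 12 * D_fps E2_fps)"
    by (intro has_q_expansion_diff has_q_expansion_power has_q_expansion_cmult has_q_expansion_q_deriv eisenstein_2_4_6_q_expansion)
next
  fix z assume z: "z \<in> upper_half_plane"
  note nz = upper_half_plane_nonzero[OF z]
  let ?f = "eisenstein 2"
  have der: "(?f has_field_derivative deriv ?f z) (at z)" if "z \<in> upper_half_plane" for z
    using has_q_expansion_deriv[OF eisenstein_2_4_6_q_expansion(1) that] DERIV_imp_deriv by metis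
  have "((\<lambda>z. ?f (- 1 / z)) has_field_derivative deriv ?f (- 1 / z) * (1 / z^2)) (at z)"
    by (rule DERIV_chain2[where f = ?f and g = "\<lambda>z. - 1 / z", OF der[OF S_upper_half_plane[OF z]]])
       (use nz in \<open>auto intro!: derivative_eq_intros simp: power2_eq_square\<close>)
  moreover have "((\<lambda>z. z^2 * ?f z + 6 * z / (of_real pi * \<i>)) has_field_derivative (2 * z * ?f z + z^2 * deriv ?f z + 6 / (of_real pi * \<i>))) (at z)"
    using der[OF z] by (auto intro!: derivative_eq_intros)
  then have "((\<lambda>z. ?f (- 1 / z)) has_field_derivative (2 * z * ?f z + z^2 * deriv ?f z + 6 / (of_real pi * \<i>))) (at z)"
    by (rule has_field_derivative_transform_within_open[OF _ open_upper_half_plane z]) (rule eisenstein_2_S[symmetric])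
  ultimately have "deriv ?f (- 1 / z) * (1 / z^2) = 2 * z * ?f z + z^2 * deriv ?f z + 6 / (of_real pi * \<i>)"
    by (rule DERIV_unique)
  then have D: "deriv ?f (- 1 / z) = (2 * z * ?f z + z^2 * deriv ?f z + 6 / (of_real pi * \<i>)) * z^2"
    using nz by (simp add: field_simps)
  have p: "z powi 4 = z^4" by (metis of_nat_numeral power_int_of_nat)
  show "?f (- 1 / z) ^ 2 - 12 * q_deriv ?f (- 1 / z) = z powi 4 * (?f z ^ 2 - 12 * q_deriv ?f z)"
    unfolding q_deriv_def D eisenstein_2_S[OF z] p by (simp add: field_simps power2_eq_square power4_eq_xxxx)
qed

lemma modform_small_weight_eq:
  assumes "modform (int k) f F" "modform (int k) g G" "fps_nth F 0 = fps_nth G 0" "k \<le> 10"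
  shows "F = G"
proof -
  have d: "modform (int k) (\<lambda>z. f z - g z) (F - G)" using assms by (intro modform_diff)
  have "(\<lambda>z. f z - g z) z = 0" if "z \<in> upper_half_plane" for z
    using cusp_form_small_weight[OF d _ assms(4) that] assms(3) by simp
  then show ?thesis
    using has_q_expansion_unique[OF modform_q_expansion[OF assms(1)] modform_q_expansion[OF assms(2)]] by simp
qed

text \<open>
  Comparison with the lattice sum determines the \<open>q\<close>-expansion from the coefficient of \<open>q\<close> alone,
  so the values of zeta at 4 and 6 are not needed.
\<close>

lemma modform_eisenstein_fps:
  assumes f: "modform (2 * int e) f F" and e: "2 \<le> e" "e \<le> 5" and F0: "fps_nth F 0 = 1"
  shows "F = 1 + fps_const (fps_nth F 1) * sigma_fps (2 * e - 1)"
proof -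
  define c where "c = lattice_const e"
  define l where "l = 2 * lipschitz_const e"
  have l: "l \<noteq> 0" by (simp add: l_def lipschitz_const_def)
  have "fps_const c * F = lattice_fps e"
    by (rule modform_small_weight_eq[of "2 * e" "\<lambda>z. c * f z" _ "lattice_sum e"])
       (use modform_cmult[OF f, of c] lattice_sum_modform[OF e(1)] e F0 in
         \<open>simp_all add: lattice_fps_def sigma_fps_def divisor_sum_0 c_def\<close>)
  then have eq: "fps_const c * F = fps_const c + fps_const l * sigma_fps (2 * e - 1)"
    by (simp add: lattice_fps_def c_def l_def)
  have "c * fps_nth F 1 = l" using arg_cong[OF eq, of "\<lambda>F. fps_nth F 1"]
    by (simp add: sigma_fps_def divisor_sum_def)
  then have "fps_const c * F = fps_const c * (1 + fps_const (fps_nth F 1) * sigma_fps (2 * e - 1))" "c \<noteq> 0"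
    using eq l by (auto simp: algebra_simps fps_const_mult[symmetric] simp del: fps_const_mult)
  moreover from this(2) have "fps_const c \<noteq> 0" by simp
  ultimately show ?thesis using mult_left_cancel by blast
qed

text \<open>The coefficient of \<open>q\<close> is \<open>2 (-24) + 12 * 24 = 240\<close>, which
  identifies the form. This gives Ramanujan's equation for \<open>E2\<close> and the modularity of
  \<open>E4\<close> in one stroke.\<close>

lemma riccati_E2_fps: "E2_fps ^ 2 - fps_const 12 * D_fps E2_fps = E4_fps"
proof -
  let ?F = "E2_fps ^ 2 - fps_const 12 * D_fps E2_fps"
  have "fps_nth ?F 0 = 1" "fps_nth ?F 1 = 240"
    by (simp_all add: power2_eq_square D_fps_nth fps_mult_nth eis_fps_def divisor_sum_def)
  then show ?thesis
    using modform_eisenstein_fps[of 2 _ ?F] modform_E2_riccati by (simp add: eis_fps_conv_sigma)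
qed

lemma modform_E4: "modform 4 (eisenstein 4) E4_fps"
proof -
  have "eisenstein 2 z ^ 2 - 12 * q_deriv (eisenstein 2) z = eisenstein 4 z" if "z \<in> upper_half_plane" for z
    using has_q_expansion_eval[OF modform_q_expansion[OF modform_E2_riccati] that]
      has_q_expansion_eval[OF eisenstein_2_4_6_q_expansion(2) that] unfolding riccati_E2_fps by simp
  then show ?thesis using modform_E2_riccati unfolding riccati_E2_fps by (subst (asm) modform_cong) auto
qed

lemma modform_serre_deriv:
  assumes f: "modform k f F"
  shows "modform (k + 2) (serre_deriv k f) (fps_const (1/12) * serre_fps k F)"
  unfolding modform_def
proof (intro conjI ballI)
  show "has_q_expansion (serre_deriv k f) (fps_const (1/12) * serre_fps k F)"
    by (rule has_q_expansion_serre_deriv[OF modform_q_expansion[OF f] eisenstein_2_4_6_q_expansion(1)])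
next
  fix z assume z: "z \<in> upper_half_plane"
  note nz = upper_half_plane_nonzero[OF z]
  have der: "(f has_field_derivative deriv f z) (at z)" if "z \<in> upper_half_plane" for z
    using has_q_expansion_deriv[OF modform_q_expansion[OF f] that] DERIV_imp_deriv by metis
  have "((\<lambda>z. f (- 1 / z)) has_field_derivative deriv f (- 1 / z) * (1 / z^2)) (at z)"
    by (rule DERIV_chain2[where f = f and g = "\<lambda>z. - 1 / z", OF der[OF S_upper_half_plane[OF z]]])
       (use nz in \<open>auto intro!: derivative_eq_intros simp: power2_eq_square\<close>)
  moreover have "((\<lambda>z. z powi k * f z) has_field_derivative (of_int k * z powi (k - 1) * f z + z powi k * deriv f z)) (at z)"
    using nz der[OF z] by (auto intro!: derivative_eq_intros)
  then have "((\<lambda>z. f (- 1 / z)) has_field_derivative (of_int k * z powi (k - 1) * f z + z powi k * deriv f z)) (at z)"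
    by (rule has_field_derivative_transform_within_open[OF _ open_upper_half_plane z]) (rule modform_S[OF f, symmetric])
  ultimately have "deriv f (- 1 / z) * (1 / z^2) = of_int k * z powi (k - 1) * f z + z powi k * deriv f z"
    by (rule DERIV_unique)
  then have "deriv f (- 1 / z) = (of_int k * z powi (k - 1) * f z + z powi k * deriv f z) * z^2"
    using nz by (simp add: field_simps)
  also have "\<dots> = of_int k * (z powi k * z) * f z + z powi k * z^2 * deriv f z"
    using nz by (simp add: power_int_diff power2_eq_square field_simps)
  finally have D: "deriv f (- 1 / z) = of_int k * (z powi k * z) * f z + z powi k * z^2 * deriv f z" .
  have p: "z powi (k + 2) = z powi k * z^2"
    using nz by (simp add: power_int_add)
  show "serre_deriv k f (- 1 / z) = z powi (k + 2) * serre_deriv k f z"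
    unfolding serre_deriv_def q_deriv_def D eisenstein_2_S[OF z] modform_S[OF f z] p
    by (simp add: field_simps)
qed

text \<open>The same device in weight 6: the coefficient of \<open>q\<close> is
  \<open>- (12 * 240 - 4 * (240 - 24)) / 4 = - 504\<close>.\<close>

lemma serre_E4_fps: "fps_const (-1/4) * serre_fps 4 E4_fps = E6_fps"
proof -
  let ?F = "fps_const (-3) * (fps_const (1/12) * serre_fps 4 E4_fps)"
  have m: "modform 6 (\<lambda>z. -3 * serre_deriv 4 (eisenstein 4) z) ?F"
    using modform_cmult[OF modform_serre_deriv[OF modform_E4], of "-3"] by simp
  have "fps_nth ?F 0 = 1" "fps_nth ?F 1 = -504"
    by (simp_all add: serre_fps_def D_fps_nth fps_mult_nth eis_fps_def divisor_sum_def fps_numeral_nth)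
  then have "?F = E6_fps"
    using modform_eisenstein_fps[of 3 _ ?F] m by (simp add: eis_fps_conv_sigma)
  moreover have "?F = fps_const (-1/4) * serre_fps 4 E4_fps"
    by (simp add: mult.assoc[symmetric] del: mult_minus_left)
  ultimately show ?thesis by simp
qed

lemma modform_E6: "modform 6 (eisenstein 6) E6_fps"
proof -
  have m: "modform 6 (\<lambda>z. -3 * serre_deriv 4 (eisenstein 4) z) (fps_const (-3) * (fps_const (1/12) * serre_fps 4 E4_fps))"
    using modform_cmult[OF modform_serre_deriv[OF modform_E4], of "-3"] by simp
  have eq: "fps_const (-3) * (fps_const (1/12) * serre_fps 4 E4_fps) = E6_fps"
    unfolding serre_E4_fps[symmetric] by (simp add: mult.assoc[symmetric] del: mult_minus_left)
  have "-3 * serre_deriv 4 (eisenstein 4) z = eisenstein 6 z" if "z \<in> upper_half_plane" for z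
    using has_q_expansion_eval[OF modform_q_expansion[OF m] that]
      has_q_expansion_eval[OF eisenstein_2_4_6_q_expansion(3) that] unfolding eq by simp
  then show ?thesis using m unfolding eq by (subst (asm) modform_cong) auto
qed

text \<open>Both sides are forms of weight 8 with constant term \<open>- 1/2\<close>, so their
  difference is a cusp form of small weight.\<close>

lemma serre_E6_fps: "fps_const (1/12) * serre_fps 6 E6_fps = fps_const (-1/2) * E4_fps ^ 2"
proof (rule modform_small_weight_eq)
  show "modform (int 8) (serre_deriv 6 (eisenstein 6)) (fps_const (1/12) * serre_fps 6 E6_fps)"
    using modform_serre_deriv[OF modform_E6] by simp
  show "modform (int 8) (\<lambda>z. (-1/2) * eisenstein 4 z ^ 2) (fps_const (-1/2) * E4_fps ^ 2)"
    using modform_cmult[OF modform_power[OF modform_E4, of 2], of "-1/2"] by simp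
qed (simp_all add: serre_fps_def D_fps_nth fps_mult_nth eis_fps_def power2_eq_square)

lemma ramanujan_E2_fps: "12 * D_fps E2_fps = E2_fps ^ 2 - E4_fps"
  using riccati_E2_fps by (simp add: numeral_fps_const algebra_simps)

lemma ramanujan_E4_fps: "3 * D_fps E4_fps = E2_fps * E4_fps - E6_fps"
proof (rule fps_ext)
  fix n
  have "fps_nth E6_fps n = (-1/4) * fps_nth (serre_fps 4 E4_fps) n"
    using arg_cong[OF serre_E4_fps, of "\<lambda>F. fps_nth F n"] by simp
  then show "fps_nth (3 * D_fps E4_fps) n = fps_nth (E2_fps * E4_fps - E6_fps) n"
    by (simp add: serre_fps_def diff_divide_distrib)
qed

lemma ramanujan_E6_fps: "2 * D_fps E6_fps = E2_fps * E6_fps - E4_fps ^ 2"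
proof (rule fps_ext)
  fix n
  have "(1/12) * fps_nth (serre_fps 6 E6_fps) n = (-1/2) * fps_nth (E4_fps ^ 2) n"
    using arg_cong[OF serre_E6_fps, of "\<lambda>F. fps_nth F n"] by simp
  then show "fps_nth (2 * D_fps E6_fps) n = fps_nth (E2_fps * E6_fps - E4_fps ^ 2) n"
    by (simp add: serre_fps_def field_simps) algebra
qed

section \<open>The discriminant and the dimension of spaces of modular forms\<close>

definition discriminant :: "complex \<Rightarrow> complex" where
  "discriminant z = 1/1728 * (eisenstein 4 z ^ 3 - eisenstein 6 z ^ 2)"

definition discriminant_fps :: "complex fps" where
  "discriminant_fps = fps_const (1/1728) * (E4_fps ^ 3 - E6_fps ^ 2)"

lemma modform_discriminant: "modform 12 discriminant discriminant_fps"
  using modform_cmult[OF modform_diff[OF modform_power[OF modform_E4, of 3, simplified] modform_power[OF modform_E6, of 2, simplified]], of "1/1728"]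
  by (simp add: discriminant_def[abs_def] discriminant_fps_def)

lemma eis_fps_nth_0 [simp]: "fps_nth (eis_fps j c) 0 = 1"
  by (simp add: eis_fps_def)

lemma discriminant_fps_nth: "fps_nth discriminant_fps 0 = 0" "fps_nth discriminant_fps 1 = 1"
  by (simp_all add: discriminant_fps_def power3_eq_cube power2_eq_square fps_mult_nth) (simp add: eis_fps_def divisor_sum_def)

lemma D_discriminant_fps: "D_fps discriminant_fps = E2_fps * discriminant_fps"
proof -
  have "D_fps (E4_fps ^ 3 - E6_fps ^ 2) = E4_fps ^ 2 * (3 * D_fps E4_fps) - E6_fps * (2 * D_fps E6_fps)"
    by (simp add: D_fps_def power2_eq_square power3_eq_cube algebra_simps)
  also have "\<dots> = E2_fps * (E4_fps ^ 3 - E6_fps ^ 2)"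
    unfolding ramanujan_E4_fps ramanujan_E6_fps by (simp add: power2_eq_square power3_eq_cube algebra_simps)
  finally show ?thesis
    by (simp add: discriminant_fps_def D_fps_mult) (simp add: D_fps_def)
qed

text \<open>The logarithmic derivative of the discriminant is \<open>E\<^sub>2\<close>, so it is the exponential of a primitive.\<close>

lemma discriminant_nonzero:
  assumes z: "z \<in> upper_half_plane"
  shows "discriminant z \<noteq> 0"
proof
  assume zero: "discriminant z = 0"
  note qD = modform_q_expansion[OF modform_discriminant]
  note q2 = eisenstein_2_4_6_q_expansion(1)
  obtain P where P: "\<And>w. w \<in> upper_half_plane \<Longrightarrow> (P has_field_derivative 2 * of_real pi * \<i> * eisenstein 2 w) (at w)"
  proof -
    have "(\<lambda>w. 2 * of_real pi * \<i> * eisenstein 2 w) holomorphic_on upper_half_plane"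
      by (intro holomorphic_intros has_q_expansion_holomorphic[OF q2])
    from holomorphic_convex_primitive'[OF convex_upper_half_plane open_upper_half_plane this]
    show ?thesis using that open_upper_half_plane by (metis at_within_open)
  qed
  have der: "(discriminant has_field_derivative 2 * of_real pi * \<i> * (eisenstein 2 w * discriminant w)) (at w)"
    if w: "w \<in> upper_half_plane" for w
    using has_q_expansion_deriv[OF qD w] has_q_expansion_eval[OF has_q_expansion_mult[OF q2 qD] w]
    unfolding D_discriminant_fps by simp
  have "((\<lambda>w. discriminant w * exp (- P w)) has_field_derivative 0) (at w)" if w: "w \<in> upper_half_plane" for w
    using der[OF w] P[OF w] by (auto intro!: derivative_eq_intros simp: algebra_simps)
  then have "(\<lambda>w. discriminant w * exp (- P w)) constant_on upper_half_plane"
    using convex_connected[OF convex_upper_half_plane] open_upper_half_plane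
    by (intro has_field_derivative_0_imp_constant_on) auto
  then have "discriminant w = 0" if "w \<in> upper_half_plane" for w
    using that z zero unfolding constant_on_def by (metis exp_not_eq_zero mult_eq_0_iff)
  then have "discriminant_fps = 0"
    using has_q_expansion_unique[OF qD has_q_expansion_const[of 0]] by simp
  then show False using discriminant_fps_nth(2) by simp
qed

text \<open>Both series are divided by \<open>q\<close> first. The shifted discriminant then has no
  zero in the disc: off the centre by \<open>discriminant_nonzero\<close>, at the centre because its
  value is 1. Hence the quotient is a power series in \<open>q\<close>.\<close>

lemma modform_divide_discriminant:
  assumes f: "modform k f F" and F0: "fps_nth F 0 = 0"
  obtains G where "modform (k - 12) (\<lambda>z. f z / discriminant z) G"
proof -
  note qD = modform_q_expansion[OF modform_discriminant]
  note qf = modform_q_expansion[OF f]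
  define h where "h = (\<lambda>q. eval_fps (fps_shift 1 F) q / eval_fps (fps_shift 1 discriminant_fps) q)"
  have shift: "eval_fps F q = q * eval_fps (fps_shift 1 F) q"
    if "has_q_expansion f F" "fps_nth F 0 = 0" "norm q < 1" for f F q
  proof (cases "F = 0")
    case False
    then have "1 \<le> subdegree F" using that by (intro subdegree_geI) auto
    then show ?thesis
      using eval_fps_shift[of 1 F q] has_q_expansion_radius[OF that(1,3)] that(2) by (auto simp: eval_fps_at_0)
  qed simp
  have "eval_fps (fps_shift 1 discriminant_fps) q \<noteq> 0" if q: "norm q < 1" for q
  proof (cases "q = 0")
    case True
    then show ?thesis using discriminant_fps_nth(2) by (simp add: eval_fps_at_0)
  next
    case False
    obtain z where z: "z \<in> upper_half_plane" "nome z = q" using nome_surj[OF False q] by blast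
    then show ?thesis
      using discriminant_nonzero[OF z(1)] has_q_expansion_eval[OF qD z(1)] shift[OF qD discriminant_fps_nth(1) q] by auto
  qed
  then have "h holomorphic_on ball 0 1"
    unfolding h_def using has_q_expansion_radius[OF qf] has_q_expansion_radius[OF qD]
    by (intro holomorphic_intros) auto
  then have hs: "(\<lambda>n. (deriv ^^ n) h 0 / fact n * (q - 0) ^ n) sums h q" if "norm q < 1" for q
    using that by (intro holomorphic_power_series[of h 0 1]) auto
  define G where "G = Abs_fps (\<lambda>n. (deriv ^^ n) h 0 / fact n)"
  have fh: "f z / discriminant z = h (nome z)" if z: "z \<in> upper_half_plane" for z
    using has_q_expansion_eval[OF qf z] has_q_expansion_eval[OF qD z] shift[OF qf F0 norm_nome_less_1[OF z]]
      shift[OF qD discriminant_fps_nth(1) norm_nome_less_1[OF z]] nome_nonzero[of z]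
    by (simp add: h_def)
  have "has_q_expansion (\<lambda>z. f z / discriminant z) G"
    unfolding has_q_expansion_def using hs[OF norm_nome_less_1] by (simp add: fh G_def)
  moreover have "f (- 1 / z) / discriminant (- 1 / z) = z powi (k - 12) * (f z / discriminant z)" if z: "z \<in> upper_half_plane" for z
    unfolding modform_S[OF f z] modform_S[OF modform_discriminant z]
    using upper_half_plane_nonzero[OF z] by (simp add: power_int_diff)
  ultimately have "modform (k - 12) (\<lambda>z. f z / discriminant z) G" by (simp add: modform_def)
  then show ?thesis by (rule that)
qed

text \<open>The product of \<open>f ^ 12\<close> with the discriminant to the power
  \<open>- k\<close> has weight 0 and vanishes at the cusp.\<close>

lemma modform_negative_weight:
  assumes f: "modform k f F" and k: "k < 0" and z: "z \<in> upper_half_plane"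
  shows "f z = 0"
proof -
  define n where "n = nat (- k)"
  have n: "n > 0" "int n = - k" using k by (simp_all add: n_def)
  have "modform (int 0) (\<lambda>z. f z ^ 12 * discriminant z ^ n) (F ^ 12 * discriminant_fps ^ n)"
    using modform_mult[OF modform_power[OF f, of 12] modform_power[OF modform_discriminant, of n]] n by simp
  moreover have "fps_nth (F ^ 12 * discriminant_fps ^ n) 0 = 0"
    using n(1) by (simp add: fps_mult_nth_0 fps_power_zeroth discriminant_fps_nth power_0_left)
  ultimately have "f z ^ 12 * discriminant z ^ n = 0"
    using cusp_form_small_weight[of 0] z by blast
  then show ?thesis using discriminant_nonzero[OF z] by simp
qed

text \<open>If \<open>c\<close> is the constant term, then \<open>F^2 = c^2 E4\<close> and
  \<open>F^3 = c^3 E6\<close>, whence \<open>c^6 (E4^3 - E6^2) = 0\<close> by comparing sixth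
  powers. So \<open>c = 0\<close> and \<open>f\<close> is a cusp form.\<close>

lemma modform_weight_2:
  assumes f: "modform 2 f F" and z: "z \<in> upper_half_plane"
  shows "f z = 0"
proof -
  define c where "c = fps_nth F 0"
  have "F ^ 2 = fps_const (c^2) * E4_fps"
    using modform_power[OF f, of 2] modform_cmult[OF modform_E4, of "c^2"]
    by (intro modform_small_weight_eq[of 4]) (auto simp: c_def fps_power_zeroth)
  moreover have "F ^ 3 = fps_const (c^3) * E6_fps"
    using modform_power[OF f, of 3] modform_cmult[OF modform_E6, of "c^3"]
    by (intro modform_small_weight_eq[of 6]) (auto simp: c_def fps_power_zeroth)
  moreover have "(F ^ 2) ^ 3 = (F ^ 3) ^ 2" by (simp flip: power_mult)
  ultimately have "(fps_const (c^2) * E4_fps) ^ 3 = (fps_const (c^3) * E6_fps) ^ 2" by metis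
  then have "fps_const (c ^ 6) * (E4_fps ^ 3 - E6_fps ^ 2) = 0"
    by (simp add: power_mult_distrib fps_const_power algebra_simps flip: power_mult)
  moreover have "E4_fps ^ 3 - E6_fps ^ 2 \<noteq> 0"
    using discriminant_fps_nth(2) by (auto simp: discriminant_fps_def)
  ultimately have "c = 0" by simp
  then show ?thesis using cusp_form_small_weight[of 2 f F z] f z by (simp add: c_def)
qed

section \<open>Upper bound for the dimension of spaces of modular forms\<close>

text \<open>The classical formula for even \<open>k\<close>. The residue 2 is exceptional because
  its chain of weights, descending in steps of 12, ends in the trivial weight 2.\<close>

definition modular_dim :: "int \<Rightarrow> nat" where
  "modular_dim k = (if k < 0 then 0 else if k mod 12 = 2 then nat (k div 12) else nat (k div 12) + 1)"

lemma exists_eisenstein_monomial: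
  assumes "even k" "k \<ge> 0" "k \<noteq> 2"
  shows "\<exists>a b. int (4 * a + 6 * b) = k"
proof -
  obtain j where j: "k = 2 * j" using assms(1) by blast
  show ?thesis
  proof (cases "even j")
    case True
    then obtain i where "j = 2 * i" by blast
    then show ?thesis using j assms by (intro exI[of _ "nat i"] exI[of _ 0]) simp
  next
    case False
    then obtain i where "j = 2 * i + 1" by (elim oddE)
    then show ?thesis using j assms by (intro exI[of _ "nat (i - 1)"] exI[of _ 1]) simp
  qed
qed

lemma modform_eisenstein_monomial:
  assumes "int (4 * a + 6 * b) = k"
  shows "modform k (\<lambda>z. eisenstein 4 z ^ a * eisenstein 6 z ^ b) (E4_fps ^ a * E6_fps ^ b)"
  using modform_mult[OF modform_power[OF modform_E4, of a] modform_power[OF modform_E6, of b]] assms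
  by (simp add: mult.commute)

lemma modform_structure:
  assumes f: "modform k f F" and k: "even k" "k \<ge> 0" "k \<noteq> 2" "int (4 * a + 6 * b) = k"
  obtains c g G where "modform (k - 12) g G"
    "\<And>z. z \<in> upper_half_plane \<Longrightarrow> f z = c * (eisenstein 4 z ^ a * eisenstein 6 z ^ b) + discriminant z * g z"
proof -
  define c where "c = fps_nth F 0"
  define h where "h = (\<lambda>z. f z - c * (eisenstein 4 z ^ a * eisenstein 6 z ^ b))"
  have "modform k h (F - fps_const c * (E4_fps ^ a * E6_fps ^ b))"
    unfolding h_def by (intro modform_diff f modform_cmult modform_eisenstein_monomial k)
  moreover have "fps_nth (F - fps_const c * (E4_fps ^ a * E6_fps ^ b)) 0 = 0"
    by (simp add: c_def fps_power_zeroth)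
  ultimately obtain G where "modform (k - 12) (\<lambda>z. h z / discriminant z) G"
    by (rule modform_divide_discriminant)
  moreover have "f z = c * (eisenstein 4 z ^ a * eisenstein 6 z ^ b) + discriminant z * (h z / discriminant z)"
    if "z \<in> upper_half_plane" for z
    using discriminant_nonzero[OF that] by (simp add: h_def)
  ultimately show ?thesis by (rule that)
qed

lemma cfun_span_image:
  assumes "f \<in> cfun.span B" "\<And>x y. T (x + y) = T x + T y" "\<And>c x. T (\<lambda>z. c * x z) = (\<lambda>z. c * T x z)"
  shows "T f \<in> cfun.span (T ` B)"
  using assms(1)
proof (induction rule: cfun.span_induct_alt)
  case base
  have "T (\<lambda>z. 0) = T (\<lambda>z. 0 * (\<lambda>_. 0) z)" by simp
  also have "\<dots> = (\<lambda>z. 0)" unfolding assms(3) by simp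
  finally show ?case using cfun.span_zero[of "T ` B"] by (simp add: zero_fun_def)
next
  case (step c x y)
  then have "T x \<in> cfun.span (T ` B)" by (intro cfun.span_base) simp
  then show ?case unfolding assms(2,3) using step by (intro cfun.span_add cfun.span_scale) auto
qed

lemma modular_forms_finite_span:
  assumes "even k"
  shows "\<exists>B. finite B \<and> card B \<le> modular_dim k \<and> modular_forms k \<subseteq> cfun.span B"
  using assms
\<comment> \<open>The shift by 12 makes the measure drop from \<open>k\<close> to
  \<open>k - 12\<close> also in the last step, where the weight becomes negative.\<close>
proof (induction "nat (k + 12)" arbitrary: k rule: less_induct)
  case less
  have zero: "f \<in> cfun.span {}" if "f \<in> modular_forms k" "\<And>F z. modform k f F \<Longrightarrow> z \<in> upper_half_plane \<Longrightarrow> f z = 0" for f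
  proof -
    have "cut f = f" and "\<exists>F. modform k f F" using that(1) by (auto simp: modular_forms_iff)
    then have "f z = 0" for z using that(2) by (metis cut_def)
    then have "f = 0" by (simp add: fun_eq_iff)
    then show ?thesis by simp
  qed
  consider "k < 0" | "k = 2" | "k \<ge> 0" "k \<noteq> 2" by linarith
  then show ?case
  proof cases
    case 1
    then show ?thesis using zero modform_negative_weight by (intro exI[of _ "{}"]) auto
  next
    case 2
    then show ?thesis using zero modform_weight_2 by (intro exI[of _ "{}"]) auto
  next
    case 3
    obtain a b where ab: "int (4 * a + 6 * b) = k" using exists_eisenstein_monomial[OF less.prems 3] by blast
    define T where "T = (\<lambda>g :: complex \<Rightarrow> complex. cut (\<lambda>z. discriminant z * g z))"
    define E where "E = cut (\<lambda>z. eisenstein 4 z ^ a * eisenstein 6 z ^ b)"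
    obtain B where B: "finite B" "card B \<le> modular_dim (k - 12)" "modular_forms (k - 12) \<subseteq> cfun.span B"
      using less.hyps[of "k - 12"] less.prems 3 by auto
    have "card (insert E (T ` B)) \<le> card (T ` B) + 1" by (simp add: card_insert_if B(1))
    also have "\<dots> \<le> card B + 1" using card_image_le[OF B(1), of T] by simp
    also have "\<dots> \<le> modular_dim (k - 12) + 1" using B(2) by simp
    also have "\<dots> = modular_dim k"
    proof -
      have "k \<ge> 12 \<or> k = 0 \<or> k = 4 \<or> k = 6 \<or> k = 8 \<or> k = 10" using 3 less.prems by presburger
      moreover have "(k - 12) mod 12 = k mod 12" "(k - 12) div 12 = k div 12 - 1"
        using mod_add_self2[of "k - 12" 12] div_add_self2[of 12 "k - 12"] by simp_all
      ultimately show ?thesis by (auto simp: modular_dim_def)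
    qed
    finally have card: "card (insert E (T ` B)) \<le> modular_dim k" .
    have "f \<in> cfun.span (insert E (T ` B))" if f: "f \<in> modular_forms k" for f
    proof -
      obtain F where F: "modform k f F" and cut: "cut f = f" using f by (auto simp: modular_forms_iff)
      obtain c g G where g: "modform (k - 12) g G"
        "\<And>z. z \<in> upper_half_plane \<Longrightarrow> f z = c * (eisenstein 4 z ^ a * eisenstein 6 z ^ b) + discriminant z * g z"
        using modform_structure[OF F less.prems 3 ab] by metis
      have "cut g \<in> cfun.span B" using cut_modular_form[OF g(1)] B(3) by blast
      then have "T (cut g) \<in> cfun.span (T ` B)"
        by (rule cfun_span_image) (auto simp: T_def cut_def fun_eq_iff algebra_simps)
      then have "T (cut g) \<in> cfun.span (insert E (T ` B))"
        using cfun.span_mono[of "T ` B" "insert E (T ` B)"] by blast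
      moreover have "E \<in> cfun.span (insert E (T ` B))" by (intro cfun.span_base) simp
      ultimately have "(\<lambda>z. c * E z) + T (cut g) \<in> cfun.span (insert E (T ` B))"
        by (intro cfun.span_add cfun.span_scale)
      moreover have "f z = 0" if "z \<notin> upper_half_plane" for z
        using cut that by (metis cut_def)
      then have "(\<lambda>z. c * E z) + T (cut g) = f"
        using g(2) by (auto simp: fun_eq_iff E_def T_def cut_def)
      ultimately show ?thesis by simp
    qed
    then show ?thesis using card B(1) by (intro exI[of _ "insert E (T ` B)"]) auto
  qed
qed

section \<open>The modular differential equation\<close>

text \<open>Leibniz rule for the Serre derivative, whose value on \<open>E4\<close> is
  \<open>- 4 E6\<close> in this scaling. With its analogue for \<open>E6\<close> it moves every
  Serre derivative inwards until it acts on \<open>F\<close> alone.\<close>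

lemma serre_fps_E4: "serre_fps k (E4_fps * F) = E4_fps * serre_fps (k - 4) F - 4 * (E6_fps * F)"
proof -
  have "serre_fps k (E4_fps * F) = 4 * (3 * D_fps E4_fps) * F + 12 * E4_fps * D_fps F - of_int k * (E2_fps * (E4_fps * F))"
    by (simp add: serre_fps_def D_fps_mult algebra_simps)
  also have "\<dots> = E4_fps * serre_fps (k - 4) F - 4 * (E6_fps * F)"
    unfolding ramanujan_E4_fps by (simp add: serre_fps_def algebra_simps)
  finally show ?thesis .
qed

lemma serre_fps_E6: "serre_fps k (E6_fps * F) = E6_fps * serre_fps (k - 6) F - 6 * (E4_fps * (E4_fps * F))"
proof -
  have "serre_fps k (E6_fps * F) = 6 * (2 * D_fps E6_fps) * F + 12 * E6_fps * D_fps F - of_int k * (E2_fps * (E6_fps * F))"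
    by (simp add: serre_fps_def D_fps_mult algebra_simps)
  also have "\<dots> = E6_fps * serre_fps (k - 6) F - 6 * (E4_fps * (E4_fps * F))"
    unfolding ramanujan_E6_fps by (simp add: serre_fps_def algebra_simps power2_eq_square)
  finally show ?thesis .
qed

text \<open>
  The coefficients are those for which the indicial polynomial of the equation
  \<open>mde w F = 0\<close> at the cusp is \<open>x\<^sup>3 (x - w/3)\<close>.
\<close>

definition mde :: "int \<Rightarrow> complex fps \<Rightarrow> complex fps" where
  "mde w F = serre_fps_iter 4 (w - 3) F
     - of_int (6 * w^2 - 10) * (E4_fps * serre_fps_iter 2 (w - 3) F)
     - of_int (8 * w^3 - 24 * w^2 + 40) * (E6_fps * serre_fps (w - 3) F)
     - of_int (3 * w^4 - 24 * w^3 + 54 * w^2 - 81) * (E4_fps * (E4_fps * F))"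

text \<open>This is 36 times \<open>K_up\<close>, because \<open>serre_fps\<close> carries a factor 12 per derivative.\<close>

definition K_fps :: "int \<Rightarrow> complex fps \<Rightarrow> complex fps" where
  "K_fps w F = of_int (7 * w^2 + 42 * w + 60) * serre_fps_iter 3 (w - 3) F
     - of_int (3 * (15 * w^4 + 96 * w^3 + 151 * w^2 - 30 * w - 116)) * (E4_fps * serre_fps (w - 3) F)
     - of_int (6 * ((w + 1) * (9 * w^4 + 45 * w^3 + 40 * w^2 + 24 * w + 144))) * (E6_fps * F)"

text \<open>
  Here \<open>Q\<close>, \<open>R\<close> and \<open>e\<^sub>i\<close> stand for \<open>E\<^sub>4\<close>, \<open>E\<^sub>6\<close> and the \<open>i\<close>-th Serre derivative of \<open>F\<close>.
  The left-hand side is \<open>L\<^sub>w\<^sub>+\<^sub>6 K\<^sub>w F\<close> and the right-hand side is the value of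
  the operator \<open>M\<^sub>w\<close>, which is \<open>A\<close> times the third Serre derivative minus \<open>S Q\<close> times the first minus \<open>T R\<close>,
  at \<open>L\<^sub>w F\<close>; \<open>S\<close> and \<open>T\<close> were found by comparing coefficients.
\<close>

lemma intertwine_poly:
  fixes W Q R e0 e1 e2 e3 e4 e5 e7 :: "'a :: comm_ring_1"
  defines "a \<equiv> 6 * W^2 - 10" and "b \<equiv> 8 * W^3 - 24 * W^2 + 40" and "c \<equiv> 3 * W^4 - 24 * W^3 + 54 * W^2 - 81"
  defines "a' \<equiv> 6 * (W+6)^2 - 10" and "b' \<equiv> 8 * (W+6)^3 - 24 * (W+6)^2 + 40" and "c' \<equiv> 3 * (W+6)^4 - 24 * (W+6)^3 + 54 * (W+6)^2 - 81"
  defines "A \<equiv> 7 * W^2 + 42 * W + 60" and "B \<equiv> 3 * (15 * W^4 + 96 * W^3 + 151 * W^2 - 30 * W - 116)"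
      and "C \<equiv> 6 * ((W + 1) * (9 * W^4 + 45 * W^3 + 40 * W^2 + 24 * W + 144))"
  defines "S \<equiv> 3 * (15 * W^4 + 264 * W^3 + 1663 * W^2 + 4434 * W + 4204)"
      and "T \<equiv> 54 * W^5 + 1116 * W^4 + 9006 * W^3 + 35496 * W^2 + 68256 * W + 51072"
  shows "(A * e7) - (B * (Q * e5)) + 16 * (B * (R * e4)) - (C * (R * e4)) - 144 * (B * (Q * (Q * e3))) + 24 * (C * (Q * (Q * e3))) + 768 * (B * (Q * (R * e2))) - 288 * (C * (Q * (R * e2))) - 1152 * (B * (Q * (Q * (Q * e1)))) + 1152 * (C * (Q * (Q * (Q * e1)))) - 768 * (B * (R * (R * e1))) + 768 * (C * (R * (R * e1))) - 5760 * (C * (Q * (Q * (R * e0)))) - a' * (Q * ((A * e5) - (B * (Q * e3)) + 8 * (B * (R * e2)) - (C * (R * e2)) - 24 * (B * (Q * (Q * e1))) + 12 * (C * (Q * (Q * e1))) - 48 * (C * (Q * (R * e0))))) - b' * (R * ((A * e4) - (B * (Q * e2)) + 4 * (B * (R * e1)) - (C * (R * e1)) + 6 * (C * (Q * (Q * e0))))) - c' * (Q * (Q * (A * e3 - B * (Q * e1) - C * (R * e0))))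
       = A * (e7 - (a * (Q * e5)) + 12 * (a * (R * e4)) - (b * (R * e4)) - 72 * (a * (Q * (Q * e3))) + 18 * (b * (Q * (Q * e3))) - (c * (Q * (Q * e3))) + 192 * (a * (Q * (R * e2))) - 144 * (b * (Q * (R * e2))) + 24 * (c * (Q * (R * e2))) + 288 * (b * (Q * (Q * (Q * e1)))) - 144 * (c * (Q * (Q * (Q * e1)))) + 192 * (b * (R * (R * e1))) - 96 * (c * (R * (R * e1))) + 960 * (c * (Q * (Q * (R * e0))))) - S * (Q * (e5 - (a * (Q * e3)) + 4 * (a * (R * e2)) - (b * (R * e2)) + 6 * (b * (Q * (Q * e1))) - (c * (Q * (Q * e1))) + 8 * (c * (Q * (R * e0))))) - T * (R * (e4 - (a * (Q * e2)) - (b * (R * e1)) - (c * (Q * (Q * e0)))))"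
  unfolding assms by (simp add: algebra_simps power_numeral_reduce)

text \<open>Both compositions are expanded in the iterated Serre derivatives \<open>e i\<close> with
  coefficients polynomial in \<open>E4\<close> and \<open>E6\<close>. Treating all of these as
  indeterminates reduces the claim to \<open>intertwine_poly\<close>, whose right-hand side vanishes
  with \<open>L\<close>.\<close>

lemma mde_K_fps:
  assumes "mde w F = 0"
  shows "mde (w + 6) (K_fps w F) = 0"
proof -
  define e where "e = (\<lambda>i. serre_fps_iter i (w - 3) F)"
  have e: "serre_fps k (e i) = e (Suc i)" if "k = w - 3 + 2 * int i" for k i
    using that by (simp add: e_def)
  define a where "a = 6 * w^2 - 10"
  define b where "b = 8 * w^3 - 24 * w^2 + 40"
  define c where "c = 3 * w^4 - 24 * w^3 + 54 * w^2 - 81"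
  define A where "A = 7 * w^2 + 42 * w + 60"
  define B where "B = 3 * (15 * w^4 + 96 * w^3 + 151 * w^2 - 30 * w - 116)"
  define C where "C = 6 * ((w + 1) * (9 * w^4 + 45 * w^3 + 40 * w^2 + 24 * w + 144))"
  note rules = serre_fps_add serre_fps_diff serre_fps_of_int serre_fps_numeral serre_fps_E4 serre_fps_E6 e
  have e01: "e 0 = F" "e (Suc 0) = serre_fps (w - 3) F"
    by (simp_all add: e_def)
  define K where "K = K_fps w F"
  have K0: "K = (of_int A * e 3) - (of_int B * (E4_fps * e 1)) - (of_int C * (E6_fps * e 0))"
    by (simp add: K_def K_fps_def A_def B_def C_def e_def)
  define K1 where "K1 = serre_fps (w + 3) K"
  have K1: "K1 = (of_int A * e 4) - (of_int B * (E4_fps * e 2)) + 4 * (of_int B * (E6_fps * e 1)) - (of_int C * (E6_fps * e 1)) + 6 * (of_int C * (E4_fps * (E4_fps * e 0)))"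
    by (simp add: K1_def K0 rules numeral_2_eq_2[symmetric], simp add: algebra_simps)
  define K2 where "K2 = serre_fps (w + 5) K1"
  have K2: "K2 = (of_int A * e 5) - (of_int B * (E4_fps * e 3)) + 8 * (of_int B * (E6_fps * e 2)) - (of_int C * (E6_fps * e 2)) - 24 * (of_int B * (E4_fps * (E4_fps * e 1))) + 12 * (of_int C * (E4_fps * (E4_fps * e 1))) - 48 * (of_int C * (E4_fps * (E6_fps * e 0)))"
    by (simp add: K2_def K1 rules numeral_2_eq_2[symmetric], simp add: algebra_simps)
  define K3 where "K3 = serre_fps (w + 7) K2"
  have K3: "K3 = (of_int A * e 6) - (of_int B * (E4_fps * e 4)) + 12 * (of_int B * (E6_fps * e 3)) - (of_int C * (E6_fps * e 3)) - 72 * (of_int B * (E4_fps * (E4_fps * e 2))) + 18 * (of_int C * (E4_fps * (E4_fps * e 2))) + 192 * (of_int B * (E4_fps * (E6_fps * e 1))) - 144 * (of_int C * (E4_fps * (E6_fps * e 1))) + 288 * (of_int C * (E4_fps * (E4_fps * (E4_fps * e 0)))) + 192 * (of_int C * (E6_fps * (E6_fps * e 0)))"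
    by (simp add: K3_def K2 rules numeral_2_eq_2[symmetric], simp add: algebra_simps)
  define K4 where "K4 = serre_fps (w + 9) K3"
  have K4: "K4 = (of_int A * e 7) - (of_int B * (E4_fps * e 5)) + 16 * (of_int B * (E6_fps * e 4)) - (of_int C * (E6_fps * e 4)) - 144 * (of_int B * (E4_fps * (E4_fps * e 3))) + 24 * (of_int C * (E4_fps * (E4_fps * e 3))) + 768 * (of_int B * (E4_fps * (E6_fps * e 2))) - 288 * (of_int C * (E4_fps * (E6_fps * e 2))) - 1152 * (of_int B * (E4_fps * (E4_fps * (E4_fps * e 1)))) + 1152 * (of_int C * (E4_fps * (E4_fps * (E4_fps * e 1)))) - 768 * (of_int B * (E6_fps * (E6_fps * e 1))) + 768 * (of_int C * (E6_fps * (E6_fps * e 1))) - 5760 * (of_int C * (E4_fps * (E4_fps * (E6_fps * e 0))))"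
    by (simp add: K4_def K3 rules numeral_2_eq_2[symmetric], simp add: algebra_simps)
  define L where "L = mde w F"
  have L0: "L = e 4 - (of_int a * (E4_fps * e 2)) - (of_int b * (E6_fps * e 1)) - (of_int c * (E4_fps * (E4_fps * e 0)))"
    by (simp add: L_def mde_def a_def b_def c_def e_def)
  define L1 where "L1 = serre_fps (w + 5) L"
  have L1: "L1 = e 5 - (of_int a * (E4_fps * e 3)) + 4 * (of_int a * (E6_fps * e 2)) - (of_int b * (E6_fps * e 2)) + 6 * (of_int b * (E4_fps * (E4_fps * e 1))) - (of_int c * (E4_fps * (E4_fps * e 1))) + 8 * (of_int c * (E4_fps * (E6_fps * e 0)))"
    by (simp add: L1_def L0 rules numeral_2_eq_2[symmetric], simp add: algebra_simps)
  define L2 where "L2 = serre_fps (w + 7) L1"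
  have L2: "L2 = e 6 - (of_int a * (E4_fps * e 4)) + 8 * (of_int a * (E6_fps * e 3)) - (of_int b * (E6_fps * e 3)) - 24 * (of_int a * (E4_fps * (E4_fps * e 2))) + 12 * (of_int b * (E4_fps * (E4_fps * e 2))) - (of_int c * (E4_fps * (E4_fps * e 2))) - 48 * (of_int b * (E4_fps * (E6_fps * e 1))) + 16 * (of_int c * (E4_fps * (E6_fps * e 1))) - 48 * (of_int c * (E4_fps * (E4_fps * (E4_fps * e 0)))) - 32 * (of_int c * (E6_fps * (E6_fps * e 0)))"
    by (simp add: L2_def L1 rules numeral_2_eq_2[symmetric], simp add: algebra_simps)
  define L3 where "L3 = serre_fps (w + 9) L2"
  have L3: "L3 = e 7 - (of_int a * (E4_fps * e 5)) + 12 * (of_int a * (E6_fps * e 4)) - (of_int b * (E6_fps * e 4)) - 72 * (of_int a * (E4_fps * (E4_fps * e 3))) + 18 * (of_int b * (E4_fps * (E4_fps * e 3))) - (of_int c * (E4_fps * (E4_fps * e 3))) + 192 * (of_int a * (E4_fps * (E6_fps * e 2))) - 144 * (of_int b * (E4_fps * (E6_fps * e 2))) + 24 * (of_int c * (E4_fps * (E6_fps * e 2))) + 288 * (of_int b * (E4_fps * (E4_fps * (E4_fps * e 1)))) - 144 * (of_int c * (E4_fps * (E4_fps * (E4_fps * e 1)))) + 192 * (of_int b * (E6_fps * (E6_fps * e 1))) - 96 * (of_int c * (E6_fps * (E6_fps * e 1))) + 960 * (of_int c * (E4_fps * (E4_fps * (E6_fps * e 0))))"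
    by (simp add: L3_def L2 rules numeral_2_eq_2[symmetric], simp add: algebra_simps)
  have "L = 0" using assms by (simp add: L_def)
  then have Lz: "L1 = 0" "L2 = 0" "L3 = 0" by (simp_all add: L1_def L2_def L3_def)
  have "mde (w + 6) K = K4 - of_int (6 * (w + 6)^2 - 10) * (E4_fps * K2)
     - of_int (8 * (w + 6)^3 - 24 * (w + 6)^2 + 40) * (E6_fps * K1)
     - of_int (3 * (w + 6)^4 - 24 * (w + 6)^3 + 54 * (w + 6)^2 - 81) * (E4_fps * (E4_fps * K))"
    by (simp add: mde_def K1_def K2_def K3_def K4_def numeral_eq_Suc add.assoc add.commute[of 3])
  also have "\<dots> = of_int A * L3 - (3 * (15 * of_int w ^ 4 + 264 * of_int w ^ 3 + 1663 * (of_int w)^2 + 4434 * of_int w + 4204)) * (E4_fps * L1)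
     - (54 * of_int w ^ 5 + 1116 * of_int w ^ 4 + 9006 * of_int w ^ 3 + 35496 * (of_int w)^2 + 68256 * of_int w + 51072) * (E6_fps * L)"
    using intertwine_poly[where W = "of_int w :: complex fps" and Q = E4_fps and R = E6_fps and ?e0.0 = "e 0" and ?e1.0 = "e 1" and ?e2.0 = "e 2" and ?e3.0 = "e 3" and ?e4.0 = "e 4" and ?e5.0 = "e 5" and ?e7.0 = "e 7"]
    unfolding K0 K1 K2 K4 L0 L1 L3 A_def B_def C_def a_def b_def c_def of_int_add of_int_diff of_int_mult of_int_power of_int_numeral of_int_1 .
  finally show ?thesis
    using Lz \<open>L = 0\<close> by (simp add: K_def)
qed

section \<open>Leading coefficients of solutions of the differential equation\<close>

text \<open>The expansion \<open>q^n (a + b q + c q^2 + ...)\<close>. Allowing \<open>a = 0\<close>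
  makes it possible to express the cancellation of leading terms before \<open>jet3_shift\<close>
  raises the order.\<close>

definition jet3 :: "nat \<Rightarrow> complex fps \<Rightarrow> complex \<Rightarrow> complex \<Rightarrow> complex \<Rightarrow> bool" where
  "jet3 n F a b c \<longleftrightarrow>
     (\<exists>G. F = fps_X ^ n * G \<and> fps_nth G 0 = a \<and> fps_nth G 1 = b \<and> fps_nth G 2 = c)"

lemma divisor_sum_1 [simp]: "divisor_sum m 1 = 1" "divisor_sum m (Suc 0) = 1"
  by (simp_all add: divisor_sum_def)

lemma divisor_sum_2 [simp]: "divisor_sum m 2 = 1 + 2 ^ m"
proof -
  have "{d. d dvd (2 :: nat)} = {1, 2}"
    by (auto dest: prime_nat_iff[THEN iffD1, OF two_is_prime_nat, THEN conjunct2, rule_format])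
  then show ?thesis by (simp add: divisor_sum_def)
qed

lemma jet3_D:
  assumes "jet3 n F a b c"
  shows "jet3 n (D_fps F) (of_nat n * a) (of_nat (n + 1) * b) (of_nat (n + 2) * c)"
proof -
  obtain G where G: "F = fps_X ^ n * G" "fps_nth G 0 = a" "fps_nth G 1 = b" "fps_nth G 2 = c"
    using assms by (auto simp: jet3_def)
  have "D_fps (fps_X ^ n) = of_nat n * fps_X ^ n"
    by (rule fps_ext) (auto simp: D_fps_nth fps_X_power_iff fps_of_nat[symmetric])
  then have "D_fps F = fps_X ^ n * (of_nat n * G + D_fps G)"
    by (simp add: G D_fps_mult algebra_simps)
  moreover have "fps_nth (of_nat n * G + D_fps G) i = of_nat (n + i) * fps_nth G i" for i
    by (simp add: D_fps_nth fps_of_nat[symmetric] algebra_simps)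
  ultimately show ?thesis using G unfolding jet3_def by (metis add_0_right)
qed

lemma jet3_mult:
  assumes "jet3 n F a b c" and "fps_nth E 0 = 1"
  shows "jet3 n (E * F) a (b + fps_nth E 1 * a) (c + fps_nth E 1 * b + fps_nth E 2 * a)"
proof -
  obtain G where G: "F = fps_X ^ n * G" "fps_nth G 0 = a" "fps_nth G 1 = b" "fps_nth G 2 = c"
    using assms by (auto simp: jet3_def)
  have "E * F = fps_X ^ n * (E * G)" using G by (simp add: algebra_simps)
  moreover have "fps_nth (E * G) 0 = a" "fps_nth (E * G) 1 = b + fps_nth E 1 * a"
    "fps_nth (E * G) 2 = c + fps_nth E 1 * b + fps_nth E 2 * a"
    using G assms(2) by (simp_all add: fps_mult_nth numeral_2_eq_2 algebra_simps)
  ultimately show ?thesis unfolding jet3_def by blast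
qed

lemma jet3_diff:
  assumes "jet3 n F a b c" "jet3 n F' a' b' c'"
  shows "jet3 n (F - F') (a - a') (b - b') (c - c')"
proof -
  obtain G G' where "F = fps_X ^ n * G" "fps_nth G 0 = a" "fps_nth G 1 = b" "fps_nth G 2 = c"
    "F' = fps_X ^ n * G'" "fps_nth G' 0 = a'" "fps_nth G' 1 = b'" "fps_nth G' 2 = c'"
    using assms by (auto simp: jet3_def)
  then show ?thesis unfolding jet3_def by (intro exI[of _ "G - G'"]) (simp add: right_diff_distrib)
qed

lemma jet3_cmult:
  assumes "jet3 n F a b c"
  shows "jet3 n (fps_const x * F) (x * a) (x * b) (x * c)"
proof -
  obtain G where G: "F = fps_X ^ n * G" "fps_nth G 0 = a" "fps_nth G 1 = b" "fps_nth G 2 = c"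
    using assms by (auto simp: jet3_def)
  have "fps_const x * F = fps_X ^ n * (fps_const x * G)" using G by (simp add: algebra_simps)
  then show ?thesis unfolding jet3_def using G by (intro exI[of _ "fps_const x * G"]) simp
qed

lemma jet3_of_int:
  assumes "jet3 n F a b c"
  shows "jet3 n (of_int x * F) (of_int x * a) (of_int x * b) (of_int x * c)"
  using jet3_cmult[OF assms, of "of_int x"] by (simp add: fps_of_int)

lemma jet3_unique:
  assumes "jet3 n F a b c" "jet3 n F a' b' c'"
  shows "a = a'" "b = b'" "c = c'"
  using assms by (auto simp: jet3_def)

lemma jet3_eis_mult:
  assumes "jet3 n F a b c"
  shows "jet3 n (eis_fps m x * F) a (b + of_int x * a) (c + of_int x * b + of_int x * (1 + 2 ^ m) * a)"
  using jet3_mult[OF assms, of "eis_fps m x"] by (simp add: eis_fps_def)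

lemma jet3_serre:
  assumes "jet3 n F a b c"
  shows "jet3 n (serre_fps k F) ((12 * of_nat n - of_int k) * a)
     ((12 * of_nat n + 12 - of_int k) * b + 24 * of_int k * a)
     ((12 * of_nat n + 24 - of_int k) * c + 24 * of_int k * b + 72 * of_int k * a)"
  using jet3_diff[OF jet3_of_int[OF jet3_D[OF assms], of 12] jet3_of_int[OF jet3_eis_mult[OF assms, of 1 "-24"], of k]]
  by (simp add: serre_fps_def algebra_simps)

lemma jet3_serre_eq:
  assumes "jet3 n F a b c" "a' = (12 * of_nat n - of_int k) * a"
    "b' = (12 * of_nat n + 12 - of_int k) * b + 24 * of_int k * a"
    "c' = (12 * of_nat n + 24 - of_int k) * c + 24 * of_int k * b + 72 * of_int k * a"
  shows "jet3 n (serre_fps k F) a' b' c'"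
  using jet3_serre assms by simp

text \<open>Here \<open>w = 3 n\<close>, so the Serre derivative of weight
  \<open>w - 3 + 2 i\<close> acts on the coefficient of \<open>q^n\<close> by
  \<open>12 n - (w - 3 + 2 i) = 9 n + 3 - 2 i\<close>. The numbers \<open>a i\<close>,
  \<open>b i\<close>, \<open>c i\<close> form the jet of the \<open>i\<close>-th derivative.\<close>

context
  fixes n :: nat and F :: "complex fps" and a b N a1 b1 c1 a2 b2 c2 a3 b3 c3 :: complex
  assumes jet: "jet3 n F 1 a b"
  defines "N \<equiv> of_nat n"
  defines "a1 \<equiv> 9 * N + 3" and "b1 \<equiv> (9 * N + 15) * a + 72 * N - 72"
    and "c1 \<equiv> (9 * N + 27) * b + (72 * N - 72) * a + 216 * N - 216"
  defines "a2 \<equiv> (9 * N + 1) * a1" and "b2 \<equiv> (9 * N + 13) * b1 + (72 * N - 24) * a1"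
    and "c2 \<equiv> (9 * N + 25) * c1 + (72 * N - 24) * b1 + (216 * N - 72) * a1"
  defines "a3 \<equiv> (9 * N - 1) * a2" and "b3 \<equiv> (9 * N + 11) * b2 + (72 * N + 24) * a2"
    and "c3 \<equiv> (9 * N + 23) * c2 + (72 * N + 24) * b2 + (216 * N + 72) * a2"
begin

lemma jet3_iter:
  shows "jet3 n (serre_fps (3 * int n - 3) F) a1 b1 c1"
   and "jet3 n (serre_fps_iter 2 (3 * int n - 3) F) a2 b2 c2"
   and "jet3 n (serre_fps_iter 3 (3 * int n - 3) F) a3 b3 c3"
   and "jet3 n (serre_fps_iter 4 (3 * int n - 3) F) ((9 * N - 3) * a3)
       ((9 * N + 9) * b3 + (72 * N + 72) * a3)
       ((9 * N + 21) * c3 + (72 * N + 72) * b3 + (216 * N + 216) * a3)"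
proof -
  show 1: "jet3 n (serre_fps (3 * int n - 3) F) a1 b1 c1"
    by (rule jet3_serre_eq[OF jet]) (simp_all add: N_def a1_def b1_def c1_def algebra_simps)
  have "jet3 n (serre_fps (3 * int n - 3 + 2) (serre_fps (3 * int n - 3) F)) a2 b2 c2"
    by (rule jet3_serre_eq[OF 1]) (simp_all add: N_def a2_def b2_def c2_def ring_distribs)
  then show 2: "jet3 n (serre_fps_iter 2 (3 * int n - 3) F) a2 b2 c2" by (simp add: numeral_eq_Suc)
  have "jet3 n (serre_fps (3 * int n - 3 + 4) (serre_fps_iter 2 (3 * int n - 3) F)) a3 b3 c3"
    by (rule jet3_serre_eq[OF 2]) (simp_all add: N_def a3_def b3_def c3_def ring_distribs)
  then show 3: "jet3 n (serre_fps_iter 3 (3 * int n - 3) F) a3 b3 c3" by (simp add: numeral_eq_Suc)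
  have "jet3 n (serre_fps (3 * int n - 3 + 6) (serre_fps_iter 3 (3 * int n - 3) F)) ((9 * N - 3) * a3)
       ((9 * N + 9) * b3 + (72 * N + 72) * a3)
       ((9 * N + 21) * c3 + (72 * N + 72) * b3 + (216 * N + 216) * a3)"
    by (rule jet3_serre_eq[OF 3]) (simp_all add: N_def ring_distribs)
  then show "jet3 n (serre_fps_iter 4 (3 * int n - 3) F) ((9 * N - 3) * a3)
       ((9 * N + 9) * b3 + (72 * N + 72) * a3)
       ((9 * N + 21) * c3 + (72 * N + 72) * b3 + (216 * N + 216) * a3)"
    by (simp add: numeral_eq_Suc)
qed

text \<open>The Frobenius recursion at the exponent \<open>n\<close>: the indicial polynomial at
  \<open>n + 1\<close> and \<open>n + 2\<close> supplies the factors \<open>(N + 1)^3\<close> and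
  \<open>2 (N + 2)^3\<close>.\<close>

lemma jet3_mde:
  assumes "mde (3 * int n) F = 0"
  shows "(N + 1) ^ 3 * a = 3 * N^4 + 18 * N^3 + 9 * N^2 - 6 * N"
    and "2 * (N + 2) ^ 3 * (N + 1) ^ 3 * b = N * (9 * N^7 + 144 * N^6 + 810 * N^5 + 1296 * N^4 - 567 * N^3 - 432 * N^2 + 612 * N - 144)"
proof -
  define p where "p = 54 * N^2 - 10"
  define q where "q = 216 * N^3 - 216 * N^2 + 40"
  define r where "r = 243 * N^4 - 648 * N^3 + 486 * N^2 - 81"
  have coeffs: "complex_of_int (6 * (3 * int n)^2 - 10) = p"
    "complex_of_int (8 * (3 * int n) ^ 3 - 24 * (3 * int n)^2 + 40) = q"
    "complex_of_int (3 * (3 * int n) ^ 4 - 24 * (3 * int n) ^ 3 + 54 * (3 * int n)^2 - 81) = r"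
    by (simp_all add: p_def q_def r_def N_def power_mult_distrib)
  note J = jet3_diff[OF jet3_diff[OF jet3_diff[OF jet3_iter(4)
        jet3_of_int[OF jet3_eis_mult[OF jet3_iter(2), of 3 240], of "6 * (3 * int n)^2 - 10"]]
        jet3_of_int[OF jet3_eis_mult[OF jet3_iter(1), of 5 "-504"], of "8 * (3 * int n) ^ 3 - 24 * (3 * int n)^2 + 40"]]
        jet3_of_int[OF jet3_eis_mult[OF jet3_eis_mult[OF jet, of 3 240], of 3 240], of "3 * (3 * int n) ^ 4 - 24 * (3 * int n) ^ 3 + 54 * (3 * int n)^2 - 81"],
        folded mde_def, unfolded assms coeffs]
  have Z: "jet3 n 0 0 0 0"
    by (auto simp: jet3_def intro: exI[of _ 0])
  note E = jet3_unique(2,3)[OF J Z]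
  \<comment> \<open>\<open>20736 = 12^4\<close> is the scaling of four derivatives.\<close>
  have "20736 * ((N + 1) ^ 3 * a - (3 * N^4 + 18 * N^3 + 9 * N^2 - 6 * N)) = 0"
    using E(1) by (simp add: p_def q_def r_def a3_def b3_def a2_def b2_def a1_def b1_def) algebra
  then show A: "(N + 1) ^ 3 * a = 3 * N^4 + 18 * N^3 + 9 * N^2 - 6 * N"
      by (simp only: mult_eq_0_iff zero_neq_numeral[symmetric] simp_thms right_minus_eq)
  show "2 * (N + 2) ^ 3 * (N + 1) ^ 3 * b = N * (9 * N^7 + 144 * N^6 + 810 * N^5 + 1296 * N^4 - 567 * N^3 - 432 * N^2 + 612 * N - 144)"
    using E(2) A by (simp add: p_def q_def r_def a3_def b3_def a2_def b2_def a1_def b1_def c1_def c2_def c3_def) algebra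
qed

text \<open>The leading coefficient cancels identically in \<open>N\<close>, the next one by the
  recursion. The order thus grows by 2, as weight 6 more requires, and the third coefficient
  explains the normalising constant.\<close>

lemma jet3_K_fps:
  assumes "mde (3 * int n) F = 0"
  defines "W \<equiv> 3 * N"
  shows "jet3 n (K_fps (3 * int n) F) 0 0
    (36 * (2^2 * 3^7 * (W + 1) * (W + 2)^3 * (W + 4)^3 * (W + 5)) / (W + 6)^3)"
proof -
  define p where "p = 63 * N^2 + 126 * N + 60"
  define q where "q = 3 * (1215 * N^4 + 2592 * N^3 + 1359 * N^2 - 90 * N - 116)"
  define r where "r = 6 * ((3 * N + 1) * (729 * N^4 + 1215 * N^3 + 360 * N^2 + 72 * N + 144))"
  have coeffs: "complex_of_int (7 * (3 * int n)^2 + 42 * (3 * int n) + 60) = p"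
    "complex_of_int (3 * (15 * (3 * int n) ^ 4 + 96 * (3 * int n) ^ 3 + 151 * (3 * int n)^2 - 30 * (3 * int n) - 116)) = q"
    "complex_of_int (6 * ((3 * int n + 1) * (9 * (3 * int n) ^ 4 + 45 * (3 * int n) ^ 3 + 40 * (3 * int n)^2 + 24 * (3 * int n) + 144))) = r"
    by (simp_all add: p_def q_def r_def N_def power_mult_distrib)
  note J = jet3_diff[OF jet3_diff[OF 
        jet3_of_int[OF jet3_iter(3), of "7 * (3 * int n)^2 + 42 * (3 * int n) + 60"]
        jet3_of_int[OF jet3_eis_mult[OF jet3_iter(1), of 3 240], of "3 * (15 * (3 * int n) ^ 4 + 96 * (3 * int n) ^ 3 + 151 * (3 * int n)^2 - 30 * (3 * int n) - 116)"]]
        jet3_of_int[OF jet3_eis_mult[OF jet, of 5 "-504"], of "6 * ((3 * int n + 1) * (9 * (3 * int n) ^ 4 + 45 * (3 * int n) ^ 3 + 40 * (3 * int n)^2 + 24 * (3 * int n) + 144))"],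
        folded K_fps_def, unfolded coeffs]
  note eqs = jet3_mde[OF assms(1)]
  have nz: "N + 1 \<noteq> 0" "N + 2 \<noteq> 0"
    unfolding N_def by (metis of_nat_Suc of_nat_eq_0_iff add.commute nat.distinct(1), metis of_nat_Suc of_nat_eq_0_iff add_2_eq_Suc' of_nat_add of_nat_numeral nat.distinct(1))
  have "p * a3 - q * a1 - r * 1 = 0"
    unfolding p_def q_def r_def a3_def a2_def a1_def by algebra
  moreover have "(N + 1) ^ 3 * (p * b3 - q * (b1 + of_int 240 * a1) - r * (a + of_int (- 504) * 1)) = 0"
    using eqs(1) unfolding p_def q_def r_def b3_def a3_def b2_def a2_def b1_def a1_def 
    by (simp del: mult_eq_0_iff) algebra
  moreover have "2 * (N + 2) ^ 3 * (N + 1) ^ 3 * (p * c3 - q * (c1 + of_int 240 * b1 + of_int 240 * (1 + 2 ^ 3) * a1)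
      - r * (b + of_int (- 504) * a + of_int (- 504) * (1 + 2 ^ 5) * 1)) 
     = 2 * (N + 1) ^ 3 * (36 * (2^2 * 3^4 * (W + 1) * (W + 2)^3 * (W + 4)^3 * (W + 5)))"
    using eqs unfolding p_def q_def r_def c3_def b3_def a3_def c2_def b2_def a2_def c1_def b1_def a1_def W_def
    by (simp del: mult_eq_0_iff) algebra
  \<comment> \<open>The denominator \<open>(N + 2)^3\<close> comes from the recursion for
    \<open>b\<close>; written in terms of \<open>W + 6\<close> it turns \<open>3^4\<close> into
    \<open>3^7\<close>.\<close>
  moreover have "(W + 6) ^ 3 = 3 ^ 3 * (N + 2) ^ 3"
    unfolding W_def by algebra
  moreover have "X = 0" if "x ^ 3 * X = 0" "x \<noteq> 0" for x X :: complex
    using that by simp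
  moreover have "X = 36 * (2^2 * 3^7 * Y) / (3^3 * y^3)" if "2 * y^3 * x^3 * X = 2 * x^3 * (36 * (2^2 * 3^4 * Y))" "x \<noteq> 0" "y \<noteq> 0" for x y X Y :: complex
    using that by (simp add: field_simps)
  ultimately have "p * a3 - q * a1 - r * 1 = 0"
      "p * b3 - q * (b1 + of_int 240 * a1) - r * (a + of_int (- 504) * 1) = 0"
      "p * c3 - q * (c1 + of_int 240 * b1 + of_int 240 * (1 + 2 ^ 3) * a1)
      - r * (b + of_int (- 504) * a + of_int (- 504) * (1 + 2 ^ 5) * 1) = 
      36 * (2^2 * 3^7 * ((W + 1) * (W + 2)^3 * (W + 4)^3 * (W + 5))) / (W + 6)^3"
    using nz by (simp_all only: mult.assoc)
  then show ?thesis using J by (simp only: mult.assoc)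
qed

text \<open>The factor of \<open>E4\<close> is \<open>(9 N + 3) (9 N + 1) = a2\<close>, by which the
  second Serre derivative acts on the leading coefficient, so this coefficient cancels and the next
  one is read off from the recursion.\<close>

lemma jet3_next:
  assumes "mde (3 * int n) F = 0"
  defines "W \<equiv> 3 * N"
  shows "\<exists>c. jet3 n (of_int (3 * (3 * int n + 1) * (9 * int n + 1)) * (E4_fps * F) - serre_fps_iter 2 (3 * int n - 3) F) 0
    (144 * (27 * (W + 1) * (W + 2)^3) / (2 * (W + 3)^2)) c"
proof -
  define p where "p = 3 * (3 * N + 1) * (9 * N + 1)"
  have coeffs: "complex_of_int (3 * (3 * int n + 1) * (9 * int n + 1)) = p"
    by (simp add: p_def N_def)
  note J = jet3_diff[OF jet3_of_int[OF jet3_eis_mult[OF jet, of 3 240], of "3 * (3 * int n + 1) * (9 * int n + 1)"]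
       jet3_iter(2), unfolded coeffs]
  have nz: "N + 1 \<noteq> 0"
    unfolding N_def by (metis of_nat_Suc of_nat_eq_0_iff add.commute nat.distinct(1))
  have cancel: "X = Y / (18 * x ^ 2)" if "18 * x ^ 3 * X = x * Y" "x \<noteq> 0" for x X Y :: complex
    using that by (simp add: field_simps power2_eq_square power3_eq_cube)
  have "18 * (N + 1) ^ 3 * (p * (a + of_int 240 * 1) - b2) = (N + 1) * (144 * (27 * (W + 1) * (W + 2)^3))"
    using jet3_mde(1)[OF assms(1)] unfolding p_def b2_def b1_def a1_def W_def by simp algebra
  from cancel[OF this nz] have "p * (a + of_int 240 * 1) - b2 = 144 * (27 * (W + 1) * (W + 2)^3) / (18 * (N + 1)^2)" .
  moreover have "2 * (W + 3) ^ 2 = 18 * (N + 1) ^ 2" unfolding W_def by algebra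
  moreover have "p * 1 - a2 = 0" by (simp add: p_def a2_def a1_def)
  ultimately have "p * 1 - a2 = 0" "p * (a + of_int 240 * 1) - b2 = 144 * (27 * (W + 1) * (W + 2)^3) / (2 * (W + 3)^2)"
    by (simp_all only:)
  then show ?thesis using J by (auto intro!: exI)
qed

end

section \<open>Quasimodular forms of depth 3\<close>

text \<open>The counterpart of \<open>modform\<close> for depth 3: a condition on the half-plane
  only.\<close>

definition qmodform :: "int \<Rightarrow> (complex \<Rightarrow> complex) \<Rightarrow> bool" where
  "qmodform w f \<longleftrightarrow> (\<exists>g G. (\<forall>l\<le>3. modform (w - 2 * int l) (g l) (G l)) \<and>
     (\<forall>z\<in>upper_half_plane. f z = (\<Sum>l\<le>3. eisenstein 2 z ^ l * g l z)))"

lemma quasimodular_forms_cut: "f \<in> quasimodular_forms 3 w \<Longrightarrow> cut f = f"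
  by (auto simp: quasimodular_forms_def modular_forms_def cut_def fun_eq_iff)

lemma quasimodular_forms_iff: "cut f \<in> quasimodular_forms 3 w \<longleftrightarrow> qmodform w f"
proof
  assume "cut f \<in> quasimodular_forms 3 w"
  then obtain g where g: "\<forall>l\<le>3. g l \<in> modular_forms (w - 2 * int l)" "cut f = (\<lambda>z. \<Sum>l\<le>3. eisenstein 2 z ^ l * g l z)"
    by (auto simp: quasimodular_forms_def)
  have "\<forall>l. \<exists>F. l \<le> 3 \<longrightarrow> modform (w - 2 * int l) (g l) F"
    using g(1) by (auto simp: modular_forms_iff)
  from choice[OF this] obtain G where "\<forall>l\<le>3. modform (w - 2 * int l) (g l) (G l)" by blast
  moreover have "f z = (\<Sum>l\<le>3. eisenstein 2 z ^ l * g l z)" if "z \<in> upper_half_plane" for z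
    using fun_cong[OF g(2), of z] that by simp
  ultimately show "qmodform w f" unfolding qmodform_def by blast
next
  assume "qmodform w f"
  then obtain g G where g: "\<forall>l\<le>3. modform (w - 2 * int l) (g l) (G l)"
    "\<forall>z\<in>upper_half_plane. f z = (\<Sum>l\<le>3. eisenstein 2 z ^ l * g l z)"
    by (auto simp: qmodform_def)
  have "cut f = (\<lambda>z. \<Sum>l\<le>3. eisenstein 2 z ^ l * cut (g l) z)"
    using g(2) by (auto simp: cut_def fun_eq_iff)
  then show "cut f \<in> quasimodular_forms 3 w"
    using g(1) cut_modular_form unfolding quasimodular_forms_def
    by (intro CollectI exI[of _ "\<lambda>l. cut (g l)"]) auto
qed

lemma qmodform_add:
  assumes "qmodform w f" "qmodform w g"
  shows "qmodform w (\<lambda>z. f z + g z)"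
proof -
  obtain a A b B where "\<forall>l\<le>3. modform (w - 2 * int l) (a l) (A l)" "\<forall>l\<le>3. modform (w - 2 * int l) (b l) (B l)"
    and "\<forall>z\<in>upper_half_plane. f z = (\<Sum>l\<le>3. eisenstein 2 z ^ l * a l z)"
    "\<forall>z\<in>upper_half_plane. g z = (\<Sum>l\<le>3. eisenstein 2 z ^ l * b l z)"
    using assms by (auto simp: qmodform_def)
  then show ?thesis unfolding qmodform_def
    by (intro exI[of _ "\<lambda>l z. a l z + b l z"] exI[of _ "\<lambda>l. A l + B l"])
       (auto intro!: modform_add simp: sum.distrib ring_distribs)
qed

lemma qmodform_mult:
  assumes "qmodform w f" "modform k h H"
  shows "qmodform (w + k) (\<lambda>z. h z * f z)"
proof -
  obtain a A where a: "\<forall>l\<le>3. modform (w - 2 * int l) (a l) (A l)"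
    "\<forall>z\<in>upper_half_plane. f z = (\<Sum>l\<le>3. eisenstein 2 z ^ l * a l z)"
    using assms by (auto simp: qmodform_def)
  have "modform (w + k - 2 * int l) (\<lambda>z. h z * a l z) (H * A l)" if "l \<le> 3" for l
    using modform_mult[OF assms(2), of "w - 2 * int l" "a l" "A l"] a(1) that by (simp add: algebra_simps)
  then show ?thesis using a(2) unfolding qmodform_def
    by (intro exI[of _ "\<lambda>l z. h z * a l z"] exI[of _ "\<lambda>l. H * A l"]) (auto simp: sum_distrib_left algebra_simps)
qed

lemma qmodform_cmult: "qmodform w f \<Longrightarrow> qmodform w (\<lambda>z. c * f z)"
  using qmodform_mult[OF _ modform_const, of w f c] by simp

lemma qmodform_diff: "qmodform w f \<Longrightarrow> qmodform w g \<Longrightarrow> qmodform w (\<lambda>z. f z - g z)"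
  using qmodform_add[of w f "\<lambda>z. -1 * g z"] qmodform_cmult[of w g "-1"] by simp

lemma q_deriv_cong:
  assumes "\<And>z. z \<in> upper_half_plane \<Longrightarrow> f z = g z" "z \<in> upper_half_plane"
  shows "q_deriv f z = q_deriv g z"
  unfolding q_deriv_def
  by (subst deriv_cong_ev[of f g z z])
     (use assms eventually_nhds_in_open[OF open_upper_half_plane assms(2)] in \<open>auto elim: eventually_mono\<close>)

lemma serre_deriv_cong:
  assumes "\<And>z. z \<in> upper_half_plane \<Longrightarrow> f z = g z" "z \<in> upper_half_plane"
  shows "serre_deriv k f z = serre_deriv k g z"
  using q_deriv_cong[OF assms] assms by (simp add: serre_deriv_def)

lemma serre_deriv_iter_cong:
  assumes "\<And>z. z \<in> upper_half_plane \<Longrightarrow> f z = g z" "z \<in> upper_half_plane"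
  shows "serre_deriv_iter j k f z = serre_deriv_iter j k g z"
  using assms(2) by (induction j arbitrary: z) (auto simp: assms(1) intro: serre_deriv_cong)

lemma q_deriv_E2:
  assumes "z \<in> upper_half_plane"
  shows "q_deriv (eisenstein 2) z = (eisenstein 2 z ^ 2 - eisenstein 4 z) / 12"
  using has_q_expansion_eval[OF modform_q_expansion[OF modform_E2_riccati] assms]
    has_q_expansion_eval[OF eisenstein_2_4_6_q_expansion(2) assms] unfolding riccati_E2_fps by (simp add: field_simps)

text \<open>With weight \<open>w - 3\<close> in place of \<open>w\<close>, the Serre derivative does not raise the depth beyond 3.\<close>

lemma qmodform_serre_deriv:
  assumes "qmodform w f"
  shows "qmodform (w + 2) (serre_deriv (w - 3) f)"
proof -
  obtain g G where g: "\<forall>l\<le>3. modform (w - 2 * int l) (g l) (G l)"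
    "\<forall>z\<in>upper_half_plane. f z = (\<Sum>l\<le>3. eisenstein 2 z ^ l * g l z)"
    using assms by (auto simp: qmodform_def)
  have sum3: "(\<Sum>l\<le>3. a l) = a 0 + a 1 + a 2 + a 3" for a :: "nat \<Rightarrow> complex"
    by (simp add: numeral_eq_Suc sum.atMost_Suc)
  have m: "modform w (g 0) (G 0)" "modform (w - 2) (g 1) (G 1)" "modform (w - 4) (g 2) (G 2)" "modform (w - 6) (g 3) (G 3)"
    using g(1)[rule_format, of 0] g(1)[rule_format, of 1] g(1)[rule_format, of 2] g(1)[rule_format, of 3] by simp_all
  note s = modform_serre_deriv[OF m(1)] modform_serre_deriv[OF m(2)] modform_serre_deriv[OF m(3)] modform_serre_deriv[OF m(4)]
  \<comment> \<open>With \<open>12 E2' = E2^2 - E4\<close>, the derivative of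
    \<open>E2^l * g l\<close> consists of \<open>E2^l\<close> times a Serre derivative of weight
    \<open>w - 2 l\<close>, of \<open>(3 - l) / 12\<close> times \<open>E2^(l+1) * g l\<close>, and
    of \<open>- l / 12\<close> times \<open>E2^(l-1) * E4 * g l\<close>. At \<open>l = 3\<close> the
    middle term vanishes.\<close>
  define h0 where "h0 = (\<lambda>z. serre_deriv w (g 0) z + (- 1/12) * (eisenstein 4 z * g 1 z))"
  define h1 where "h1 = (\<lambda>z. serre_deriv (w - 2) (g 1) z + 3/12 * g 0 z + (- 2/12) * (eisenstein 4 z * g 2 z))"
  define h2 where "h2 = (\<lambda>z. serre_deriv (w - 4) (g 2) z + 2/12 * g 1 z + (- 3/12) * (eisenstein 4 z * g 3 z))"
  define h3 where "h3 = (\<lambda>z. serre_deriv (w - 6) (g 3) z + 1/12 * g 2 z)"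
  have w: "4 + (w - 2) = w + 2" "4 + (w - 4) = w" "4 + (w - 6) = w - 2" "w - 2 + 2 = w" "w - 4 + 2 = w - 2" "w - 6 + 2 = w - 4" by simp_all
  obtain H0 H1 H2 H3 where H: "modform (w + 2) h0 H0" "modform w h1 H1" "modform (w - 2) h2 H2" "modform (w - 4) h3 H3"
    using modform_add[OF s(1) modform_cmult[OF modform_mult[OF modform_E4 m(2)], unfolded w], of "- 1/12"]
      modform_add[OF modform_add[OF s(2)[unfolded w] modform_cmult[OF m(1), of "3/12"]] modform_cmult[OF modform_mult[OF modform_E4 m(3)], unfolded w, of "- 2/12"]]
      modform_add[OF modform_add[OF s(3)[unfolded w] modform_cmult[OF m(2), of "2/12"]] modform_cmult[OF modform_mult[OF modform_E4 m(4)], unfolded w, of "- 3/12"]]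
      modform_add[OF s(4)[unfolded w] modform_cmult[OF m(3), of "1/12"]]
    unfolding h0_def h1_def h2_def h3_def by blast
  have val: "serre_deriv (w - 3) f z = h0 z + eisenstein 2 z * h1 z + eisenstein 2 z ^ 2 * h2 z + eisenstein 2 z ^ 3 * h3 z"
    if z: "z \<in> upper_half_plane" for z
  proof -
    define p where "p = g 0 z"
    have der: "(f has_field_derivative 2 * of_real pi * \<i> * q_deriv f z) (at z)" if "has_q_expansion f F" for f F
      using has_q_expansion_deriv[OF that z] DERIV_imp_deriv[OF has_q_expansion_deriv[OF that z]] by (simp add: q_deriv_def)
    note d = der[OF modform_q_expansion[OF m(1)]] der[OF modform_q_expansion[OF m(2)]]
      der[OF modform_q_expansion[OF m(3)]] der[OF modform_q_expansion[OF m(4)]] der[OF eisenstein_2_4_6_q_expansion(1)]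
    let ?e = "eisenstein 2 z"
    let ?d = "(?e ^ 2 - eisenstein 4 z) / 12"
    let ?f = "\<lambda>z. g 0 z + eisenstein 2 z * g 1 z + eisenstein 2 z ^ 2 * g 2 z + eisenstein 2 z ^ 3 * g 3 z"
    have fz: "f w = ?f w" if "w \<in> upper_half_plane" for w using g(2) that by (simp add: sum3)
    have "(?f has_field_derivative 2 * of_real pi * \<i> * (q_deriv (g 0) z + (?d * g 1 z + ?e * q_deriv (g 1) z)
        + (2 * ?e * ?d * g 2 z + ?e ^ 2 * q_deriv (g 2) z) + (3 * ?e ^ 2 * ?d * g 3 z + ?e ^ 3 * q_deriv (g 3) z))) (at z)"
      by (rule derivative_eq_intros d refl)+ (simp add: q_deriv_E2[OF z] algebra_simps power2_eq_square)
    then have "q_deriv ?f z = q_deriv (g 0) z + (?d * g 1 z + ?e * q_deriv (g 1) z)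
        + (2 * ?e * ?d * g 2 z + ?e ^ 2 * q_deriv (g 2) z) + (3 * ?e ^ 2 * ?d * g 3 z + ?e ^ 3 * q_deriv (g 3) z)"
      unfolding q_deriv_def[of ?f] by (simp add: DERIV_imp_deriv)
    then have qd: "q_deriv f z = q_deriv (g 0) z + (?d * g 1 z + ?e * q_deriv (g 1) z)
        + (2 * ?e * ?d * g 2 z + ?e ^ 2 * q_deriv (g 2) z) + (3 * ?e ^ 2 * ?d * g 3 z + ?e ^ 3 * q_deriv (g 3) z)"
      using q_deriv_cong[of f ?f, OF fz z] by simp
    show ?thesis
      unfolding serre_deriv_def[of "w - 3"] fz[OF z] qd h0_def h1_def h2_def h3_def serre_deriv_def
      by (simp add: field_simps power2_eq_square power3_eq_cube)
  qed
  show ?thesis unfolding qmodform_def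
  proof (intro exI conjI allI impI ballI)
    fix l :: nat assume "l \<le> 3"
    then have "l = 0 \<or> l = 1 \<or> l = 2 \<or> l = 3" by auto
    then show "modform (w + 2 - 2 * int l) ([h0, h1, h2, h3] ! l) ([H0, H1, H2, H3] ! l)"
      using H by (elim disjE) (simp_all add: numeral_eq_Suc algebra_simps)
  next
    fix z assume "z \<in> upper_half_plane"
    then show "serre_deriv (w - 3) f z = (\<Sum>l\<le>3. eisenstein 2 z ^ l * ([h0, h1, h2, h3] ! l) z)"
      unfolding sum3 by (simp add: val numeral_eq_Suc)
  qed
qed

lemma qmodform_serre_deriv_iter:
  assumes "qmodform w f"
  shows "qmodform (w + 2 * int j) (serre_deriv_iter j (w - 3) f)"
proof (induction j)
  case (Suc j)
  from qmodform_serre_deriv[OF this] show ?case by (simp add: algebra_simps)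
qed (use assms in simp)

lemma has_q_expansion_serre_deriv_iter:
  assumes "has_q_expansion f F"
  shows "has_q_expansion (serre_deriv_iter j k f) (fps_const (1 / 12 ^ j) * serre_fps_iter j k F)"
proof (induction j)
  case (Suc j)
  have c: "serre_fps l (fps_const c * A) = fps_const c * serre_fps l A" for l c A
    by (simp add: serre_fps_def D_fps_def algebra_simps)
  show ?case
    using has_q_expansion_serre_deriv[OF Suc eisenstein_2_4_6_q_expansion(1), of "k + 2 * int j"]
    by (simp add: c mult.assoc[symmetric])
qed (use assms in simp)

text \<open>The scalings agree because \<open>48 / 12^3 = 1/36\<close>, \<open>1/12 = 3/36\<close>
  and \<open>1/6 = 6/36\<close>.\<close>

lemma has_q_expansion_K_up:
  assumes "has_q_expansion f F"
  shows "has_q_expansion (K_up w f) (fps_const (1/36) * K_fps (int w) F)"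
proof -
  define W where "W = (of_nat w :: complex)"
  define A where "A = 7 * W^2 + 42 * W + 60"
  define B where "B = 15 * W^4 + 96 * W^3 + 151 * W^2 - 30 * W - 116"
  define C where "C = (W + 1) * (9 * W^4 + 45 * W^3 + 40 * W^2 + 24 * W + 144)"
  note q = eisenstein_2_4_6_q_expansion
  have *: "has_q_expansion (\<lambda>z. 48 * A * serre_deriv_iter 3 (int w - 3) f z
      - B * (eisenstein 4 z * serre_deriv (int w - 3) f z) - 1/6 * C * (eisenstein 6 z * f z))
     (fps_const (48 * A) * (fps_const (1 / 12 ^ 3) * serre_fps_iter 3 (int w - 3) F)
      - fps_const B * (E4_fps * (fps_const (1/12) * serre_fps (int w - 3) F)) - fps_const (1/6 * C) * (E6_fps * F))"
    by (intro has_q_expansion_diff has_q_expansion_cmult has_q_expansion_mult has_q_expansion_serre_deriv_iter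
        has_q_expansion_serre_deriv q assms)
  have K: "K_up w f = (\<lambda>z. 48 * A * serre_deriv_iter 3 (int w - 3) f z
      - B * (eisenstein 4 z * serre_deriv (int w - 3) f z) - 1/6 * C * (eisenstein 6 z * f z))"
    by (rule ext) (simp only: K_up_def Let_def A_def B_def C_def W_def mult.assoc)
  have "of_int (7 * int w ^ 2 + 42 * int w + 60) = fps_const A"
     "of_int (3 * (15 * int w ^ 4 + 96 * int w ^ 3 + 151 * int w ^ 2 - 30 * int w - 116)) = fps_const (3 * B)"
     "of_int (6 * ((int w + 1) * (9 * int w ^ 4 + 45 * int w ^ 3 + 40 * int w ^ 2 + 24 * int w + 144))) = fps_const (6 * C)"
    unfolding fps_of_int[symmetric] by (simp_all add: A_def B_def C_def W_def)
  then have "fps_const (1/36) * K_fps (int w) F = fps_const (1/36) * (fps_const A * serre_fps_iter 3 (int w - 3) F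
      - fps_const (3 * B) * (E4_fps * serre_fps (int w - 3) F) - fps_const (6 * C) * (E6_fps * F))"
    by (simp only: K_fps_def)
  also have "\<dots> = fps_const (48 * A) * (fps_const (1 / 12 ^ 3) * serre_fps_iter 3 (int w - 3) F)
      - fps_const B * (E4_fps * (fps_const (1/12) * serre_fps (int w - 3) F)) - fps_const (1/6 * C) * (E6_fps * F)"
  proof -
    have "E4_fps * (fps_const (1/12) * S) = fps_const (1/12) * (E4_fps * S)" for S
      by (rule mult.left_commute)
    then show ?thesis by (simp add: right_diff_distrib mult.assoc[symmetric])
  qed
  finally show ?thesis using * K by simp
qed

lemma qmodform_K_up:
  assumes "qmodform (int w) f"
  shows "qmodform (int w + 6) (K_up w f)"
proof -
  define W where "W = (of_nat w :: complex)"
  define A where "A = 48 * (7 * W^2 + 42 * W + 60)"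
  define B where "B = 15 * W^4 + 96 * W^3 + 151 * W^2 - 30 * W - 116"
  define C where "C = 1/6 * (W + 1) * (9 * W^4 + 45 * W^3 + 40 * W^2 + 24 * W + 144)"
  have "qmodform (int w + 6) (\<lambda>z. A * serre_deriv_iter 3 (int w - 3) f z
      - B * (eisenstein 4 z * serre_deriv (int w - 3) f z) - C * (eisenstein 6 z * f z))"
    using qmodform_serre_deriv_iter[OF assms, of 3] qmodform_mult[OF qmodform_serre_deriv[OF assms] modform_E4]
      qmodform_mult[OF assms modform_E6]
    by (intro qmodform_diff qmodform_cmult) (simp_all add: add.assoc)
  also have "(\<lambda>z. A * serre_deriv_iter 3 (int w - 3) f z
      - B * (eisenstein 4 z * serre_deriv (int w - 3) f z) - C * (eisenstein 6 z * f z)) = K_up w f"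
    by (rule ext) (simp only: K_up_def Let_def A_def B_def C_def W_def mult.assoc)
  finally show ?thesis .
qed

section \<open>The extremal sequence\<close>

lemma serre_fps_cmult: "serre_fps k (fps_const c * F) = fps_const c * serre_fps k F"
  by (simp add: serre_fps_def D_fps_def algebra_simps)

lemma serre_fps_iter_cmult: "serre_fps_iter j k (fps_const c * F) = fps_const c * serre_fps_iter j k F"
  by (induction j) (simp_all add: serre_fps_cmult)

lemma mde_cmult: "mde w (fps_const c * F) = fps_const c * mde w F"
  unfolding mde_def serre_fps_iter_cmult serre_fps_cmult
  by (simp only: right_diff_distrib mult.left_commute[of _ "fps_const c"])

text \<open>Ramanujan's equations evaluate the Serre derivatives of 1 in the weights -3, -1, 1, 3.
  They verify the differential equation for \<open>f_0 = 1\<close>, and the third one also yields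
  the explicit formula for \<open>f_6\<close>.\<close>

lemma serre_iter_1:
  "serre_fps (-3) 1 = 3 * E2_fps"
  "serre_fps_iter 2 (-3) 1 = 6 * E2_fps ^ 2 - 3 * E4_fps"
  "serre_fps_iter 3 (-3) 1 = 6 * E2_fps ^ 3 - 21 * (E2_fps * E4_fps) + 12 * E6_fps"
  "serre_fps_iter 4 (-3) 1 = 120 * (E2_fps * E6_fps) - 60 * (E2_fps ^ 2 * E4_fps) - 51 * E4_fps ^ 2"
proof -
  have D: "12 * D_fps E2_fps = E2_fps ^ 2 - E4_fps" "12 * D_fps E4_fps = 4 * (E2_fps * E4_fps - E6_fps)"
    "12 * D_fps E6_fps = 6 * (E2_fps * E6_fps - E4_fps ^ 2)"
    using ramanujan_E2_fps ramanujan_E4_fps ramanujan_E6_fps by algebra+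
  have Dn: "D_fps (numeral n * F) = numeral n * D_fps F" for n F
    by (simp add: D_fps_def numeral_fps_const)
  have Dl: "D_fps (F - G) = D_fps F - D_fps G" "D_fps (F + G) = D_fps F + D_fps G" for F G
    by (simp_all add: D_fps_def algebra_simps)
  have Dz: "D_fps (numeral n) = 0" for n
    by (simp add: D_fps_def numeral_fps_const)
  show 1: "serre_fps (-3) 1 = 3 * E2_fps"
    by (simp add: serre_fps_def D_fps_def)
  have "serre_fps_iter 2 (-3) 1 = serre_fps (-1) (3 * E2_fps)"
    by (simp add: numeral_2_eq_2 1)
  also have "\<dots> = 6 * E2_fps ^ 2 - 3 * E4_fps"
    unfolding serre_fps_def Dn using D(1) by (simp add: Dz) algebra
  finally show 2: "serre_fps_iter 2 (-3) 1 = 6 * E2_fps ^ 2 - 3 * E4_fps" .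
  have "serre_fps_iter 3 (-3) 1 = serre_fps 1 (serre_fps_iter 2 (-3) 1)"
    by (simp add: numeral_eq_Suc)
  also have "\<dots> = 6 * E2_fps ^ 3 - 21 * (E2_fps * E4_fps) + 12 * E6_fps"
    unfolding 2 serre_fps_def Dn Dl power2_eq_square D_fps_mult using D(1,2) by (simp add: Dz) algebra
  finally show 3: "serre_fps_iter 3 (-3) 1 = 6 * E2_fps ^ 3 - 21 * (E2_fps * E4_fps) + 12 * E6_fps" .
  have "serre_fps_iter 4 (-3) 1 = serre_fps 3 (serre_fps_iter 3 (-3) 1)"
    by (simp add: numeral_eq_Suc)
  also have "\<dots> = 120 * (E2_fps * E6_fps) - 60 * (E2_fps ^ 2 * E4_fps) - 51 * E4_fps ^ 2"
    unfolding 3 serre_fps_def Dn Dl power3_eq_cube D_fps_mult using D by (simp add: Dz) algebra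
  finally show "serre_fps_iter 4 (-3) 1 = 120 * (E2_fps * E6_fps) - 60 * (E2_fps ^ 2 * E4_fps) - 51 * E4_fps ^ 2" .
qed

lemma mde_0_1: "mde 0 1 = 0"
  by (simp add: mde_def serre_iter_1 algebra_simps power2_eq_square)

definition extremal_const :: "nat \<Rightarrow> complex" where
  "extremal_const w = (let W = of_nat w in
     (W + 6)^3 / (2^2 * 3^7 * (W + 1) * (W + 2)^3 * (W + 4)^3 * (W + 5)))"

text \<open>Starting at weight 0 makes the base of every induction the constant 1 and turns
  \<open>f_6\<close> into an instance of the recursion. The divisor 36 undoes the scaling of
  \<open>K_fps\<close>.\<close>

fun extremal_fps :: "nat \<Rightarrow> complex fps" where
  "extremal_fps 0 = 1"
| "extremal_fps (Suc m) = fps_const (extremal_const (6 * m) / 36) * K_fps (6 * int m) (extremal_fps m)"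

fun extremal_form :: "nat \<Rightarrow> complex \<Rightarrow> complex" where
  "extremal_form 0 = (\<lambda>z. 1)"
| "extremal_form (Suc m) = (\<lambda>z. extremal_const (6 * m) * K_up (6 * m) (extremal_form m) z)"

lemma extremal_form_q_expansion: "has_q_expansion (extremal_form m) (extremal_fps m)"
proof (induction m)
  case 0
  show ?case using has_q_expansion_const[of 1] by simp
next
  case (Suc m)
  from has_q_expansion_cmult[OF has_q_expansion_K_up[OF Suc, of "6 * m"], of "extremal_const (6 * m)"]
  show ?case by (simp add: mult.assoc[symmetric])
qed

lemma qmodform_extremal_form: "qmodform (6 * int m) (extremal_form m)"
proof (induction m)
  case 0
  have "modform (- 2 * int l) ((\<lambda>l z. if l = 0 then 1 else 0) l) (if l = 0 then 1 else 0)" for l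
    using modform_const[of 1] modform_zero by (cases "l = 0") auto
  then show ?case unfolding qmodform_def
    by (intro exI[of _ "\<lambda>l z. if l = 0 then 1 else 0"] exI[of _ "\<lambda>l. if l = 0 then 1 else 0"])
      (auto simp: numeral_eq_Suc sum.atMost_Suc)
next
  case (Suc m)
  then show ?case using qmodform_cmult[OF qmodform_K_up[of "6 * m"]] by (simp add: algebra_simps)
qed

lemma mde_extremal_fps: "mde (6 * int m) (extremal_fps m) = 0"
proof (induction m)
  case (Suc m)
  have "6 * int (Suc m) = 6 * int m + 6" by simp
  then show ?case using mde_K_fps[OF Suc] by (simp only: extremal_fps.simps mde_cmult mult_zero_right)
qed (simp add: mde_0_1)

text \<open>The two coefficients that newly enter the window are unspecified; in the next induction
  step the differential equation determines them.\<close>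

lemma jet3_shift:
  assumes "jet3 n F 0 0 c"
  shows "\<exists>a b. jet3 (n + 2) F c a b"
proof -
  obtain G where G: "F = fps_X ^ n * G" "fps_nth G 0 = 0" "fps_nth G 1 = 0" "fps_nth G 2 = c"
    using assms by (auto simp: jet3_def)
  have "G = fps_X ^ 2 * fps_shift 2 G"
  proof (rule fps_ext)
    fix i
    show "fps_nth G i = fps_nth (fps_X ^ 2 * fps_shift 2 G) i"
      using G by (cases "i < 2") (auto simp: fps_X_power_mult_nth less_2_cases_iff simp del: add_2_eq_Suc')
  qed
  with G(1) have "F = fps_X ^ (n + 2) * fps_shift 2 G" by (metis power_add mult.assoc)
  then have "jet3 (n + 2) F c (fps_nth G 3) (fps_nth G 4)"
    unfolding jet3_def using G(4) by (intro exI[of _ "fps_shift 2 G"]) (simp add: numeral_eq_Suc)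
  then show ?thesis by blast
qed

lemma of_nat_add_numeral_nonzero: "(of_nat n + numeral k :: complex) \<noteq> 0" "(of_nat n + 1 :: complex) \<noteq> 0"
  by (metis add_eq_0_iff_both_eq_0 of_nat_add of_nat_eq_0_iff of_nat_numeral zero_neq_numeral)
     (metis add_eq_0_iff_both_eq_0 of_nat_add of_nat_eq_0_iff of_nat_1 zero_neq_one)

lemma jet3_extremal_fps: "\<exists>a b. jet3 (2 * m) (extremal_fps m) 1 a b"
proof (induction m)
  case 0
  show ?case by (auto simp: jet3_def intro!: exI[of _ 1])
next
  case (Suc m)
  then obtain a b where J: "jet3 (2 * m) (extremal_fps m) 1 a b" by blast
  define W where "W = (of_nat (6 * m) :: complex)"
  define P where "P = 2^2 * 3^7 * (W + 1) * (W + 2)^3 * (W + 4)^3 * (W + 5)"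
  have W: "W = 3 * of_nat (2 * m)" by (simp add: W_def)
  have "mde (3 * int (2 * m)) (extremal_fps m) = 0" using mde_extremal_fps[of m] by simp
  from jet3_K_fps[OF J this]
  have "jet3 (2 * m) (K_fps (6 * int m) (extremal_fps m)) 0 0 (36 * P / (W + 6)^3)"
    by (simp add: W P_def)
  from jet3_cmult[OF this, of "extremal_const (6 * m) / 36"]
  have "jet3 (2 * m) (extremal_fps (Suc m)) 0 0 (extremal_const (6 * m) / 36 * (36 * P / (W + 6)^3))"
    by simp
  moreover have "extremal_const (6 * m) / 36 * (36 * P / (W + 6)^3) = 1"
  proof -
    have "P \<noteq> 0" "(W + 6)^3 \<noteq> 0"
      unfolding P_def W_def by (simp_all only: mult_eq_0_iff power_eq_0_iff of_nat_add_numeral_nonzero simp_thms) simp_all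
    moreover have "extremal_const (6 * m) = (W + 6)^3 / P" by (simp add: extremal_const_def Let_def P_def W_def)
    ultimately show ?thesis by simp
  qed
  ultimately show ?case using jet3_shift[of "2 * m" "extremal_fps (Suc m)" 1] by simp
qed

section \<open>The intermediate forms of weight 6m+4\<close>

text \<open>Besides becoming \<open>f_(w+4)\<close>, these forms supply the odd vanishing orders in
  the dimension count, including order 1 at \<open>m = 0\<close>.\<close>

definition next_form :: "nat \<Rightarrow> complex \<Rightarrow> complex" where
  "next_form m z = (let W = of_nat (6 * m) in
     2 * (W + 3)^2 / (27 * (W + 1) * (W + 2)^3) *
       ((W + 1) * (3 * W + 1) / 48 * eisenstein 4 z * extremal_form m z
         - serre_deriv_iter 2 (6 * int m - 3) (extremal_form m) z))"

definition next_const :: "nat \<Rightarrow> complex" where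
  "next_const m = (let W = of_nat (6 * m) in 2 * (W + 3)^2 / (27 * (W + 1) * (W + 2)^3))"

definition next_fps :: "nat \<Rightarrow> complex fps" where
  "next_fps m = fps_const (next_const m / 144) * (of_int (3 * (6 * int m + 1) * (18 * int m + 1)) * (E4_fps * extremal_fps m)
       - serre_fps_iter 2 (6 * int m - 3) (extremal_fps m))"

lemma next_form_q_expansion: "has_q_expansion (next_form m) (next_fps m)"
proof -
  define c where "c = (of_nat (6 * m) + 1) * (3 * of_nat (6 * m) + 1) / (48 :: complex)"
  have "has_q_expansion (\<lambda>z. next_const m * (c * (eisenstein 4 z * extremal_form m z) - serre_deriv_iter 2 (6 * int m - 3) (extremal_form m) z))
    (fps_const (next_const m) * (fps_const c * (E4_fps * extremal_fps m) - fps_const (1 / 12 ^ 2) * serre_fps_iter 2 (6 * int m - 3) (extremal_fps m)))"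
    by (intro has_q_expansion_cmult has_q_expansion_diff has_q_expansion_mult eisenstein_2_4_6_q_expansion
        has_q_expansion_serre_deriv_iter extremal_form_q_expansion)
  moreover have "(\<lambda>z. next_const m * (c * (eisenstein 4 z * extremal_form m z) - serre_deriv_iter 2 (6 * int m - 3) (extremal_form m) z)) = next_form m"
    by (rule ext) (simp only: next_const_def next_form_def Let_def c_def mult.assoc)
  moreover have "of_int (3 * (6 * int m + 1) * (18 * int m + 1)) = fps_const (144 * c)"
    unfolding fps_of_int[symmetric] by (simp add: c_def)
  then have "next_fps m = fps_const (next_const m) * (fps_const c * (E4_fps * extremal_fps m) - fps_const (1 / 12 ^ 2) * serre_fps_iter 2 (6 * int m - 3) (extremal_fps m))"
    unfolding next_fps_def by (simp add: right_diff_distrib mult.assoc[symmetric])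
  ultimately show ?thesis by simp
qed

lemma qmodform_next_form: "qmodform (6 * int m + 4) (next_form m)"
proof -
  define c where "c = (of_nat (6 * m) + 1) * (3 * of_nat (6 * m) + 1) / (48 :: complex)"
  have "qmodform (6 * int m + 4) (\<lambda>z. next_const m * (c * (eisenstein 4 z * extremal_form m z) - serre_deriv_iter 2 (6 * int m - 3) (extremal_form m) z))"
    using qmodform_mult[OF qmodform_extremal_form[of m] modform_E4] qmodform_serre_deriv_iter[OF qmodform_extremal_form[of m], of 2]
    by (intro qmodform_cmult qmodform_diff) simp_all
  moreover have "(\<lambda>z. next_const m * (c * (eisenstein 4 z * extremal_form m z) - serre_deriv_iter 2 (6 * int m - 3) (extremal_form m) z)) = next_form m"
    by (rule ext) (simp only: next_const_def next_form_def Let_def c_def mult.assoc)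
  ultimately show ?thesis by simp
qed

lemma jet3_nth: "jet3 n F a b c \<Longrightarrow> fps_nth F n = a" "jet3 n F a b c \<Longrightarrow> fps_nth F (Suc n) = b"
  "jet3 n F a b c \<Longrightarrow> i < n \<Longrightarrow> fps_nth F i = 0"
  by (auto simp: jet3_def fps_X_power_mult_nth)

lemma next_fps_nth: "fps_nth (next_fps m) (2 * m + 1) = 1" "\<And>i. i \<le> 2 * m \<Longrightarrow> fps_nth (next_fps m) i = 0"
proof -
  obtain a b where J: "jet3 (2 * m) (extremal_fps m) 1 a b" using jet3_extremal_fps by blast
  define W where "W = (of_nat (6 * m) :: complex)"
  have W: "W = 3 * of_nat (2 * m)" by (simp add: W_def)
  have "mde (3 * int (2 * m)) (extremal_fps m) = 0" using mde_extremal_fps[of m] by simp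
  from jet3_next[OF J this] obtain c where
    "jet3 (2 * m) (of_int (3 * (6 * int m + 1) * (18 * int m + 1)) * (E4_fps * extremal_fps m) - serre_fps_iter 2 (6 * int m - 3) (extremal_fps m)) 0
    (144 * (27 * (W + 1) * (W + 2)^3) / (2 * (W + 3)^2)) c"
    by (auto simp: W)
  from jet3_cmult[OF this, of "next_const m / 144"]
  have J': "jet3 (2 * m) (next_fps m) 0 (next_const m / 144 * (144 * (27 * (W + 1) * (W + 2)^3) / (2 * (W + 3)^2))) (next_const m / 144 * c)"
    by (simp add: next_fps_def)
  have "27 * (W + 1) * (W + 2)^3 \<noteq> 0" "2 * (W + 3)^2 \<noteq> 0"
    unfolding W_def by (simp_all only: mult_eq_0_iff power_eq_0_iff of_nat_add_numeral_nonzero simp_thms) simp_all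
  moreover have "next_const m = 2 * (W + 3)^2 / (27 * (W + 1) * (W + 2)^3)"
    by (simp add: next_const_def W_def Let_def)
  moreover have "q / p / 144 * (144 * p / q) = 1" if "p \<noteq> 0" "q \<noteq> 0" for p q :: complex using that by simp
  ultimately have "next_const m / 144 * (144 * (27 * (W + 1) * (W + 2)^3) / (2 * (W + 3)^2)) = 1" by simp
  then show "fps_nth (next_fps m) (2 * m + 1) = 1" using jet3_nth(2)[OF J'] by simp
  show "fps_nth (next_fps m) i = 0" if "i \<le> 2 * m" for i
    using jet3_nth(1,3)[OF J'] that by (cases "i = 2 * m") auto
qed

subsection \<open>Uniqueness\<close>

lemma serre_fps_nth_lowest:
  assumes "\<And>i. i < n \<Longrightarrow> fps_nth F i = 0"
  shows "fps_nth (serre_fps k F) n = (12 * of_nat n - of_int k) * fps_nth F n"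
    and "i < n \<Longrightarrow> fps_nth (serre_fps k F) i = 0"
proof -
  have m: "fps_nth (E2_fps * F) i = (if i = n then fps_nth F n else 0)" if "i \<le> n" for i
  proof -
    have "fps_nth (E2_fps * F) i = (\<Sum>j=0..i. if j = 0 then fps_nth F i else 0)"
      unfolding fps_mult_nth by (rule sum.cong) (use assms that in auto)
    then show ?thesis using assms that by (simp add: sum.delta)
  qed
  have e: "fps_nth (serre_fps k F) i = 12 * (of_nat i * fps_nth F i) - of_int k * fps_nth (E2_fps * F) i" for i
    by (simp add: serre_fps_def D_fps_nth fps_of_int[symmetric])
  show "fps_nth (serre_fps k F) n = (12 * of_nat n - of_int k) * fps_nth F n"
    using m[of n] by (simp add: e algebra_simps)
  show "i < n \<Longrightarrow> fps_nth (serre_fps k F) i = 0"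
    using m[of i] assms by (simp add: e)
qed

definition has_order :: "(complex \<Rightarrow> complex) \<Rightarrow> nat \<Rightarrow> bool" where
  "has_order f n \<longleftrightarrow> (\<exists>F. has_q_expansion f F \<and> fps_nth F n \<noteq> 0 \<and> (\<forall>i<n. fps_nth F i = 0))"

lemma has_order_mult_eisenstein:
  assumes "has_order f n"
  shows "has_order (\<lambda>z. (eisenstein 4 z ^ a * eisenstein 6 z ^ b) * f z) n"
proof -
  obtain F where F: "has_q_expansion f F" "fps_nth F n \<noteq> 0" "\<forall>i<n. fps_nth F i = 0"
    using assms by (auto simp: has_order_def)
  define E where "E = E4_fps ^ a * E6_fps ^ b"
  have E0: "fps_nth E 0 = 1" by (simp add: E_def fps_power_zeroth)
  have m: "fps_nth (E * F) i = (if i = n then fps_nth F n else 0)" if "i \<le> n" for i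
  proof -
    have "fps_nth (E * F) i = (\<Sum>j=0..i. if j = 0 then fps_nth F i else 0)"
      unfolding fps_mult_nth by (rule sum.cong) (use F that E0 in auto)
    then show ?thesis using F that by (simp add: sum.delta)
  qed
  have "has_q_expansion (\<lambda>z. (eisenstein 4 z ^ a * eisenstein 6 z ^ b) * f z) (E * F)"
    unfolding E_def by (intro has_q_expansion_mult has_q_expansion_power eisenstein_2_4_6_q_expansion F)
  then show ?thesis using m F(2) unfolding has_order_def by (intro exI[of _ "E * F"]) auto
qed

lemma has_order_serre_deriv:
  assumes "has_order f n" "12 * int n \<noteq> k"
  shows "has_order (serre_deriv k f) n"
proof -
  obtain F where F: "has_q_expansion f F" "fps_nth F n \<noteq> 0" "\<forall>i<n. fps_nth F i = 0"
    using assms by (auto simp: has_order_def)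
  have "12 * of_nat n - of_int k = (of_int (12 * int n - k) :: complex)" by simp
  then have "12 * of_nat n - of_int k \<noteq> (0 :: complex)" using assms(2) by (simp only: of_int_eq_0_iff)
  then show ?thesis
    using has_q_expansion_serre_deriv[OF F(1) eisenstein_2_4_6_q_expansion(1), of k] serre_fps_nth_lowest[of n F] F(2,3)
    unfolding has_order_def by (intro exI[of _ "fps_const (1/12) * serre_fps k F"]) auto
qed

lemma has_order_extremal_form: "has_order (extremal_form m) (2 * m)"
proof -
  obtain a b where "jet3 (2 * m) (extremal_fps m) 1 a b" using jet3_extremal_fps by blast
  from jet3_nth(1,3)[OF this] show ?thesis
    unfolding has_order_def using extremal_form_q_expansion by (intro exI[of _ "extremal_fps m"]) auto
qed

lemma has_order_next_form: "has_order (next_form m) (2 * m + 1)"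
  unfolding has_order_def using next_form_q_expansion next_fps_nth by (intro exI[of _ "next_fps m"]) auto

text \<open>A form of order \<open>n\<close> exists in weight \<open>6 m\<close> or
  \<open>6 m + 4\<close>, and monomials in \<open>E4\<close> and \<open>E6\<close> raise the weight
  without changing the order. A gap of exactly 2, which no monomial fills, is bridged by a Serre
  derivative; it keeps the order because \<open>12 n\<close> is even and \<open>v - 3\<close> is
  odd.\<close>

lemma exists_qmodform_of_order:
  fixes w n :: nat
  assumes w: "even w" and n: "3 * n \<le> w"
  obtains f where "qmodform (int w) f" "has_order f n"
proof -
  have step: "\<exists>f. qmodform (int w) f \<and> has_order f n"
    if g: "qmodform (int v) g" "has_order g n" "even v" "v \<le> w" "12 * int n \<noteq> int v - 3" for v g
  proof (cases "w = v + 2")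
    case True
    then show ?thesis using qmodform_serre_deriv[OF g(1)] has_order_serre_deriv[OF g(2,5)]
      by (intro exI[of _ "serre_deriv (int v - 3) g"]) (simp add: add.commute)
  next
    case False
    then obtain a b where "int (4 * a + 6 * b) = int w - int v"
      using exists_eisenstein_monomial[of "int w - int v"] g(3,4) w by auto
    from qmodform_mult[OF g(1) modform_eisenstein_monomial[OF this]] has_order_mult_eisenstein[OF g(2), of a b]
    show ?thesis by auto
  qed
  show ?thesis
  proof (cases "even n")
    case True
    then obtain m where m: "n = 2 * m" by blast
    have "qmodform (int (6 * m)) (extremal_form m)" using qmodform_extremal_form[of m] by simp
    from step[OF this] show ?thesis using has_order_extremal_form[of m] m n that by auto
  next
    case False
    then obtain m where m: "n = 2 * m + 1" by (elim oddE)
    have "qmodform (int (6 * m + 4)) (next_form m)" using qmodform_next_form[of m] by simp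
    \<comment> \<open>From \<open>w \<ge> 3 n = 6 m + 3\<close>, parity of \<open>w\<close> gains
      the missing 1.\<close>
    moreover have "6 * m + 4 \<le> w" using m n w by presburger
    ultimately have "\<exists>f. qmodform (int w) f \<and> has_order f n"
      using has_order_next_form[of m] m by (intro step) auto
    then show ?thesis using that by blast
  qed
qed

text \<open>The element of smallest order \<open>i\<close> is adjoined last: the others lie in the
  subspace \<open>V\<close> of functions whose expansion vanishes through \<open>q^i\<close>, and it
  does not.\<close>

lemma independent_of_distinct_orders:
  assumes "finite I" "\<And>i. i \<in> I \<Longrightarrow> has_order (h i) i"
  shows "\<not> cfun.dependent (h ` I) \<and> card (h ` I) = card I"
  using assms
proof (induction I rule: finite_linorder_min_induct)
  case (insert i I)
  define V where "V = {f. \<exists>F. has_q_expansion f F \<and> (\<forall>j\<le>i. fps_nth F j = 0)}"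
  have "cfun.subspace V"
    unfolding cfun.subspace_def
  proof safe
    show "0 \<in> V" unfolding V_def using has_q_expansion_const[of 0] by (auto simp: zero_fun_def intro!: exI[of _ 0])
  next
    fix x y assume "x \<in> V" "y \<in> V"
    then obtain X Y where "has_q_expansion x X" "has_q_expansion y Y" "\<forall>j\<le>i. fps_nth X j = 0" "\<forall>j\<le>i. fps_nth Y j = 0"
      by (auto simp: V_def)
    then show "x + y \<in> V" unfolding V_def plus_fun_def using has_q_expansion_add by (intro CollectI exI[of _ "X + Y"]) auto
  next
    fix c x assume "x \<in> V"
    then obtain X where "has_q_expansion x X" "\<forall>j\<le>i. fps_nth X j = 0" by (auto simp: V_def)
    then show "(\<lambda>z. c * x z) \<in> V" unfolding V_def using has_q_expansion_cmult by (intro CollectI exI[of _ "fps_const c * X"]) auto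
  qed
  moreover have "h ` I \<subseteq> V"
    using insert.hyps insert.prems unfolding V_def has_order_def by (fastforce intro: le_less_trans)
  ultimately have "cfun.span (h ` I) \<subseteq> V" by (intro cfun.span_minimal)
  moreover have "h i \<notin> V"
    using insert.prems[of i] has_q_expansion_unique unfolding V_def has_order_def by blast
  ultimately have ni: "h i \<notin> cfun.span (h ` I)" by blast
  moreover from this have "h i \<notin> h ` I" using cfun.span_base by blast
  ultimately show ?case
    using insert cfun.independent_insertI[OF ni] by auto
qed (use cfun.independent_empty in auto)

text \<open>The dimensions in weights \<open>w\<close>, \<open>w - 2\<close>, \<open>w - 4\<close>
  and \<open>w - 6\<close> add up to \<open>w div 3 + 1\<close>, checked for each even residue of
  \<open>w\<close> modulo 12.\<close>

lemma quasimodular_forms_finite_span: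
  assumes "even w"
  obtains B where "finite B" "card B \<le> w div 3 + 1" "quasimodular_forms 3 (int w) \<subseteq> cfun.span B"
proof -
  have "\<forall>l. \<exists>B. finite B \<and> card B \<le> modular_dim (int w - 2 * int l) \<and> modular_forms (int w - 2 * int l) \<subseteq> cfun.span B"
    using assms by (intro allI modular_forms_finite_span) simp
  from choice[OF this] obtain B where B: "\<And>l. finite (B l)" "\<And>l. card (B l) \<le> modular_dim (int w - 2 * int l)"
    "\<And>l. modular_forms (int w - 2 * int l) \<subseteq> cfun.span (B l)" by blast
  define T where "T = (\<lambda>(l :: nat) (g :: complex \<Rightarrow> complex) z. eisenstein 2 z ^ l * g z)"
  define S where "S = (\<Union>l\<le>3. T l ` B l)"
  have "finite S" using B(1) by (auto simp: S_def)
  moreover have "card S \<le> w div 3 + 1"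
  proof -
    have "card S \<le> (\<Sum>l\<le>3. card (T l ` B l))" unfolding S_def by (rule card_UN_le) simp
    also have "\<dots> \<le> (\<Sum>l\<le>3. modular_dim (int w - 2 * int l))"
      by (intro sum_mono order.trans[OF card_image_le B(2)] B(1))
    also have "\<dots> = modular_dim (int w) + modular_dim (int w - 2) + modular_dim (int w - 4) + modular_dim (int w - 6)"
      by (simp add: numeral_eq_Suc sum.atMost_Suc)
    also have "\<dots> = w div 3 + 1"
    proof -
      obtain v where v: "w = 2 * v" using assms by blast
      define q r where "q = v div 6" and "r = v mod 6"
      have "v = 6 * q + r" by (simp add: q_def r_def)
      then have w: "w = 12 * q + 2 * r" "r < 6" by (simp_all add: v r_def)
      have d: "modular_dim (12 * int a + int b) = (if b = 2 then a else a + 1)" if "b < 12" for a b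
        using that by (auto simp: modular_dim_def)
      have neg: "modular_dim k = 0" if "k < 0" for k using that by (simp add: modular_dim_def)
      \<comment> \<open>The exceptional residue 2 occurs at \<open>k = 10\<close>. For
        \<open>q = 0\<close> truncated subtraction gives 0 in both branches, in agreement with
        negative weights.\<close>
      have dq: "modular_dim (12 * int q - k) = (if k = 10 then q - 1 else q)" if "0 < k" "k < 12" for k
      proof (cases q)
        case 0
        then show ?thesis using that by (simp add: neg)
      next
        case (Suc p)
        then have e: "12 * int q - k = 12 * int p + int (nat (12 - k))" using that by simp
        have "nat (12 - k) < 12" "nat (12 - k) = 2 \<longleftrightarrow> k = 10" using that by auto
        then show ?thesis unfolding e using d[of "nat (12 - k)" p] Suc by (simp only:) simp
      qed
      have w3: "w div 3 = 4 * q + (2 * r) div 3" using w(1) by presburger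
      have "r = 0 \<or> r = 1 \<or> r = 2 \<or> r = 3 \<or> r = 4 \<or> r = 5" using w(2) by auto
      then show ?thesis
        using d[of 0 q] d[of 2 q] d[of 4 q] d[of 6 q] d[of 8 q] d[of 10 q] dq[of 2] dq[of 4] dq[of 6]
        unfolding w3 by (elim disjE) (simp_all add: w(1) add.commute)
    qed
    finally show ?thesis .
  qed
  moreover have "f \<in> cfun.span S" if f: "f \<in> quasimodular_forms 3 (int w)" for f
  proof -
    obtain g where g: "\<forall>l\<le>3. g l \<in> modular_forms (int w - 2 * int l)" "f = (\<lambda>z. \<Sum>l\<le>3. eisenstein 2 z ^ l * g l z)"
      using f by (auto simp: quasimodular_forms_def)
    have "T l (g l) \<in> cfun.span S" if "l \<le> 3" for l
    proof -
      have "g l \<in> cfun.span (B l)" using g(1) B(3) that by blast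
      then have "T l (g l) \<in> cfun.span (T l ` B l)"
        by (rule cfun_span_image) (auto simp: T_def fun_eq_iff algebra_simps)
      then show ?thesis using cfun.span_mono[of "T l ` B l" S] that unfolding S_def by blast
    qed
    then have "(\<Sum>l\<le>3. T l (g l)) \<in> cfun.span S" by (intro cfun.span_sum) auto
    also have "(\<Sum>l\<le>3. T l (g l)) = f" by (simp add: g(2) T_def fun_eq_iff numeral_eq_Suc sum.atMost_Suc)
    finally show ?thesis .
  qed
  ultimately show ?thesis using that by blast
qed

text \<open>Forms of the orders 0 to \<open>w div 3\<close> are already as many as the spanning set
  permits, so they form a basis. A nonzero form of higher order would be one independent element too
  many.\<close>

lemma
  assumes w: "even (w :: nat)"
  shows dim_quasimodular_forms: "cfun.dim (quasimodular_forms 3 (int w)) = w div 3 + 1"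
    and quasimodular_form_vanishing:
      "\<And>f F z. qmodform (int w) f \<Longrightarrow> has_q_expansion f F \<Longrightarrow> (\<And>i. i \<le> w div 3 \<Longrightarrow> fps_nth F i = 0) \<Longrightarrow>
         z \<in> upper_half_plane \<Longrightarrow> f z = 0"
proof -
  obtain B where B: "finite B" "card B \<le> w div 3 + 1" "quasimodular_forms 3 (int w) \<subseteq> cfun.span B"
    using quasimodular_forms_finite_span[OF w] by blast
  have "\<forall>n. \<exists>f. n \<le> w div 3 \<longrightarrow> qmodform (int w) f \<and> has_order f n"
    using exists_qmodform_of_order[OF w] by (metis nat_mult_le_cancel_disj mult.commute div_times_less_eq_dividend order.trans)
  from choice[OF this] obtain h where h: "\<And>n. n \<le> w div 3 \<Longrightarrow> qmodform (int w) (h n)" "\<And>n. n \<le> w div 3 \<Longrightarrow> has_order (h n) n"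
    by blast
  have order_cut: "has_order (cut f) n \<longleftrightarrow> has_order f n" for f n
    unfolding has_order_def using has_q_expansion_cong[of "cut f" f] by simp
  have bound: "card I \<le> w div 3 + 1"
    if I: "finite I" "\<And>i. i \<in> I \<Longrightarrow> qmodform (int w) (g i) \<and> has_order (g i) i" for g and I :: "nat set"
  proof -
    have "\<not> cfun.dependent ((\<lambda>i. cut (g i)) ` I) \<and> card ((\<lambda>i. cut (g i)) ` I) = card I"
      using I by (intro independent_of_distinct_orders) (auto simp: order_cut)
    moreover have "(\<lambda>i. cut (g i)) ` I \<subseteq> cfun.span B"
      using I(2) B(3) quasimodular_forms_iff by blast
    ultimately show ?thesis using cfun.independent_span_bound[OF B(1)] B(2) by (metis order.trans)
  qed
  show "f z = 0" if f: "qmodform (int w) f" "has_q_expansion f F" "\<And>i. i \<le> w div 3 \<Longrightarrow> fps_nth F i = 0"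
    and z: "z \<in> upper_half_plane" for f F z
  proof (rule ccontr)
    assume "f z \<noteq> 0"
    then have "F \<noteq> 0" using has_q_expansion_eval[OF f(2) z] by auto
    define n where "n = subdegree F"
    have n: "fps_nth F n \<noteq> 0" using \<open>F \<noteq> 0\<close> by (simp add: n_def)
    then have gt: "n > w div 3" using f(3) not_less by blast
    have "has_order f n" unfolding has_order_def using f(2) n by (auto simp: n_def)
    then have "card (insert n {..w div 3}) \<le> w div 3 + 1"
      using h f(1) gt by (intro bound[where g = "\<lambda>i. if i = n then f else h i"]) auto
    then show False using gt by simp
  qed
  define C where "C = (\<lambda>n. cut (h n)) ` {..w div 3}"
  have C: "\<not> cfun.dependent C" "card C = w div 3 + 1"
    using independent_of_distinct_orders[of "{..w div 3}" "\<lambda>n. cut (h n)"] h(2) by (simp_all add: C_def order_cut)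
  have "C \<subseteq> quasimodular_forms 3 (int w)" using h(1) quasimodular_forms_iff by (auto simp: C_def)
  moreover have "quasimodular_forms 3 (int w) \<subseteq> cfun.span C"
  proof (rule ccontr)
    assume "\<not> ?thesis"
    then obtain x where x: "x \<in> quasimodular_forms 3 (int w)" "x \<notin> cfun.span C" by blast
    have "\<not> cfun.dependent (insert x C)" using cfun.independent_insertI x C by blast
    moreover have "insert x C \<subseteq> cfun.span B" using x \<open>C \<subseteq> _\<close> B(3) by blast
    ultimately have "card (insert x C) \<le> card B" using cfun.independent_span_bound[OF B(1)] by blast
    moreover have "x \<notin> C" using x(2) cfun.span_base by blast
    moreover have "finite C" by (simp add: C_def)
    ultimately show False using C(2) B(2) by simp
  qed
  ultimately show "cfun.dim (quasimodular_forms 3 (int w)) = w div 3 + 1"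
    using cfun.dim_unique C by blast
qed

lemma extremal_unique:
  fixes w :: nat
  assumes w: "even w" and f: "normalized_extremal 3 (int w) f"
    and g: "qmodform (int w) g" "has_q_expansion g G" "\<And>i. i < w div 3 \<Longrightarrow> fps_nth G i = 0" "fps_nth G (w div 3) = 1"
    and z: "z \<in> upper_half_plane"
  shows "f z = g z"
proof -
  obtain F where F: "has_q_expansion f F" "subdegree F = w div 3" "fps_nth F (subdegree F) = 1"
    using f by (auto simp: normalized_extremal_def dim_quasimodular_forms[OF w])
  have f': "f \<in> quasimodular_forms 3 (int w)" using f by (simp add: normalized_extremal_def)
  then have "qmodform (int w) f" using quasimodular_forms_cut quasimodular_forms_iff by metis
  then have "qmodform (int w) (\<lambda>z. f z - g z)" using g(1) by (rule qmodform_diff)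
  moreover have "has_q_expansion (\<lambda>z. f z - g z) (F - G)" using F(1) g(2) by (rule has_q_expansion_diff)
  moreover have "fps_nth (F - G) i = 0" if "i \<le> w div 3" for i
    using that F(2,3) g(3,4) nth_less_subdegree_zero[of i F] by (cases "i = w div 3") auto
  ultimately have "f z - g z = 0" using quasimodular_form_vanishing[OF w _ _ _ z] by blast
  then show ?thesis by simp
qed

section \<open>Identification of the extremal forms\<close>

lemma extremal_eq_extremal_form:
  assumes "normalized_extremal 3 (int (6 * m)) f" "z \<in> upper_half_plane"
  shows "f z = extremal_form m z"
proof -
  obtain a b where J: "jet3 (2 * m) (extremal_fps m) 1 a b" using jet3_extremal_fps by blast
  show ?thesis
    by (rule extremal_unique[OF _ assms(1) _ extremal_form_q_expansion _ _ assms(2)])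
       (use jet3_nth[OF J] qmodform_extremal_form[of m] in auto)
qed

text \<open>The recursion at weight 0: \<open>K_fps 0 1\<close> is 72 times the bracket, and
  \<open>216 / (2^2 * 3^7 * 8 * 64 * 5) / 36 * 72 = 1 / 51840\<close>.\<close>

lemma extremal_form_1:
  assumes z: "z \<in> upper_half_plane"
  shows "extremal_form 1 z = (5 * eisenstein 2 z ^ 3 - 3 * eisenstein 2 z * eisenstein 4 z - 2 * eisenstein 6 z) / 51840"
proof -
  have "K_fps 0 1 = fps_const 72 * (fps_const 5 * E2_fps ^ 3 - fps_const 3 * (E2_fps * E4_fps) - fps_const 2 * E6_fps)"
    by (simp add: K_fps_def serre_iter_1 numeral_fps_const[symmetric] algebra_simps)
  then have "extremal_fps 1 = fps_const (1 / 51840) * (fps_const 5 * E2_fps ^ 3 - fps_const 3 * (E2_fps * E4_fps) - fps_const 2 * E6_fps)"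
    by (simp add: extremal_const_def mult.assoc[symmetric])
  moreover have "has_q_expansion (\<lambda>z. 1 / 51840 * (5 * eisenstein 2 z ^ 3 - 3 * (eisenstein 2 z * eisenstein 4 z) - 2 * eisenstein 6 z))
      (fps_const (1 / 51840) * (fps_const 5 * E2_fps ^ 3 - fps_const 3 * (E2_fps * E4_fps) - fps_const 2 * E6_fps))"
    by (intro has_q_expansion_cmult has_q_expansion_diff has_q_expansion_mult has_q_expansion_power eisenstein_2_4_6_q_expansion)
  ultimately show ?thesis
    using has_q_expansion_eval[OF extremal_form_q_expansion[of 1] z] has_q_expansion_eval[OF _ z] by fastforce
qed

theorem proposition6p3:
  fixes f :: "nat \<Rightarrow> complex \<Rightarrow> complex"
  assumes extremal: "\<And>w. even w \<Longrightarrow> w \<ge> 6 \<Longrightarrow> normalized_extremal 3 (int w) (f w)"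
  shows "(\<forall>z\<in>upper_half_plane. f 6 z =
            (5 * eisenstein 2 z ^ 3 - 3 * eisenstein 2 z * eisenstein 4 z - 2 * eisenstein 6 z)
              / 51840) \<and>
         (\<forall>w \<ge> 6. w mod 6 = 0 \<longrightarrow> (\<forall>z\<in>upper_half_plane. let W = of_nat w :: complex in
            f (w + 6) z =
              (W + 6)^3 / (2^2 * 3^7 * (W + 1) * (W + 2)^3 * (W + 4)^3 * (W + 5)) * K_up w (f w) z)) \<and>
         (\<forall>w \<ge> 6. w mod 6 = 0 \<longrightarrow> (\<forall>z\<in>upper_half_plane. let W = of_nat w :: complex in
            f (w + 2) z = 4 / (W + 1) * serre_deriv (int w - 3) (f w) z \<and>
            f (w + 4) z =
              2 * (W + 3)^2 / (27 * (W + 1) * (W + 2)^3) *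
                ((W + 1) * (3 * W + 1) / 48 * eisenstein 4 z * f w z
                 - serre_deriv_iter 2 (int w - 3) (f w) z)))"
proof (intro conjI ballI allI impI)
  fix z assume z: "z \<in> upper_half_plane"
  have "f 6 z = extremal_form 1 z"
    using extremal_eq_extremal_form[of 1 "f 6"] extremal[of 6] z by simp
  then show "f 6 z = (5 * eisenstein 2 z ^ 3 - 3 * eisenstein 2 z * eisenstein 4 z - 2 * eisenstein 6 z) / 51840"
    using extremal_form_1[OF z] by simp
next
  fix w :: nat and z assume w: "w \<ge> 6" "w mod 6 = 0" and z: "z \<in> upper_half_plane"
  then obtain m where m: "w = 6 * m" "m \<ge> 1" by auto
  have fw: "f w x = extremal_form m x" if "x \<in> upper_half_plane" for x
    using extremal_eq_extremal_form[of m "f w"] extremal[of w] m that by simp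
  have "f (w + 6) z = extremal_form (Suc m) z"
    using extremal_eq_extremal_form[of "Suc m" "f (w + 6)"] extremal[of "w + 6"] m z by (simp add: algebra_simps)
  moreover have "K_up w (extremal_form m) z = K_up w (f w) z"
    unfolding K_up_def Let_def
    using serre_deriv_iter_cong[of "f w" "extremal_form m" z 3, OF fw z] serre_deriv_cong[of "f w" "extremal_form m" z, OF fw z] fw[OF z]
    by simp
  ultimately show "let W = of_nat w :: complex in
            f (w + 6) z =
              (W + 6)^3 / (2^2 * 3^7 * (W + 1) * (W + 2)^3 * (W + 4)^3 * (W + 5)) * K_up w (f w) z"
    by (simp add: Let_def extremal_const_def m(1))
next
  fix w :: nat and z assume w: "w \<ge> 6" "w mod 6 = 0" and z: "z \<in> upper_half_plane"
  then obtain m where m: "w = 6 * m" "m \<ge> 1" by auto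
  have fw: "f w x = extremal_form m x" if "x \<in> upper_half_plane" for x
    using extremal_eq_extremal_form[of m "f w"] extremal[of w] m that by simp
  obtain a b where J: "jet3 (2 * m) (extremal_fps m) 1 a b" using jet3_extremal_fps by blast
  define W where "W = (of_nat w :: complex)"
  have W: "W + 1 \<noteq> 0" unfolding W_def by (rule of_nat_add_numeral_nonzero)
  define g where "g = (\<lambda>z. 4 / (W + 1) * serre_deriv (int w - 3) (extremal_form m) z)"
  define G where "G = fps_const (4 / (W + 1)) * (fps_const (1/12) * serre_fps (int w - 3) (extremal_fps m))"
  have "f (w + 2) z = g z"
  proof (rule extremal_unique[OF _ extremal _ _ _ _ z])
    show "qmodform (int (w + 2)) g"
      unfolding g_def using qmodform_cmult[OF qmodform_serre_deriv[OF qmodform_extremal_form[of m]], of "4 / (W + 1)"] m by (simp add: add.commute)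
    show "has_q_expansion g G"
      unfolding g_def G_def
      by (intro has_q_expansion_cmult has_q_expansion_serre_deriv extremal_form_q_expansion eisenstein_2_4_6_q_expansion)
    \<comment> \<open>The required order does not grow from \<open>w\<close> to
      \<open>w + 2\<close>, so the leading term of the Serre derivative only has to be
      normalised.\<close>
    have d: "(w + 2) div 3 = 2 * m" using m by simp
    show "fps_nth G i = 0" if "i < (w + 2) div 3" for i
      using serre_fps_nth_lowest(2)[of "2 * m" "extremal_fps m"] jet3_nth(3)[OF J] that d by (simp add: G_def)
    have "fps_nth G (2 * m) = 4 / (W + 1) * (1/12 * ((12 * of_nat (2 * m) - of_int (int w - 3)) * 1))"
      using serre_fps_nth_lowest(1)[of "2 * m" "extremal_fps m"] jet3_nth(1,3)[OF J] by (simp add: G_def)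
    \<comment> \<open>Since \<open>12 * w / 3 - (w - 3) = 3 (w + 1)\<close>, dividing by 12 leaves
      \<open>(w + 1) / 4\<close>; hence the factor \<open>4 / (w + 1)\<close>.\<close>
    also have "12 * of_nat (2 * m) - of_int (int w - 3) = 3 * (W + 1)" by (simp add: W_def m)
    also have "4 / x * (1/12 * (3 * x * 1)) = 1" if "x \<noteq> 0" for x :: complex using that by simp
    from this[OF W] have "4 / (W + 1) * (1/12 * (3 * (W + 1) * 1)) = 1" .
    finally show "fps_nth G ((w + 2) div 3) = 1" unfolding d .
  qed (use w m in auto)
  moreover have "f (w + 4) z = next_form m z"
  proof (rule extremal_unique[OF _ extremal _ next_form_q_expansion _ _ z])
    show "qmodform (int (w + 4)) (next_form m)" using qmodform_next_form[of m] m by simp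
    \<comment> \<open>Here the order must grow by one, which is what the cancellation in
      \<open>jet3_next\<close> achieves.\<close>
    have d: "(w + 4) div 3 = 2 * m + 1" using m by simp
    show "fps_nth (next_fps m) i = 0" if "i < (w + 4) div 3" for i using next_fps_nth(2)[of i m] that d by simp
    show "fps_nth (next_fps m) ((w + 4) div 3) = 1" using next_fps_nth(1)[of m] d by simp
  qed (use w m in auto)
  ultimately show "let W = of_nat w :: complex in
            f (w + 2) z = 4 / (W + 1) * serre_deriv (int w - 3) (f w) z \<and>
            f (w + 4) z =
              2 * (W + 3)^2 / (27 * (W + 1) * (W + 2)^3) *
                ((W + 1) * (3 * W + 1) / 48 * eisenstein 4 z * f w z
                 - serre_deriv_iter 2 (int w - 3) (f w) z)"
    using serre_deriv_iter_cong[of "f w" "extremal_form m" z 2, OF fw z] serre_deriv_cong[of "f w" "extremal_form m" z, OF fw z] fw[OF z]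
    by (simp add: Let_def g_def W_def next_form_def m(1))
qed

end
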